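(* Let $p$ be a prime, $\chi$ a non-trivial multiplicative (Dirichlet) character modulo $p$, $a,b$ integers with $\gcd(ab,p)=1$, $r$ a positive integer, and $K,M,N>1$ real numbers with $p>\max\{K,M,N\}$. Let $\boldsymbol\beta=(\beta_{k,n})$ be arbitrary complex weights indexed by integers $1\leqslant k\leqslant K$, $1\leqslant n\leqslant N$, and put $\|\boldsymbol\beta\|_\infty=\max_{k,n}|\beta_{k,n}|$. Define $$\mathfrak{T}=\sum_{1\leqslant k\leqslant K}\ \sum_{1\leqslant m\leqslant M}\ \sum_{1\leqslant n\leqslant N}\beta_{k,n}\chi(ak+bmn),\qquad \mathscr{L}_1=|a|K+|b|MN.$$ If $M>4p^{\frac{1}{2r}}$, then $$|\mathfrak{T}|\leqslant \|\boldsymbol\beta\|_\infty KMN\,\Delta_1\,p^{o(1)},\qquad \Delta_1=\Big(1+\frac{N}{K}\Big)^{\frac{1}{2r}}\Big(1+\mathscr{L}_1MNp^{-1-\frac{1}{2r}}\Big)^{\frac{1}{2r}}\Big(\frac{p^{1+\frac{1}{r}}}{M^4N^4}\Big)^{\frac{1}{4r}}.$$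
   Context: Here $p^{o(1)}$ means: for every $\varepsilon>0$ there is $p_0$ depending only on $\varepsilon$ and $r$ such that for all primes $p\geqslant p_0$ the bound holds with $p^{o(1)}$ replaced by $p^{\varepsilon}$, uniformly over $\chi$, $a$, $b$, $K$, $M$, $N$ and the weights $\boldsymbol\beta$. The summation variables $k,m,n$ run over positive integers. *)

theory Defs
  imports Complex_Main "HOL-Computational_Algebra.Primes"
begin

text \<open>Dirichlet characters modulo \<open>q\<close> as functions on all integers, so that they
  can be evaluated at negative arguments.\<close>

definition dirichlet_character :: "nat \<Rightarrow> (int \<Rightarrow> complex) \<Rightarrow> bool" where
  "dirichlet_character q \<chi> \<longleftrightarrow>
     (\<forall>m. \<chi> (m + int q) = \<chi> m) \<and>
     (\<forall>m n. \<chi> (m * n) = \<chi> m * \<chi> n) \<and>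
     (\<forall>m. \<chi> m \<noteq> 0 \<longleftrightarrow> coprime m (int q))"

definition principal_character :: "nat \<Rightarrow> int \<Rightarrow> complex" where
  "principal_character q m = (if coprime m (int q) then 1 else 0)"

definition pos_upto :: "real \<Rightarrow> nat set" where
  "pos_upto X = {n. 1 \<le> n \<and> real n \<le> X}"

text \<open>Weights are total functions; only the values on
  \<open>pos_upto K \<times> pos_upto N\<close> enter the definitions below. The maximum
  is over a finite set, which is nonempty when \<open>K, N \<ge> 1\<close>.\<close>

definition weight_norm :: "real \<Rightarrow> real \<Rightarrow> (nat \<Rightarrow> nat \<Rightarrow> complex) \<Rightarrow> real" where
  "weight_norm K N \<beta> = Max {norm (\<beta> k n) | k n. k \<in> pos_upto K \<and> n \<in> pos_upto N}"

definition char_sum ::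
  "(int \<Rightarrow> complex) \<Rightarrow> int \<Rightarrow> int \<Rightarrow> real \<Rightarrow> real \<Rightarrow> real \<Rightarrow> (nat \<Rightarrow> nat \<Rightarrow> complex) \<Rightarrow> complex" where
  "char_sum \<chi> a b K M N \<beta> =
     (\<Sum>k\<in>pos_upto K. \<Sum>m\<in>pos_upto M. \<Sum>n\<in>pos_upto N.
        \<beta> k n * \<chi> (a * int k + b * int m * int n))"

definition L1 :: "int \<Rightarrow> int \<Rightarrow> real \<Rightarrow> real \<Rightarrow> real \<Rightarrow> real" where
  "L1 a b K M N = real_of_int \<bar>a\<bar> * K + real_of_int \<bar>b\<bar> * M * N"

definition Delta1 ::
  "nat \<Rightarrow> nat \<Rightarrow> int \<Rightarrow> int \<Rightarrow> real \<Rightarrow> real \<Rightarrow> real \<Rightarrow> real" where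
  "Delta1 p r a b K M N =
     (1 + N / K) powr (1 / (2 * real r)) *
     (1 + L1 a b K M N * M * N * real p powr (- 1 - 1 / (2 * real r))) powr (1 / (2 * real r)) *
     (real p powr (1 + 1 / real r) / (M ^ 4 * N ^ 4)) powr (1 / (4 * real r))"

end

theory Submission
  imports Defs "HOL-Algebra.Algebraic_Closure_Type" "Berlekamp_Zassenhaus.Finite_Field" "HOL-Analysis.Convex"
begin

text \<open>
  Substituting \<open>m + u v\<close> for \<open>m\<close>, with \<open>v \<le> V\<close> and \<open>V\<close> about \<open>p powr (1 / (2 * r))\<close>, bounds
  the trilinear sum by \<open>\<Sum>\<^sub>x \<nu>(x) G(x)\<close>. Here \<open>\<nu>(x)\<close> counts the \<open>(k, m, n, u)\<close> with
  \<open>a k + b m n \<equiv> b u n x\<close> modulo \<open>p\<close>, and \<open>G(x)\<close> is the largest of the sums of \<open>\<chi>(x + v)\<close> over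
  subintervals of the range of \<open>v\<close>. By Hoelder's inequality one needs the second moment of \<open>\<nu>\<close>
  and the \<open>2 r\<close>-th moment of \<open>G\<close>.

  For \<open>\<nu>\<close>, the congruence \<open>x1 y2 \<equiv> x2 y1\<close> is an equation \<open>x1 y2 - x2 y1 = p t\<close> with few \<open>t\<close>;
  for given \<open>x2, y2, t\<close> the larger of \<open>y1, y2\<close> runs through a residue class modulo the smaller
  one divided by \<open>gcd(x2, y2)\<close>, and divisor bounds do the rest once \<open>n\<close> is coprime to \<open>a\<close>.

  For \<open>G\<close>, a dyadic decomposition of the subintervals reduces the moment to complete sums, bounded by
  Weil's theorem. This is proved over the polynomials with coefficients in the prime field, with the
  norm of \<open>f\<close> expressed through irreducible polynomials: Stepanov's method shows that the norm takes
  every nonzero value about equally often in the extension of degree \<open>k\<close>, up to a factor that depends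
  on \<open>p\<close> but not on \<open>k\<close>. The character sums over the extensions are the power sums of the inverse
  zeros of a polynomial of bounded degree, so letting \<open>k\<close> grow removes that factor.
\<close>

text \<open>Stepanov's method bounds from above how often the norm takes a nonzero value; the
  matching lower bound comes from the known total. Its auxiliary polynomial is shown to be nonzero
  by comparing degrees, and this requires the degree of \<open>f\<close> to be prime to
  \<open>p - 1\<close>. Hence a zero of multiplicity prime to \<open>p - 1\<close> must be
  available. In the moments there is one: a value taken by a single index has multiplicity
  \<open>1\<close>, or \<open>p - 2\<close> if its factor is conjugated. The range of
  \<open>m\<close> restricts \<open>v\<close> to an interval that varies with \<open>m\<close> and
  \<open>u\<close>. The maximum over all subintervals keeps \<open>G\<close> a function of the
  residue \<open>x\<close> alone, as Hoelder's inequality demands, and the dyadic decomposition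
  costs only powers of \<open>log p\<close>. Coprimality of \<open>n\<close> and \<open>a\<close> is
  obtained by sorting the \<open>n\<close> by \<open>h = gcd(n, a)\<close>: the factor
  \<open>\<chi>(h)\<close> leaves the sum, and \<open>a\<close>, \<open>N\<close> become
  \<open>a / h\<close>, \<open>N / h\<close>. The number of these \<open>h\<close> is a divisor
  count, small when \<open>a\<close> is bounded by a power of \<open>p\<close>. For larger
  coefficients, \<open>L1 \<ge> p ^ 3\<close>, one has \<open>Delta1 \<ge> 1\<close> and the bound
  is trivial.\<close>

hide_const (open) Divisibility.irreducible Divisibility.prime Polynomials.degree Polynomials.lead_coeff

section \<open>Taylor expansion of polynomials\<close>

text \<open>This is \<open>h(X + T)\<close>, with \<open>T\<close> the outer and \<open>X\<close>
  the inner indeterminate. The coefficient at \<open>T ^ l\<close> is the \<open>l\<close>-th Hasse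
  derivative of \<open>h\<close>; unlike the iterated derivative it carries no factor
  \<open>l!\<close>, which would vanish once \<open>l\<close> reaches the characteristic.\<close>

definition taylor_poly :: "'a::comm_ring_1 poly \<Rightarrow> 'a poly poly" where
  "taylor_poly h = poly (map_poly (\<lambda>c. [:[:c:]:]) h) [:[:0, 1:], 1:]"

interpretation pconst_hom: comm_ring_hom "\<lambda>c::'a::comm_ring_1. [:[:c:]:]"
  by unfold_locales (auto simp: one_pCons)

interpretation pconst_map_hom: map_poly_comm_ring_hom "\<lambda>c::'a::comm_ring_1. [:[:c:]:]" ..

lemma taylor_poly_add: "taylor_poly (g + h) = taylor_poly g + taylor_poly h"
  by (simp add: taylor_poly_def pconst_map_hom.hom_add)

lemma taylor_poly_mult: "taylor_poly (g * h) = taylor_poly g * taylor_poly h"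
  by (simp add: taylor_poly_def pconst_map_hom.hom_mult)

lemma taylor_poly_0 [simp]: "taylor_poly 0 = 0"
  by (simp add: taylor_poly_def)

lemma taylor_poly_1 [simp]: "taylor_poly 1 = 1"
  by (simp add: taylor_poly_def)

lemma taylor_poly_power: "taylor_poly (g ^ n) = taylor_poly g ^ n"
  by (induction n) (auto simp: taylor_poly_mult)

lemma taylor_poly_sum: "taylor_poly (sum g A) = (\<Sum>x\<in>A. taylor_poly (g x))"
  by (induction A rule: infinite_finite_induct) (auto simp: taylor_poly_add)

lemma taylor_poly_pCons:
  "taylor_poly (pCons a h) = [:[:a:]:] + [:[:0, 1:], 1:] * taylor_poly h"
  by (simp add: taylor_poly_def pconst_hom.map_poly_pCons_hom)

lemma coeff_taylor_poly_pCons: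
  "coeff (taylor_poly (pCons a h)) l =
     (if l = 0 then [:a:] + [:0, 1:] * coeff (taylor_poly h) 0
      else [:0, 1:] * coeff (taylor_poly h) l + coeff (taylor_poly h) (l - 1))"
  by (cases l) (auto simp: taylor_poly_pCons)

lemma degree_coeff_taylor_poly: "degree (coeff (taylor_poly h) l) \<le> degree h"
proof (induction h arbitrary: l)
  case (pCons a h)
  show ?case
  proof (cases "h = 0")
    case True
    then show ?thesis by (auto simp: coeff_taylor_poly_pCons)
  next
    case False
    have 1: "degree ([:0, 1:] * coeff (taylor_poly h) l') \<le> Suc (degree h)" for l'
      using pCons.IH[of l'] degree_mult_le[of "[:0,1:]" "coeff (taylor_poly h) l'"] by simp
    then show ?thesis using False pCons.IH[of "l - 1"]
      by (auto simp only: coeff_taylor_poly_pCons degree_pCons_eq intro!: degree_add_le split: if_splits)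
        (auto intro: degree_add_le)
  qed
qed auto

lemma coeff_0_taylor_poly [simp]: "coeff (taylor_poly h) 0 = h"
  by (induction h) (auto simp: coeff_taylor_poly_pCons)

lemma coeff_1_taylor_poly [simp]: "coeff (taylor_poly h) (Suc 0) = pderiv h"
  by (induction h) (auto simp: coeff_taylor_poly_pCons pderiv_pCons)

lemma taylor_poly_eq: obtains R where "taylor_poly h = [:h:] + [:0, 1:] * R" "coeff R 0 = pderiv h"
proof -
  obtain c R where cR: "taylor_poly h = pCons c R" by (cases "taylor_poly h") auto
  have "c = h" using coeff_0_taylor_poly[of h] cR by simp
  moreover have "coeff R 0 = pderiv h" using coeff_1_taylor_poly[of h] cR by simp
  ultimately show ?thesis using that[of R] cR by simp
qed

lemma pconst_dvd_iff: "[:P:] dvd Q \<longleftrightarrow> (\<forall>l. P dvd coeff Q l)" for P :: "'a::field_gcd poly"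
  by (rule const_poly_dvd_iff)

lemma dvd_power_diff: "(c::'a::comm_ring_1) dvd a - b \<Longrightarrow> c dvd a ^ n - b ^ n"
  using dvd_trans[of c "a - b" "a ^ n - b ^ n"] by (metis power_diff_sumr2 dvd_triv_left)

lemma T_power_dvd_iff: "[:0, 1:] ^ n dvd (Q :: 'a::comm_ring_1 poly) \<longleftrightarrow> (\<forall>l<n. coeff Q l = 0)"
proof
  assume "[:0, 1:] ^ n dvd Q"
  then obtain R where "Q = monom 1 n * R" by (auto simp: dvd_def monom_altdef)
  then show "\<forall>l<n. coeff Q l = 0" by (simp add: coeff_monom_mult)
next
  show "\<forall>l<n. coeff Q l = 0 \<Longrightarrow> [:0, 1:] ^ n dvd Q"
  proof (induction n arbitrary: Q)
    case (Suc n)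
    obtain c R where Q: "Q = pCons c R" by (cases Q) auto
    have "c = 0" using Suc.prems Q by (auto dest: spec[of _ 0])
    moreover have "\<forall>l<n. coeff R l = 0" using Suc.prems Q by (auto dest: spec[of _ "Suc _"])
    then have "[:0, 1:] ^ n dvd R" using Suc.IH by auto
    ultimately show ?case using Q mult_dvd_mono[of "[:0,1:]" "[:0,1:]" "[:0,1:]^n" R] by simp
  qed auto
qed

text \<open>Induction on the order. Modulo \<open>P\<close> the expansion of \<open>P\<close> is
  \<open>T * R\<close>, where \<open>R\<close> has constant term \<open>pderiv P\<close>. If
  \<open>Q = P ^ e * H\<close>, the expansion of \<open>Q\<close> modulo \<open>P\<close> therefore
  starts with \<open>pderiv P ^ e * H\<close> at \<open>T ^ e\<close>; as \<open>P\<close> is prime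
  and does not divide its derivative, it divides \<open>H\<close>.\<close>

lemma power_dvd_of_taylor:
  fixes P Q :: "'a::field_gcd poly"
  assumes P: "irreducible P" "\<not> P dvd pderiv P"
    and "\<And>l. l < n \<Longrightarrow> P dvd coeff (taylor_poly Q) l"
  shows "P ^ n dvd Q"
  using assms(3)
proof (induction n)
  case (Suc e)
  then obtain H where Q: "Q = P ^ e * H" by (auto elim: dvdE)
  obtain R where R: "taylor_poly P = [:P:] + [:0, 1:] * R" "coeff R 0 = pderiv P"
    by (rule taylor_poly_eq)
  have "[:P:] dvd taylor_poly P - [:0, 1:] * R" using R by simp
  then have "[:P:] dvd taylor_poly P ^ e - ([:0, 1:] * R) ^ e" by (rule dvd_power_diff)
  then have "[:P:] dvd (taylor_poly P ^ e - ([:0, 1:] * R) ^ e) * taylor_poly H" by (rule dvd_mult2)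
  also have "\<dots> = taylor_poly Q - monom 1 e * (R ^ e * taylor_poly H)"
    unfolding Q taylor_poly_mult taylor_poly_power power_mult_distrib monom_altdef smult_1_left
    by (simp only: algebra_simps)
  finally have "P dvd coeff (taylor_poly Q - monom 1 e * (R ^ e * taylor_poly H)) e"
    by (simp only: pconst_dvd_iff)
  then have "P dvd coeff (taylor_poly Q) e - pderiv P ^ e * H"
    by (simp add: coeff_monom_mult coeff_mult_0 coeff_0_power R)
  moreover have "P dvd coeff (taylor_poly Q) e" using Suc.prems by simp
  ultimately have "P dvd pderiv P ^ e * H"
    by (metis dvd_diff_right_iff minus_dvd_iff dvd_minus_iff diff_diff_eq2 dvd_diff diff_self add.left_neutral cancel_comm_monoid_add_class.diff_cancel diff_add_cancel add_diff_cancel_left')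
  moreover have "prime_elem P" using P by (simp add: prime_elem_iff_irreducible)
  ultimately have "P dvd H" using P by (metis prime_elem_dvd_mult_iff prime_elem_dvd_power)
  then show ?case using Q by (auto simp: mult_dvd_mono mult.commute)
qed auto

text \<open>The term of largest degree is unique, so its leading coefficient cannot cancel. This is
  how the auxiliary polynomial of Stepanov's method is shown to be nonzero.\<close>

lemma sum_neq_0_of_inj_degree:
  fixes t :: "'b \<Rightarrow> 'a::comm_monoid_add poly"
  assumes "finite S" "S \<noteq> {}" "\<And>s. s \<in> S \<Longrightarrow> t s \<noteq> 0" "inj_on (\<lambda>s. degree (t s)) S"
  shows "(\<Sum>s\<in>S. t s) \<noteq> 0"
proof -
  have "Max ((\<lambda>s. degree (t s)) ` S) \<in> (\<lambda>s. degree (t s)) ` S"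
    using assms(1,2) by (intro Max_in) auto
  then obtain s where s: "s \<in> S" "degree (t s) = Max ((\<lambda>s. degree (t s)) ` S)" by force
  have s': "degree (t s') \<le> degree (t s)" if "s' \<in> S" for s'
    using that assms(1) by (simp add: s(2))
  have "coeff (t s') (degree (t s)) = 0" if "s' \<in> S" "s' \<noteq> s" for s'
    using s'[OF that(1)] that s(1) assms(4)
    by (intro coeff_eq_0) (metis inj_on_def le_neq_implies_less)
  then have "coeff (\<Sum>s\<in>S. t s) (degree (t s)) = coeff (t s) (degree (t s))"
    using assms(1) s(1) by (simp add: coeff_sum sum.remove[of S s])
  then show ?thesis using assms(3)[OF s(1)] by (metis coeff_0 leading_coeff_0_iff)
qed

lemma card_degree_less:
  assumes "n > 0"
  shows "finite {h::'a::{finite,comm_ring_1} poly. degree h < n}"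
    and "card {h::'a poly. degree h < n} = CARD('a) ^ n"
proof -
  let ?L = "{xs::'a list. length xs = n}"
  have "bij_betw (\<lambda>h. map (coeff h) [0..<n]) {h::'a poly. degree h < n} ?L"
  proof (rule bij_betwI[where g = Poly])
    fix h :: "'a poly" assume "h \<in> {h. degree h < n}"
    then show "Poly (map (coeff h) [0..<n]) = h"
      by (intro poly_eqI) (auto simp: coeff_Poly_eq nth_default_def coeff_eq_0)
  next
    fix xs :: "'a list" assume "xs \<in> ?L"
    then show "map (coeff (Poly xs)) [0..<n] = xs"
      by (intro nth_equalityI) (auto simp: coeff_Poly_eq nth_default_def)
  next
    show "Poly \<in> ?L \<rightarrow> {h. degree h < n}"
      using assms by (auto intro!: degree_lessI simp: coeff_Poly_eq nth_default_def)
  qed auto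
  moreover have "finite ?L" "card ?L = CARD('a) ^ n"
    using finite_lists_length_eq[of "UNIV::'a set" n] card_lists_length_eq[of "UNIV::'a set" n] by auto
  ultimately show "finite {h::'a poly. degree h < n}" "card {h::'a poly. degree h < n} = CARD('a) ^ n"
    by (auto simp: bij_betw_finite bij_betw_same_card)
qed

lemma prod_irreducible_power_dvd:
  fixes S :: "'a::field_gcd poly set"
  assumes "finite S" "\<And>P. P \<in> S \<Longrightarrow> irreducible P \<and> monic P" "\<And>P. P \<in> S \<Longrightarrow> P ^ n dvd Q"
  shows "(\<Prod>P\<in>S. P ^ n) dvd Q"
  using assms
proof (induction S)
  case (insert P S)
  have "coprime P P'" if "P' \<in> S" for P'
  proof (rule ccontr)
    assume "\<not> coprime P P'"
    moreover have "prime_elem P" "prime_elem P'"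
      using insert.prems(1) that by (auto simp: prime_elem_iff_irreducible)
    ultimately have "P dvd P'" "P' dvd P"
      using prime_elem_imp_coprime[of P P'] prime_elem_imp_coprime[of P' P] by (auto simp: coprime_commute)
    then have "normalize P = normalize P'" by (rule Rings.associatedI)
    then show False using that insert.hyps insert.prems(1)
      by (metis insertCI normalize_monic)
  qed
  then have "coprime (P ^ n) (\<Prod>P\<in>S. P ^ n)" by (intro prod_coprime_right) auto
  then show ?case using insert by (simp add: divides_mult)
qed auto

section \<open>Stepanov's method\<close>

text \<open>For \<open>b = CARD('a)\<close> this is the exponent of the norm from the field with
  \<open>b ^ k\<close> elements to the prime field: the conjugates of \<open>x\<close> are the
  \<open>x ^ (b ^ t)\<close>.\<close>

definition rep_unit :: "nat \<Rightarrow> nat \<Rightarrow> nat" where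
  "rep_unit b k = (\<Sum>t<k. b ^ t)"

lemma rep_unit_mult: "b \<ge> 1 \<Longrightarrow> (b - 1) * rep_unit b k + 1 = b ^ k"
proof (induction k)
  case (Suc k)
  have "(b - 1) * rep_unit b (Suc k) + 1 = ((b - 1) * rep_unit b k + 1) + (b - 1) * b ^ k"
    by (simp add: rep_unit_def algebra_simps)
  also have "\<dots> = b * b ^ k"
    using Suc by (simp add: diff_mult_distrib)
  finally show ?case by simp
qed (simp add: rep_unit_def)

lemma rep_unit_add: "rep_unit b (h + j) = rep_unit b h + b ^ h * rep_unit b j"
  by (induction j) (auto simp: rep_unit_def algebra_simps power_add)

lemma mod_ring_poly_poly_frobenius:
  fixes x y :: "'a::prime_card mod_ring poly poly"
  shows "(x + y) ^ (CARD('a) ^ n) = x ^ (CARD('a) ^ n) + y ^ (CARD('a) ^ n)"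
  by (rule freshmans_dream'[where n = n]) (use prime_card in auto)

lemma pderiv_frobenius_poly:
  assumes "k \<ge> 1"
  shows "pderiv ([:0, 1:] ^ (CARD('a) ^ k) - [:0, 1:] :: 'a::prime_card mod_ring poly) = -1"
proof -
  have "of_nat (CARD('a) ^ k) = (0 :: 'a mod_ring)" using assms by simp
  then show ?thesis using assms by (simp add: pderiv_diff pderiv_power pderiv_pCons power_0_left pCons_one)
qed

text \<open>If \<open>P\<close> divided its own derivative, it would divide the derivative of
  \<open>X ^ q - X\<close>, which is the unit \<open>-1\<close>. This supplies the separability
  hypothesis of \<open>power_dvd_of_taylor\<close>.\<close>

lemma not_dvd_pderiv_of_dvd_frobenius_poly:
  fixes P :: "'a::prime_card mod_ring poly"
  assumes "k \<ge> 1" "irreducible P" "P dvd [:0, 1:] ^ (CARD('a) ^ k) - [:0, 1:]"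
  shows "\<not> P dvd pderiv P"
proof
  assume d: "P dvd pderiv P"
  obtain H where H: "[:0, 1:] ^ (CARD('a) ^ k) - [:0, 1:] = P * H" using assms(3) by (elim dvdE)
  have "pderiv (P * H) = -1" using pderiv_frobenius_poly[OF assms(1), where 'a='a] unfolding H .
  moreover have "P dvd pderiv (P * H)" using d by (simp add: pderiv_mult)
  ultimately have "P dvd -1" by simp
  then have "is_unit P" using dvd_minus_iff by blast
  then show False using assms(2) by (auto simp: irreducible_def)
qed

text \<open>The auxiliary polynomial is the sum of \<open>a i j * f ^ (i * E) * Y ^ (j * q)\<close> with \<open>i < d\<close>, \<open>j < J\<close> and
  \<open>degree (a i j) < E - J\<close>. Modulo \<open>P\<close> the powers \<open>f ^ (i * E)\<close> and \<open>Y ^ (j * q)\<close> become \<open>c ^ i\<close> and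
  \<open>Y ^ j\<close>, which makes vanishing to order \<open>M\<close> a linear condition on \<open>a\<close> of low degree (\<open>cond\<close> below, cleared of
  denominators). No Hasse derivatives of \<open>f ^ (i * E)\<close> are needed because \<open>M\<close> is a power of the characteristic.\<close>

lemma stepanov:
  fixes f :: "'a::prime_card mod_ring poly" and c :: "'a mod_ring" and h k J :: nat
  defines "q0 \<equiv> CARD('a)" and "d \<equiv> CARD('a) - 1" and "m \<equiv> degree f"
  defines "M \<equiv> q0 ^ h" and "q \<equiv> q0 ^ k" and "E \<equiv> rep_unit q0 k"
  assumes "f \<noteq> 0" "coprime m d" "h \<le> k" "k \<ge> 1"
    and count: "M * (E + M * m) < d * J * (E - J)"
    and S: "finite S" "\<And>P. P \<in> S \<Longrightarrow> irreducible P \<and> monic P \<and> \<not> P dvd f"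
      "\<And>P. P \<in> S \<Longrightarrow> P dvd [:0, 1:] ^ q - [:0, 1:]"
      "\<And>P. P \<in> S \<Longrightarrow> P dvd f ^ E - [:c:]"
  shows "M * (\<Sum>P\<in>S. degree P) \<le> E + d * m * E + J * q"
proof -
  define A where "A = E - J"
  define B where "B = E + M * m"
  define Eh where "Eh = rep_unit q0 h"
  define Er where "Er = rep_unit q0 (k - h)"
  define Y :: "'a mod_ring poly" where "Y = [:0, 1:]"
  define I where "I = {..<d} \<times> {..<J}"
  define PL :: "nat \<Rightarrow> 'a mod_ring poly set" where "PL n = {h. degree h < n}" for n
  have q0: "q0 \<ge> 2" unfolding q0_def using prime_card[where ?'a='a] by (simp add: prime_ge_2_nat)
  have d1: "d \<ge> 1" using q0 by (simp add: d_def q0_def)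
  have "d * J * (E - J) > 0" using count by linarith
  then have A: "A > 0" "J > 0" by (auto simp: A_def)
  have EJ: "A + J = E" using A(1) by (simp add: A_def)
  have qE: "q = d * E + 1" unfolding q_def E_def d_def using rep_unit_mult[of q0 k] q0 by (simp add: q0_def)
  have Mh: "M = d * Eh + 1" unfolding M_def Eh_def d_def using rep_unit_mult[of q0 h] q0 by (simp add: q0_def)
  have Esplit: "E = Eh + M * Er"
    unfolding E_def Eh_def Er_def M_def using rep_unit_add[of q0 h "k - h"] \<open>h \<le> k\<close> by simp
  have qM: "M dvd q" unfolding q_def M_def using \<open>h \<le> k\<close> by (simp add: le_imp_power_dvd)
  \<comment> \<open>By \<open>Esplit\<close>, \<open>f ^ (i * E)\<close> is
    \<open>f ^ (i * Eh)\<close> times an \<open>M\<close>-th power, and the latter is constant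
    modulo \<open>T ^ M\<close>, so only \<open>f ^ (i * Eh)\<close> has to be expanded.
    Multiplication by \<open>f ^ (d * Eh)\<close> completes the \<open>M\<close>-th power to
    \<open>f ^ (i * E)\<close>, which is \<open>c ^ i\<close> modulo \<open>P\<close>, and leaves
    the factor \<open>f ^ ((d - i) * Eh)\<close>.\<close>
  define cond where "cond a l = (\<Sum>(i,j)\<in>I. coeff (taylor_poly (a (i,j) * f ^ (i * Eh))) l
      * f ^ ((d - i) * Eh) * [:c ^ i:] * Y ^ j)" for a :: "nat \<times> nat \<Rightarrow> 'a mod_ring poly" and l
  have finI: "finite I" by (simp add: I_def)
  have B: "B > 0" using EJ A by (simp add: B_def)
  \<comment> \<open>The exponents of \<open>f\<close> add up to \<open>d * Eh < M\<close> whatever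
    \<open>i\<close> is, which accounts for \<open>M * m\<close>; the degree of
    \<open>a (i,j)\<close> and the power of \<open>Y\<close> together stay below
    \<open>A + J = E\<close>.\<close>
  have cond_PL: "cond a l \<in> PL B" if a: "a \<in> PiE I (\<lambda>_. PL A)" for a l
  proof -
    have "degree (coeff (taylor_poly (a (i,j) * f ^ (i * Eh))) l * f ^ ((d - i) * Eh) * [:c ^ i:] * Y ^ j)
       \<le> B - 1" if ij: "(i,j) \<in> I" for i j
    proof -
      have "degree (a (i,j)) < A" using a ij by (auto simp: PL_def)
      have id: "i < d" "j < J" using ij by (auto simp: I_def)
      have "degree (coeff (taylor_poly (a (i,j) * f ^ (i * Eh))) l) \<le> degree (a (i,j)) + i * Eh * m"
        using degree_coeff_taylor_poly[of "a (i,j) * f ^ (i * Eh)" l]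
          degree_mult_le[of "a (i,j)" "f ^ (i * Eh)"] degree_power_le[of f "i * Eh"]
        by (simp add: m_def mult.commute)
      moreover have "degree (f ^ ((d - i) * Eh)) \<le> (d - i) * Eh * m"
        using degree_power_le[of f "(d - i) * Eh"] by (simp add: m_def mult.commute)
      moreover have "degree (Y ^ j) \<le> j" using degree_power_le[of Y j] by (simp add: Y_def)
      moreover have "degree (u * v * [:c ^ i:] * w) \<le> degree u + degree v + degree w"
        for u v w :: "'a mod_ring poly"
        using degree_mult_le[of u v] degree_mult_le[of "u * v" "[:c ^ i:]"]
          degree_mult_le[of "u * v * [:c ^ i:]" w] by simp
      ultimately have "degree (coeff (taylor_poly (a (i,j) * f ^ (i * Eh))) l * f ^ ((d - i) * Eh) * [:c ^ i:] * Y ^ j)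
        \<le> degree (a (i,j)) + i * Eh * m + (d - i) * Eh * m + j"
        by (meson add_mono order_trans)
      moreover have "degree (a (i,j)) + i * Eh * m + (d - i) * Eh * m + j \<le> B - 1"
      proof -
        have "i * Eh * m + (d - i) * Eh * m = (i + (d - i)) * Eh * m" by (simp only: add_mult_distrib)
        also have "\<dots> = d * Eh * m" using id by simp
        also have "d * Eh * m \<le> M * m" using Mh by (intro mult_right_mono) auto
        finally show ?thesis
          using \<open>degree (a (i,j)) < A\<close> id EJ unfolding B_def by linarith
      qed
      ultimately show ?thesis by (rule order_trans)
    qed
    then have "degree (cond a l) \<le> B - 1" unfolding cond_def
      by (intro degree_sum_le finI) auto
    then show ?thesis using B by (simp add: PL_def)
  qed
  have cardPL: "finite (PL n)" "card (PL n) = q0 ^ n" if "n > 0" for n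
    using card_degree_less[OF that, where 'a="'a mod_ring"] by (auto simp: PL_def q0_def)
  \<comment> \<open>Pigeonhole: by \<open>count\<close> there are more coefficient families in
    \<open>U\<close> than possible values of the \<open>M\<close> conditions in \<open>V\<close>.
    Two families agree on all conditions, and by linearity their difference satisfies them with
    value 0.\<close>
  define U where "U = PiE I (\<lambda>_. PL A)"
  define V where "V = PiE {..<M} (\<lambda>_. PL B)"
  define \<phi> where "\<phi> a = restrict (cond a) {..<M}" for a
  have "finite V" using cardPL B by (auto simp: V_def intro!: finite_PiE)
  moreover have "card V = q0 ^ (B * M)"
    unfolding V_def using cardPL(2)[OF B] by (subst card_PiE) (auto simp: power_mult)
  moreover have "card U = q0 ^ (A * (d * J))"
    unfolding U_def using cardPL(2)[OF A(1)] finI by (subst card_PiE) (auto simp: power_mult I_def)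
  moreover have "B * M < A * (d * J)" using count by (simp add: A_def B_def mult.commute)
  ultimately have "card V < card U" using q0 by simp
  moreover have "\<phi> ` U \<subseteq> V" unfolding \<phi>_def U_def V_def by (intro image_subsetI restrict_PiE_iff[THEN iffD2] ballI cond_PL)
  ultimately have "\<not> inj_on \<phi> U" using \<open>finite V\<close> card_inj_on_le by (metis not_le)
  then obtain a1 a2 where a12: "a1 \<in> U" "a2 \<in> U" "\<phi> a1 = \<phi> a2" "a1 \<noteq> a2" by (auto simp: inj_on_def)
  define \<delta> where "\<delta> s = a1 s - a2 s" for s
  have cond\<delta>: "cond \<delta> l = 0" if "l < M" for l
  proof -
    have "cond a1 l = cond \<delta> l + cond a2 l"
      unfolding cond_def sum.distrib[symmetric]
    proof (intro sum.cong refl, clarify)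
      fix i j
      have "a1 (i,j) * f ^ (i * Eh) = \<delta> (i,j) * f ^ (i * Eh) + a2 (i,j) * f ^ (i * Eh)"
        by (simp add: \<delta>_def algebra_simps)
      then show "coeff (taylor_poly (a1 (i, j) * f ^ (i * Eh))) l * f ^ ((d - i) * Eh) * [:c ^ i:] * Y ^ j =
           coeff (taylor_poly (\<delta> (i, j) * f ^ (i * Eh))) l * f ^ ((d - i) * Eh) * [:c ^ i:] * Y ^ j +
           coeff (taylor_poly (a2 (i, j) * f ^ (i * Eh))) l * f ^ ((d - i) * Eh) * [:c ^ i:] * Y ^ j"
        by (simp only: taylor_poly_add coeff_add distrib_right)
    qed
    moreover have "cond a1 l = cond a2 l" using a12(3) that by (metis \<phi>_def lessThan_iff restrict_apply)
    ultimately show ?thesis by simp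
  qed
  have deg\<delta>: "degree (\<delta> s) < A" if "s \<in> I" for s
    using a12(1,2) that degree_diff_le_max[of "a1 s" "a2 s"] by (force simp: U_def PL_def \<delta>_def)
  obtain s0 where s0: "s0 \<in> I" "\<delta> s0 \<noteq> 0"
    using a12 by (metis PiE_ext U_def \<delta>_def right_minus_eq)
  define t where "t s = \<delta> s * f ^ (fst s * E) * Y ^ (snd s * q)" for s
  define \<Psi> where "\<Psi> = (\<Sum>s\<in>I. t s)"
  define I' where "I' = {s\<in>I. \<delta> s \<noteq> 0}"
  have \<Psi>': "\<Psi> = (\<Sum>s\<in>I'. t s)"
    unfolding \<Psi>_def I'_def by (rule sum.mono_neutral_right) (auto simp: finI t_def)
  have Y0: "Y \<noteq> 0" "degree Y = 1" by (auto simp: Y_def)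
  \<comment> \<open>Because \<open>q = d * E + 1\<close>, the degree can be read in base
    \<open>E\<close>: the remainder \<open>j + degree (\<delta> (i,j))\<close> is below
    \<open>E\<close>, and the quotient is \<open>i * m + j * d\<close>. As \<open>m\<close> is prime
    to \<open>d\<close> and \<open>i < d\<close>, the quotient determines \<open>i\<close> and then
    \<open>j\<close>.\<close>
  have degt: "degree (t (i,j)) = (i * m + j * d) * E + (j + degree (\<delta> (i,j)))" if "\<delta> (i,j) \<noteq> 0" for i j
  proof -
    have "degree (t (i,j)) = degree (\<delta> (i,j)) + i * E * m + j * q"
      using that Y0 \<open>f \<noteq> 0\<close> unfolding t_def
      by (subst degree_mult_eq degree_power_eq; simp add: degree_mult_eq degree_power_eq m_def)
    then show ?thesis by (simp add: qE algebra_simps)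
  qed
  have tj: "j + degree (\<delta> (i,j)) < E" if "(i,j) \<in> I" for i j
    using deg\<delta>[OF that] that EJ by (auto simp: I_def)
  have "\<Psi> \<noteq> 0" unfolding \<Psi>'
  proof (rule sum_neq_0_of_inj_degree)
    show "finite I'" using finI by (simp add: I'_def)
    show "I' \<noteq> {}" using s0 unfolding I'_def by blast
    show "t s \<noteq> 0" if "s \<in> I'" for s using that Y0 \<open>f \<noteq> 0\<close> by (auto simp: t_def I'_def)
    show "inj_on (\<lambda>s. degree (t s)) I'"
    proof (rule inj_onI)
      fix s s' assume s: "s \<in> I'" "s' \<in> I'" and e: "degree (t s) = degree (t s')"
      obtain i j i' j' where ij: "s = (i,j)" "s' = (i',j')" by (cases s, cases s') auto
      have I: "(i,j) \<in> I" "(i',j') \<in> I" "\<delta> (i,j) \<noteq> 0" "\<delta> (i',j') \<noteq> 0" using s ij by (auto simp: I'_def)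
      have lt: "i < d" "i' < d" using I by (auto simp: I_def)
      have "((i * m + j * d) * E + (j + degree (\<delta> (i,j)))) div E =
            ((i' * m + j' * d) * E + (j' + degree (\<delta> (i',j')))) div E"
        using e unfolding ij degt[OF I(3)] degt[OF I(4)] by simp
      then have eq: "i * m + j * d = i' * m + j' * d"
        using tj[OF I(1)] tj[OF I(2)] by simp
      then have "(i * m) mod d = (i' * m) mod d" by (metis mod_mult_self1)
      then have "[i = i'] (mod d)" using \<open>coprime m d\<close> by (metis Cong.cong_def cong_mult_rcancel_nat coprime_commute)
      then have "i = i'" using lt by (simp add: Cong.cong_def)
      moreover then have "j = j'" using eq d1 by simp
      ultimately show "s = s'" using ij by simp
    qed
  qed
  have deg\<Psi>: "degree \<Psi> \<le> E + d * m * E + J * q"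
    unfolding \<Psi>'
  proof (rule degree_sum_le)
    fix s assume s: "s \<in> I'"
    obtain i j where ij: "s = (i,j)" by (cases s)
    have I: "(i,j) \<in> I" "\<delta> (i,j) \<noteq> 0" "i < d" "j < J" using s ij by (auto simp: I'_def I_def)
    have "degree (t s) \<le> (i * m + j * d) * E + E" using degt[OF I(2)] tj[OF I(1)] ij by simp
    also have "\<dots> = i * m * E + j * (d * E) + E" by (simp add: algebra_simps)
    also have "\<dots> \<le> d * m * E + J * q + E"
      using I qE by (intro add_mono mult_mono) auto
    finally show "degree (t s) \<le> E + d * m * E + J * q" by simp
  qed (auto simp: I'_def finI)
  define T :: "'a mod_ring poly poly" where "T = [:0, 1:]"
  \<comment> \<open>The Frobenius map is additive, so \<open>f ^ M\<close> expands to
    \<open>[:f ^ M:]\<close> plus a multiple of \<open>T ^ M\<close>, and \<open>Y ^ q\<close> to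
    \<open>[:Y ^ q:] + T ^ q\<close> with \<open>q \<ge> M\<close>. Modulo \<open>T ^ M\<close> both
    behave as constants.\<close>
  have tay_diff: "T ^ M dvd taylor_poly \<Psi> - (\<Sum>(i,j)\<in>I. taylor_poly (\<delta> (i,j) * f ^ (i * Eh))
        * [:f ^ (i * M * Er) * Y ^ (j * q):])"
  proof -
    have cong_mult: "T ^ M dvd u - v \<Longrightarrow> T ^ M dvd u' - v' \<Longrightarrow> T ^ M dvd u * u' - v * v'" for u v u' v'
    proof -
      assume "T ^ M dvd u - v" "T ^ M dvd u' - v'"
      then have "T ^ M dvd (u - v) * u' + v * (u' - v')" by (intro dvd_add dvd_mult dvd_mult2)
      moreover have "(u - v) * u' + v * (u' - v') = u * u' - v * v'" by (simp add: algebra_simps)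
      ultimately show ?thesis by simp
    qed
    have pconst_power: "[:u :: 'a mod_ring poly:] ^ n = [:u ^ n:]" for u n
      by (rule poly_const_pow)
    have fM: "T ^ M dvd taylor_poly (f ^ M) - [:f ^ M:]"
    proof -
      obtain R where "taylor_poly f = [:f:] + [:0, 1:] * R" by (rule taylor_poly_eq)
      then have "taylor_poly (f ^ M) = [:f:] ^ M + (T * R) ^ M"
        unfolding taylor_poly_power M_def q0_def T_def by (simp only: mod_ring_poly_poly_frobenius)
      then show ?thesis by (simp add: pconst_power power_mult_distrib)
    qed
    have Xq: "T ^ M dvd taylor_poly (Y ^ q) - [:Y ^ q:]"
    proof -
      have "taylor_poly Y = [:Y:] + T" by (simp add: Y_def T_def taylor_poly_pCons)
      then have "taylor_poly (Y ^ q) = [:Y:] ^ q + T ^ q"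
        unfolding taylor_poly_power q_def q0_def by (simp only: mod_ring_poly_poly_frobenius)
      moreover have "M \<le> q" using qM qE by (simp add: dvd_imp_le)
      ultimately show ?thesis by (simp add: pconst_power le_imp_power_dvd)
    qed
    have "T ^ M dvd taylor_poly (t (i,j)) - taylor_poly (\<delta> (i,j) * f ^ (i * Eh))
        * [:f ^ (i * M * Er) * Y ^ (j * q):]" for i j
    proof -
      have "t (i,j) = (\<delta> (i,j) * f ^ (i * Eh)) * ((f ^ M) ^ (i * Er) * (Y ^ q) ^ j)"
        unfolding t_def Esplit by (simp add: algebra_simps power_add flip: power_mult)
      moreover have "[:f ^ (i * M * Er) * Y ^ (j * q):] = [:f ^ M:] ^ (i * Er) * [:Y ^ q:] ^ j"
        by (simp add: pconst_power algebra_simps flip: power_mult)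
      moreover have "T ^ M dvd taylor_poly (f ^ M) ^ (i * Er) * taylor_poly (Y ^ q) ^ j
          - [:f ^ M:] ^ (i * Er) * [:Y ^ q:] ^ j"
        by (rule cong_mult[OF dvd_power_diff[OF fM] dvd_power_diff[OF Xq]])
      then have "T ^ M dvd taylor_poly (\<delta> (i,j) * f ^ (i * Eh)) * (taylor_poly (f ^ M) ^ (i * Er) * taylor_poly (Y ^ q) ^ j)
          - taylor_poly (\<delta> (i,j) * f ^ (i * Eh)) * ([:f ^ M:] ^ (i * Er) * [:Y ^ q:] ^ j)"
        by (rule cong_mult[rotated]) simp
      ultimately show ?thesis
        by (simp only: taylor_poly_mult taylor_poly_power)
    qed
    then show ?thesis unfolding \<Psi>_def taylor_poly_sum sum_subtractf[symmetric]
      by (intro dvd_sum) auto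
  qed
  have coeff\<Psi>: "coeff (taylor_poly \<Psi>) l = (\<Sum>(i,j)\<in>I. coeff (taylor_poly (\<delta> (i,j) * f ^ (i * Eh))) l
        * (f ^ (i * M * Er) * Y ^ (j * q)))" if "l < M" for l
    using tay_diff that unfolding T_def T_power_dvd_iff
    by (auto simp: coeff_sum case_prod_unfold mult.commute)
  have PM: "P ^ M dvd \<Psi>" if P: "P \<in> S" for P
  proof (rule power_dvd_of_taylor)
    show "irreducible P" using S(2)[OF P] by blast
    show "\<not> P dvd pderiv P"
      using not_dvd_pderiv_of_dvd_frobenius_poly[OF \<open>k \<ge> 1\<close> \<open>irreducible P\<close>] S(3)[OF P]
      by (simp add: q_def q0_def)
    fix l assume l: "l < M"
    \<comment> \<open>The sum on the left will turn out to be \<open>f ^ (d * Eh)\<close> times the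
      \<open>l\<close>-th Taylor coefficient of \<open>\<Psi>\<close>. Modulo \<open>P\<close> it is
      \<open>cond \<delta> l = 0\<close>, and the power of \<open>f\<close> can be removed because
      \<open>P\<close> does not divide \<open>f\<close>.\<close>
    have "P dvd (\<Sum>(i,j)\<in>I. coeff (taylor_poly (\<delta> (i,j) * f ^ (i * Eh))) l * f ^ ((d - i) * Eh)
        * ((f ^ E) ^ i * (Y ^ q) ^ j)) - cond \<delta> l"
      unfolding cond_def sum_subtractf[symmetric]
    proof (intro dvd_sum, clarify)
      fix i j
      have "P dvd (f ^ E) ^ i - [:c:] ^ i" "P dvd (Y ^ q) ^ j - Y ^ j"
        using S(3,4)[OF P] by (auto intro: dvd_power_diff simp: Y_def)
      moreover have "[:c:] ^ i = [:c ^ i:]" by (induction i) (auto simp: one_pCons)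
      ultimately have "P dvd ((f ^ E) ^ i - [:c ^ i:]) * (Y ^ q) ^ j + [:c ^ i:] * ((Y ^ q) ^ j - Y ^ j)"
        by (intro dvd_add dvd_mult dvd_mult2) auto
      also have "\<dots> = (f ^ E) ^ i * (Y ^ q) ^ j - [:c ^ i:] * Y ^ j"
        by (simp only: left_diff_distrib right_diff_distrib) simp
      finally have "P dvd (f ^ E) ^ i * (Y ^ q) ^ j - [:c ^ i:] * Y ^ j" .
      then have "P dvd (coeff (taylor_poly (\<delta> (i,j) * f ^ (i * Eh))) l * f ^ ((d - i) * Eh)) *
         ((f ^ E) ^ i * (Y ^ q) ^ j - [:c ^ i:] * Y ^ j)" by (rule dvd_mult)
      then show "P dvd coeff (taylor_poly (\<delta> (i,j) * f ^ (i * Eh))) l * f ^ ((d - i) * Eh)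
        * ((f ^ E) ^ i * (Y ^ q) ^ j) - coeff (taylor_poly (\<delta> (i,j) * f ^ (i * Eh))) l * f ^ ((d - i) * Eh) * [:c ^ i:] * Y ^ j"
        by (simp only: algebra_simps)
    qed
    also have "(\<Sum>(i,j)\<in>I. coeff (taylor_poly (\<delta> (i,j) * f ^ (i * Eh))) l * f ^ ((d - i) * Eh)
        * ((f ^ E) ^ i * (Y ^ q) ^ j)) = f ^ (d * Eh) * coeff (taylor_poly \<Psi>) l"
      unfolding coeff\<Psi>[OF l] sum_distrib_left
    proof (intro sum.cong refl, clarify)
      fix i j assume "(i,j) \<in> I"
      then have "d = (d - i) + i" by (simp add: I_def)
      then have "d * Eh = (d - i) * Eh + i * Eh" by (metis add_mult_distrib)
      then have "d * Eh + i * M * Er = (d - i) * Eh + E * i" by (simp add: Esplit distrib_left ac_simps)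
      then have "f ^ (d * Eh) * f ^ (i * M * Er) = f ^ ((d - i) * Eh) * (f ^ E) ^ i"
        by (metis power_add power_mult)
      then have "w * f ^ ((d - i) * Eh) * ((f ^ E) ^ i * v) = f ^ (d * Eh) * (w * (f ^ (i * M * Er) * v))" for v w
      proof -
        assume e: "f ^ (d * Eh) * f ^ (i * M * Er) = f ^ ((d - i) * Eh) * (f ^ E) ^ i"
        have "w * f ^ ((d - i) * Eh) * ((f ^ E) ^ i * v) = w * v * (f ^ ((d - i) * Eh) * (f ^ E) ^ i)"
          by (simp only: ac_simps)
        also have "\<dots> = w * v * (f ^ (d * Eh) * f ^ (i * M * Er))" by (simp only: e)
        also have "\<dots> = f ^ (d * Eh) * (w * (f ^ (i * M * Er) * v))"
          by (simp only: ac_simps)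
        finally show ?thesis .
      qed
      then show "coeff (taylor_poly (\<delta> (i,j) * f ^ (i * Eh))) l * f ^ ((d - i) * Eh) * ((f ^ E) ^ i * (Y ^ q) ^ j) =
         f ^ (d * Eh) * (coeff (taylor_poly (\<delta> (i,j) * f ^ (i * Eh))) l * (f ^ (i * M * Er) * Y ^ (j * q)))"
        by (simp only: mult.commute[of j q] power_mult)
    qed
    finally have "P dvd f ^ (d * Eh) * coeff (taylor_poly \<Psi>) l" using cond\<delta>[OF l] by simp
    moreover have "prime_elem P" using \<open>irreducible P\<close> by (simp add: prime_elem_iff_irreducible)
    ultimately show "P dvd coeff (taylor_poly \<Psi>) l"
      using S(2)[OF P] by (metis prime_elem_dvd_mult_iff prime_elem_dvd_power)
  qed
  have "(\<Prod>P\<in>S. P ^ M) dvd \<Psi>" using S(1,2) PM by (intro prod_irreducible_power_dvd) auto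
  then have "degree (\<Prod>P\<in>S. P ^ M) \<le> degree \<Psi>" using \<open>\<Psi> \<noteq> 0\<close> by (rule dvd_imp_degree_le)
  moreover have "degree (\<Prod>P\<in>S. P ^ M) = (\<Sum>P\<in>S. M * degree P)"
  proof -
    have nz: "P \<noteq> 0" if "P \<in> S" for P using S(2)[OF that] by auto
    then have "degree (\<Prod>P\<in>S. P ^ M) = (\<Sum>P\<in>S. degree (P ^ M))"
      by (intro degree_prod_eq_sum_degree) auto
    then show ?thesis using nz by (simp add: degree_power_eq mult.commute)
  qed
  ultimately show ?thesis using deg\<Psi> by (simp add: sum_distrib_left)
qed

section \<open>Norms from extensions of a prime field\<close>

interpretation to_ac_hom: field_hom "to_ac :: 'a::field \<Rightarrow> 'a alg_closure"
  by unfold_locales auto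

interpretation map_poly_to_ac: map_poly_inj_idom_hom "to_ac :: 'a::field \<Rightarrow> 'a alg_closure" ..

lemma frobenius_ac_add:
  fixes x y :: "'a::prime_card mod_ring alg_closure"
  shows "(x + y) ^ (CARD('a) ^ n) = x ^ (CARD('a) ^ n) + y ^ (CARD('a) ^ n)"
  by (rule freshmans_dream'[where n = n]) (use prime_card in auto)

lemma frobenius_ac_diff:
  fixes x y :: "'a::prime_card mod_ring alg_closure"
  shows "(x - y) ^ (CARD('a) ^ n) = x ^ (CARD('a) ^ n) - y ^ (CARD('a) ^ n)"
  using frobenius_ac_add[of "x - y" y n] by (simp add: algebra_simps)

lemma mod_ring_power_card_power: "(c :: 'a::prime_card mod_ring) ^ (CARD('a) ^ n) = c"
  using finite_field_power_card_power_eq_same[of "CARD('a) ^ n" n c] by simp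

lemma mod_ring_power_card: "(c :: 'a::prime_card mod_ring) ^ CARD('a) = c"
  using mod_ring_power_card_power[of c 1] by simp

lemma poly_to_ac_frobenius:
  fixes h :: "'a::prime_card mod_ring poly"
  shows "poly (map_poly to_ac h) x ^ (CARD('a) ^ n) = poly (map_poly to_ac h) (x ^ (CARD('a) ^ n))"
proof (induction h)
  case 0
  then show ?case using prime_gt_0_nat[OF prime_card[where ?'a='a]] by (simp add: power_0_left)
next
  case (pCons a h)
  have "to_ac a ^ (CARD('a) ^ n) = to_ac a"
    using mod_ring_power_card_power[of a n] by (metis to_ac_power)
  then show ?case using pCons by (simp add: frobenius_ac_add power_mult_distrib)
qed

text \<open>The polynomial \<open>X ^ p - X\<close> has at most \<open>p\<close> roots, and the
  elements of the prime field already account for that many.\<close>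

lemma frobenius_fixed_imp_range_to_ac:
  fixes y :: "'a::prime_card mod_ring alg_closure"
  assumes "y ^ CARD('a) = y"
  shows "y \<in> range to_ac"
proof -
  define Q :: "'a mod_ring alg_closure poly" where "Q = monom 1 (CARD('a)) - [:0, 1:]"
  have c2: "CARD('a) \<ge> 2" using prime_card[where ?'a='a] by (simp add: prime_ge_2_nat)
  have "coeff Q (CARD('a)) = 1" using c2 by (simp add: Q_def coeff_pCons split: nat.split)
  then have Q0: "Q \<noteq> 0" by auto
  have "degree Q \<le> CARD('a)" unfolding Q_def using c2
    by (intro degree_diff_le) (auto simp: degree_monom_eq)
  then have le: "card {y. poly Q y = 0} \<le> CARD('a)" using card_poly_roots_bound[OF Q0] by simp
  have sub: "range to_ac \<subseteq> {y. poly Q y = 0}"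
  proof clarify
    fix c :: "'a mod_ring"
    have "to_ac c ^ CARD('a) = to_ac c" using mod_ring_power_card[of c] by (metis to_ac_power)
    then show "poly Q (to_ac c) = 0" by (simp add: Q_def poly_monom)
  qed
  have "card (range (to_ac :: 'a mod_ring \<Rightarrow> _)) = CARD('a)"
    by (simp add: card_image inj_to_ac)
  then have "range to_ac = {y. poly Q y = 0}"
    using sub le poly_roots_finite[OF Q0] card_mono[OF _ sub] by (intro card_subset_eq) auto
  then show ?thesis using assms by (auto simp: Q_def poly_monom)
qed

text \<open>Otherwise \<open>P\<close> and \<open>h\<close> are coprime, and a Bezout identity
  evaluated at the common root reads \<open>0 = 1\<close>. All divisibilities by \<open>P\<close>
  are obtained in this way from computations in the algebraic closure.\<close>

lemma root_imp_dvd: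
  fixes P h :: "'a::field_gcd poly"
  assumes "irreducible P" "poly (map_poly to_ac P) x = 0" "poly (map_poly to_ac h) x = 0"
  shows "P dvd h"
proof (rule ccontr)
  assume "\<not> P dvd h"
  then have "coprime P h"
    using assms(1) by (simp add: prime_elem_iff_irreducible prime_elem_imp_coprime)
  then obtain u v where "u * P + v * h = 1"
    using bezout_coefficients[of P h] by (metis coprime_imp_gcd_eq_1 bezout_coefficients_fst_snd)
  then have "poly (map_poly to_ac (u * P + v * h)) x = 1" by simp
  then show False using assms by (simp add: map_poly_to_ac.hom_add map_poly_to_ac.hom_mult)
qed

text \<open>The Frobenius orbit of a root \<open>x\<close> is finite, and the product
  \<open>R\<close> over the orbit is fixed by Frobenius, so it has coefficients in the prime field.
  Thus \<open>P\<close> divides \<open>R\<close>; conversely the whole orbit consists of roots of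
  \<open>P\<close>, so the degrees agree and the two monic polynomials coincide.\<close>

lemma irreducible_poly_split:
  fixes P :: "'a::prime_card mod_ring poly"
  assumes P: "irreducible P" "monic P"
  obtains x where "map_poly to_ac P = (\<Prod>i<degree P. [:- (x ^ (CARD('a) ^ i)), 1:])"
    "x ^ (CARD('a) ^ degree P) = x" "poly (map_poly to_ac P) x = 0"
proof -
  define q0 where "q0 = CARD('a)"
  have q0: "q0 \<ge> 2" unfolding q0_def using prime_card[where ?'a='a] by (simp add: prime_ge_2_nat)
  have P0: "P \<noteq> 0" "map_poly to_ac P \<noteq> 0" using P(1) by auto
  have "degree P > 0" using P(1) P0 by (auto simp: irreducible_def is_unit_iff_degree)
  then obtain x where x: "poly (map_poly to_ac P) x = 0"
    using alg_closed_imp_poly_has_root[of "map_poly to_ac P"] by auto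
  have roots: "poly (map_poly to_ac P) (x ^ (q0 ^ i)) = 0" for i
    using poly_to_ac_frobenius[of P x i] x q0 by (auto simp: q0_def power_0_left)
  have inj: "u = v" if "u ^ (q0 ^ i) = v ^ (q0 ^ i)" for u v :: "'a mod_ring alg_closure" and i
    using frobenius_ac_diff[of u v i] that q0 by (simp add: q0_def)
  have "\<not> inj_on (\<lambda>i. x ^ (q0 ^ i)) UNIV"
  proof
    assume "inj_on (\<lambda>i. x ^ (q0 ^ i)) UNIV"
    then have "infinite (range (\<lambda>i. x ^ (q0 ^ i)))" using finite_imageD by blast
    moreover have "range (\<lambda>i. x ^ (q0 ^ i)) \<subseteq> {y. poly (map_poly to_ac P) y = 0}" using roots by auto
    ultimately show False using poly_roots_finite[OF P0(2)] finite_subset by blast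
  qed
  then obtain i j where ij: "i < j" "x ^ (q0 ^ i) = x ^ (q0 ^ j)" by (auto simp: inj_on_def) (metis linorder_less_linear)
  have "(x ^ (q0 ^ (j - i))) ^ (q0 ^ i) = x ^ (q0 ^ i)"
    using ij by (simp flip: power_mult power_add)
  then have "x ^ (q0 ^ (j - i)) = x" by (rule inj)
  then have ex: "\<exists>n. n > 0 \<and> x ^ (q0 ^ n) = x" using ij by (intro exI[of _ "j - i"]) auto
  define n where "n = (LEAST n. n > 0 \<and> x ^ (q0 ^ n) = x)"
  have n: "n > 0" "x ^ (q0 ^ n) = x" using LeastI_ex[OF ex] by (auto simp: n_def)
  have nmin: "n \<le> k" if "k > 0" "x ^ (q0 ^ k) = x" for k using that by (auto simp: n_def intro: Least_le)
  have injn: "inj_on (\<lambda>i. x ^ (q0 ^ i)) {..<n}"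
  proof -
    have False if "i < j" "j < n" "x ^ (q0 ^ i) = x ^ (q0 ^ j)" for i j
    proof -
      have "(x ^ (q0 ^ (j - i))) ^ (q0 ^ i) = x ^ (q0 ^ i)"
        using that by (simp flip: power_mult power_add)
      then have "x ^ (q0 ^ (j - i)) = x" by (rule inj)
      then show False using nmin[of "j - i"] that by auto
    qed
    then show ?thesis by (intro inj_onI) (metis lessThan_iff linorder_less_linear)
  qed
  define R where "R = (\<Prod>i<n. [:- (x ^ (q0 ^ i)), 1:])"
  interpret F: comm_ring_hom "\<lambda>y :: 'a mod_ring alg_closure. y ^ q0"
    by unfold_locales (use q0 frobenius_ac_add[where n = 1 and 'a='a] in \<open>auto simp: power_mult_distrib q0_def power_0_left\<close>)
  interpret FP: map_poly_comm_ring_hom "\<lambda>y :: 'a mod_ring alg_closure. y ^ q0" ..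
  have "map_poly (\<lambda>y. y ^ q0) R = (\<Prod>i<n. map_poly (\<lambda>y. y ^ q0) [:- (x ^ (q0 ^ i)), 1:])"
    unfolding R_def by (rule FP.hom_prod)
  also have "\<dots> = (\<Prod>i<n. [:- (x ^ (q0 ^ Suc i)), 1:])"
    using F.hom_uminus by (intro prod.cong refl) (simp add: F.map_poly_pCons_hom mult.commute flip: power_mult)
  also have "\<dots> = R"
  proof -
    have "(\<Prod>i<Suc n. [:- (x ^ (q0 ^ i)), 1:]) = [:- x, 1:] * (\<Prod>i<n. [:- (x ^ (q0 ^ Suc i)), 1:])"
      by (simp only: prod.lessThan_Suc_shift power_0 power_one_right)
    moreover have "(\<Prod>i<Suc n. [:- (x ^ (q0 ^ i)), 1:]) = [:- x, 1:] * R"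
      by (simp only: prod.lessThan_Suc n(2) R_def mult.commute)
    ultimately have "[:- x, 1:] * (\<Prod>i<n. [:- (x ^ (q0 ^ Suc i)), 1:]) = [:- x, 1:] * R" by (simp only:)
    moreover have "[:- x, 1:] \<noteq> 0" by simp
    ultimately show ?thesis using mult_left_cancel by blast
  qed
  finally have FR: "map_poly (\<lambda>y. y ^ q0) R = R" .
  have "coeff R i \<in> range to_ac" for i
  proof (rule frobenius_fixed_imp_range_to_ac)
    have "coeff (map_poly (\<lambda>y. y ^ q0) R) i = coeff R i ^ q0" using q0 by (simp add: coeff_map_poly power_0_left)
    then show "coeff R i ^ CARD('a) = coeff R i" by (metis FR q0_def)
  qed
  then have "map_poly to_ac (map_poly of_ac R) = R"
    by (intro poly_eqI) (simp add: coeff_map_poly to_ac_of_ac)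
  then obtain R0 where R0: "map_poly to_ac R0 = R" by blast
  have degR: "degree R = n" unfolding R_def by (subst degree_prod_eq_sum_degree) simp_all
  have monR: "monic R" unfolding R_def by (rule monic_prod) auto
  have degR0: "degree R0 = n" using degR unfolding R0[symmetric] by simp
  have "to_ac (coeff R0 n) = coeff R n" unfolding R0[symmetric] by (simp add: coeff_map_poly)
  also have "\<dots> = to_ac 1" using monR degR by simp
  finally have monR0: "monic R0" using degR0 by (simp only: to_ac_eq_iff)
  have "poly R x = 0" unfolding R_def poly_prod using n by (auto intro!: bexI[of _ 0])
  then have PR: "P dvd R0" using root_imp_dvd[OF P(1) x] R0 by simp
  have "n = card ((\<lambda>i. x ^ (q0 ^ i)) ` {..<n})" using injn by (simp add: card_image)
  also have "\<dots> \<le> card {y. poly (map_poly to_ac P) y = 0}"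
    using roots by (intro card_mono poly_roots_finite P0) auto
  also have "\<dots> \<le> degree P" using card_poly_roots_bound[OF P0(2)] by simp
  finally have "n \<le> degree P" .
  moreover have "degree P \<le> n" using PR degR0 n by (metis degree_0 dvd_imp_degree_le not_less_zero)
  ultimately have "degree P = n" by simp
  obtain H where H: "R0 = P * H" using PR by (elim dvdE)
  have "R0 \<noteq> 0" using degR0 n by auto
  then have "degree H = 0" using H degR0 \<open>degree P = n\<close> by (auto simp: degree_mult_eq)
  then obtain c where "H = [:c:]" by (metis degree_eq_zeroE)
  moreover have "lead_coeff R0 = lead_coeff P * lead_coeff H" unfolding H by (rule lead_coeff_mult)
  ultimately have "R0 = P" using H monR0 P(2) by auto
  then show ?thesis using that[of x] R0 n x \<open>degree P = n\<close> by (simp add: R_def q0_def)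
qed

lemma dvd_frobenius_poly:
  fixes P :: "'a::prime_card mod_ring poly"
  assumes P: "irreducible P" "monic P" "degree P dvd k"
  shows "P dvd [:0, 1:] ^ (CARD('a) ^ k) - [:0, 1:]"
proof -
  obtain x where x: "x ^ (CARD('a) ^ degree P) = x" "poly (map_poly to_ac P) x = 0"
    using irreducible_poly_split[OF P(1,2)] by metis
  obtain j where k: "k = degree P * j" using P(3) by (elim dvdE)
  have "x ^ (CARD('a) ^ (degree P * j)) = x" for j
  proof (induction j)
    case (Suc j)
    have "x ^ (CARD('a) ^ (degree P * Suc j)) = (x ^ (CARD('a) ^ degree P)) ^ (CARD('a) ^ (degree P * j))"
      by (simp add: power_add flip: power_mult)
    then show ?case using x(1) Suc by simp
  qed auto
  then have "poly (map_poly to_ac ([:0, 1:] ^ (CARD('a) ^ k) - [:0, 1:])) x = 0"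
    unfolding map_poly_to_ac.hom_minus map_poly_to_ac.hom_power by (simp add: k)
  then show ?thesis using root_imp_dvd[OF P(1) x(2)] by blast
qed

text \<open>At a root \<open>x\<close> of \<open>P\<close> the norm of \<open>x - c\<close> is the
  product of its conjugates \<open>x ^ (CARD('a) ^ i) - c\<close>. The same product is
  \<open>P(c)\<close> up to the sign of each factor.\<close>

lemma dvd_linear_norm:
  fixes P :: "'a::prime_card mod_ring poly"
  assumes P: "irreducible P" "monic P"
  shows "P dvd [:- c, 1:] ^ rep_unit CARD('a) (degree P) - [:(- 1) ^ degree P * poly P c:]"
proof -
  obtain x where x: "map_poly to_ac P = (\<Prod>i<degree P. [:- (x ^ (CARD('a) ^ i)), 1:])"
     "poly (map_poly to_ac P) x = 0"
    using irreducible_poly_split[OF P] by metis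
  have "to_ac (poly P c) = poly (map_poly to_ac P) (to_ac c)" by simp
  also have "\<dots> = (\<Prod>i<degree P. to_ac c - x ^ (CARD('a) ^ i))"
    unfolding x(1) poly_prod by (intro prod.cong refl) auto
  also have "\<dots> = (\<Prod>i<degree P. (- 1) * (x - to_ac c) ^ (CARD('a) ^ i))"
  proof (intro prod.cong refl)
    fix i
    have "to_ac c ^ (CARD('a) ^ i) = to_ac c"
      using mod_ring_power_card_power[of c i] by (metis to_ac_power)
    then show "to_ac c - x ^ (CARD('a) ^ i) = (- 1) * (x - to_ac c) ^ (CARD('a) ^ i)"
      by (simp add: frobenius_ac_diff)
  qed
  also have "\<dots> = (- 1) ^ degree P * (x - to_ac c) ^ rep_unit CARD('a) (degree P)"
    unfolding prod.distrib rep_unit_def power_sum by simp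
  finally have "to_ac ((- 1) ^ degree P * poly P c) = (x - to_ac c) ^ rep_unit CARD('a) (degree P)"
    by (simp flip: power_mult_distrib mult.assoc)
  then have "poly (map_poly to_ac ([:- c, 1:] ^ rep_unit CARD('a) (degree P) - [:(- 1) ^ degree P * poly P c:])) x = 0"
    unfolding map_poly_to_ac.hom_minus map_poly_to_ac.hom_power
    by (simp add: to_ac_hom.map_poly_pCons_hom del: to_ac_hom.hom_mult to_ac_mult to_ac_hom.hom_power to_ac_power)
  then show ?thesis using root_imp_dvd[OF P(1) x(2)] by blast
qed

text \<open>Transitivity of the norm, on exponents: from degree \<open>D * j\<close> down to degree
  \<open>D\<close>, and from there to the prime field.\<close>

lemma rep_unit_mult_arg: "rep_unit b (D * j) = rep_unit b D * rep_unit (b ^ D) j"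
proof (induction j)
  case (Suc j)
  have "rep_unit b (D * Suc j) = rep_unit b (D * j + D)" by (simp add: add.commute)
  also have "\<dots> = rep_unit b (D * j) + b ^ (D * j) * rep_unit b D" by (rule rep_unit_add)
  finally show ?case using Suc by (simp add: rep_unit_def power_mult algebra_simps)
qed (simp add: rep_unit_def)

text \<open>The value of the norm of \<open>f\<close> at a root of \<open>P\<close> is the resultant of \<open>P\<close> and \<open>f\<close>.\<close>

lemma dvd_power_rep_unit_diff:
  fixes P :: "'a::prime_card mod_ring poly"
  assumes P: "irreducible P" "monic P"
  defines "D \<equiv> degree P"
  shows "P dvd (\<Prod>c\<in>C. [:- c, 1:] ^ e c) ^ rep_unit CARD('a) (D * j)
           - [:(\<Prod>c\<in>C. ((- 1) ^ D * poly P c) ^ e c) ^ j:]"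
proof -
  define \<nu> where "\<nu> c = (- 1) ^ D * poly P c" for c
  let ?E = "rep_unit CARD('a) D"
  have cong_mult: "P dvd u - v \<Longrightarrow> P dvd u' - v' \<Longrightarrow> P dvd u * u' - v * v'" for u v u' v'
  proof -
    assume "P dvd u - v" "P dvd u' - v'"
    then have "P dvd (u - v) * u' + v * (u' - v')" by (intro dvd_add dvd_mult dvd_mult2)
    moreover have "(u - v) * u' + v * (u' - v') = u * u' - v * v'" by (simp add: algebra_simps)
    ultimately show ?thesis by simp
  qed
  have "P dvd (\<Prod>c\<in>C. ([:- c, 1:] ^ ?E) ^ e c) - (\<Prod>c\<in>C. [:\<nu> c:] ^ e c)"
  proof (induction C rule: infinite_finite_induct)
    case (insert c C)
    show ?case unfolding prod.insert[OF insert.hyps]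
      by (rule cong_mult[OF dvd_power_diff insert.IH])
        (use dvd_linear_norm[OF P, of c] in \<open>simp add: \<nu>_def D_def\<close>)
  qed auto
  moreover have "(\<Prod>c\<in>C. ([:- c, 1:] ^ ?E) ^ e c) = (\<Prod>c\<in>C. [:- c, 1:] ^ e c) ^ ?E"
    unfolding prod_power_distrib by (intro prod.cong refl) (simp add: mult.commute flip: power_mult)
  moreover have "(\<Prod>c\<in>C. [:\<nu> c:] ^ e c) = [:\<Prod>c\<in>C. \<nu> c ^ e c:]"
    by (induction C rule: infinite_finite_induct) (auto simp: poly_const_pow pCons_one)
  ultimately have "P dvd (\<Prod>c\<in>C. [:- c, 1:] ^ e c) ^ ?E - [:\<Prod>c\<in>C. \<nu> c ^ e c:]" by simp
  then have "P dvd ((\<Prod>c\<in>C. [:- c, 1:] ^ e c) ^ ?E) ^ rep_unit (CARD('a) ^ D) j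
      - [:\<Prod>c\<in>C. \<nu> c ^ e c:] ^ rep_unit (CARD('a) ^ D) j" by (rule dvd_power_diff)
  \<comment> \<open>Conjugation is trivial on the prime field, so there the norm of a degree
    \<open>j\<close> extension is the \<open>j\<close>-th power.\<close>
  moreover have "z ^ rep_unit (CARD('a) ^ D) j = z ^ j" for z :: "'a mod_ring"
    by (induction j) (auto simp: rep_unit_def power_add mod_ring_power_card_power mult.commute simp flip: power_mult)
  ultimately show ?thesis
    by (simp add: rep_unit_mult_arg power_mult poly_const_pow \<nu>_def)
qed

section \<open>L-functions of characters on monic polynomials\<close>

definition monic_polys :: "nat \<Rightarrow> 'a::prime_card mod_ring poly set" where
  "monic_polys n = {g. monic g \<and> degree g = n}"

definition prime_polys :: "nat \<Rightarrow> 'a::prime_card mod_ring poly set" where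
  "prime_polys n = {P. prime P \<and> degree P \<le> n}"

lemma prime_poly_iff: "prime P \<longleftrightarrow> irreducible P \<and> monic P" for P :: "'a::prime_card mod_ring poly"
proof
  assume P: "prime P"
  then have "irreducible P" by (intro prime_elem_imp_irreducible) auto
  have "normalize P = P" using P by simp
  then have "unit_factor P = 1" using P unit_factor_normalize[of P] by force
  then have "monic P" by (simp add: unit_factor_poly_def unit_factor_mod_ring_def monom_0 pCons_one[symmetric])
  then show "irreducible P \<and> monic P" using \<open>irreducible P\<close> by simp
next
  assume "irreducible P \<and> monic P"
  then show "prime P" by (simp add: normalization_semidom_class.prime_def prime_elem_iff_irreducible normalize_monic)
qed

lemma prime_poly_degree_pos: "prime P \<Longrightarrow> degree P > 0" for P :: "'a::prime_card mod_ring poly"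
  by (metis gr0I is_unit_iff_degree not_prime_0 not_prime_unit)

lemma card_mod_ring_ge_2: "CARD('a::prime_card) \<ge> 2"
  using prime_card[where ?'a='a] by (simp add: prime_ge_2_nat)

lemma finite_degree_le: "finite {g::'a::prime_card mod_ring poly. degree g \<le> n}"
  using card_degree_less(1)[of "Suc n", where 'a="'a mod_ring"] by (simp add: less_Suc_eq_le)

lemma finite_monic_polys [simp]: "finite (monic_polys n :: 'a::prime_card mod_ring poly set)"
  by (rule finite_subset[OF _ finite_degree_le[of n]]) (auto simp: monic_polys_def)

lemma finite_prime_polys [simp]: "finite (prime_polys n :: 'a::prime_card mod_ring poly set)"
  by (rule finite_subset[OF _ finite_degree_le[of n]]) (auto simp: prime_polys_def)

lemma monic_polys_0: "monic_polys 0 = {1}"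
  by (auto simp: monic_polys_def pCons_one elim!: degree_eq_zeroE)

lemma monic_polys_1: "monic_polys 1 = range (\<lambda>a::'a::prime_card mod_ring. [:- a, 1:])"
proof
  show "range (\<lambda>a::'a mod_ring. [:- a, 1:]) \<subseteq> monic_polys 1" by (auto simp: monic_polys_def)
  show "monic_polys 1 \<subseteq> range (\<lambda>a::'a mod_ring. [:- a, 1:])"
  proof
    fix g :: "'a mod_ring poly" assume "g \<in> monic_polys 1"
    then have g: "degree g = 1" "coeff g 1 = 1" by (auto simp: monic_polys_def)
    then have "g = [:- (- coeff g 0), 1:]"
      by (intro poly_eqI) (auto simp: coeff_pCons coeff_eq_0 split: nat.splits)
    then show "g \<in> range (\<lambda>a. [:- a, 1:])" by blast
  qed
qed

lemma card_monic_polys: "card (monic_polys n :: 'a::prime_card mod_ring poly set) = CARD('a) ^ n"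
proof (cases "n = 0")
  case False
  have "bij_betw (\<lambda>h. monom 1 n + h) {h::'a mod_ring poly. degree h < n} (monic_polys n)"
  proof (rule bij_betwI[where g = "\<lambda>g. g - monom 1 n"])
    show "(\<lambda>h. monom 1 n + h) \<in> {h::'a mod_ring poly. degree h < n} \<rightarrow> monic_polys n"
      using False by (auto simp: monic_polys_def degree_add_eq_left degree_monom_eq coeff_eq_0)
    show "(\<lambda>g. g - monom 1 n) \<in> monic_polys n \<rightarrow> {h::'a mod_ring poly. degree h < n}"
    proof (clarify)
      fix g :: "'a mod_ring poly" assume g: "g \<in> monic_polys n"
      show "degree (g - monom 1 n) < n"
        using False g by (intro degree_lessI) (auto simp: monic_polys_def coeff_eq_0)
    qed
  qed auto
  from bij_betw_same_card[OF this] show ?thesis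
    using card_degree_less(2)[of n, where 'a="'a mod_ring"] False by simp
qed (simp add: monic_polys_0)

text \<open>The polynomial counterpart of writing \<open>log n\<close> as the sum of von Mangoldt's
  function over the divisors of \<open>n\<close>: each prime factor contributes its degree once for
  every power of it that divides \<open>g\<close>.\<close>

lemma degree_eq_sum_prime_powers:
  fixes g :: "'a::prime_card mod_ring poly"
  assumes "g \<in> monic_polys n"
  shows "n = (\<Sum>P\<in>prime_polys n. \<Sum>i\<in>{1..n}. if P ^ i dvd g then degree P else 0)"
proof -
  have g: "monic g" "degree g = n" "g \<noteq> 0" using assms by (auto simp: monic_polys_def)
  have pf: "prime_factors g \<subseteq> prime_polys n"
    using g by (auto simp: prime_polys_def in_prime_factors_iff dvd_imp_degree_le)
  have "g = (\<Prod>P\<in>prime_factors g. P ^ multiplicity P g)"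
    using prod_prime_factors[OF g(3)] g(1) by (simp add: normalize_monic)
  then have "n = degree (\<Prod>P\<in>prime_factors g. P ^ multiplicity P g)" using g(2) by simp
  also have "\<dots> = (\<Sum>P\<in>prime_factors g. degree (P ^ multiplicity P g))"
    by (intro degree_prod_eq_sum_degree) auto
  also have "\<dots> = (\<Sum>P\<in>prime_factors g. multiplicity P g * degree P)"
    by (intro sum.cong refl) (auto simp: degree_power_eq in_prime_factors_iff)
  also have "\<dots> = (\<Sum>P\<in>prime_polys n. multiplicity P g * degree P)"
  proof (rule sum.mono_neutral_left[OF _ pf])
    show "\<forall>P\<in>prime_polys n - prime_factors g. multiplicity P g * degree P = 0"
      using g(3) by (auto simp: prime_polys_def in_prime_factors_iff not_dvd_imp_multiplicity_0)
  qed auto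
  also have "\<dots> = (\<Sum>P\<in>prime_polys n. \<Sum>i\<in>{1..n}. if P ^ i dvd g then degree P else 0)"
  proof (intro sum.cong refl)
    fix P :: "'a mod_ring poly" assume P: "P \<in> prime_polys n"
    then have "prime P" by (simp add: prime_polys_def)
    have iff: "P ^ i dvd g \<longleftrightarrow> i \<le> multiplicity P g" for i
      using prime_poly_degree_pos[OF \<open>prime P\<close>] g(3)
      by (intro power_dvd_iff_le_multiplicity) (auto simp: is_unit_iff_degree)
    have "P ^ multiplicity P g dvd g" by (simp add: multiplicity_dvd)
    then have "degree (P ^ multiplicity P g) \<le> n" using g dvd_imp_degree_le by blast
    then have "multiplicity P g * degree P \<le> n" using \<open>prime P\<close> by (simp add: degree_power_eq mult.commute)
    moreover have "multiplicity P g * 1 \<le> multiplicity P g * degree P"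
      using prime_poly_degree_pos[OF \<open>prime P\<close>] by (intro mult_left_mono) auto
    ultimately have le: "multiplicity P g \<le> n" by linarith
    have "(\<Sum>i\<in>{1..n}. if P ^ i dvd g then degree P else 0) = (\<Sum>i\<in>{i\<in>{1..n}. P ^ i dvd g}. degree P)"
      by (simp only: sum.inter_filter finite_atLeastAtMost)
    also have "{i\<in>{1..n}. P ^ i dvd g} = {1..multiplicity P g}" using le by (auto simp: iff)
    finally show "multiplicity P g * degree P = (\<Sum>i\<in>{1..n}. if P ^ i dvd g then degree P else 0)" by simp
  qed
  finally show ?thesis .
qed

text \<open>The coefficient of \<open>t ^ n\<close> in the L-function of
  \<open>\<Lambda>\<close>.\<close>

definition char_coeff :: "('a::prime_card mod_ring poly \<Rightarrow> complex) \<Rightarrow> nat \<Rightarrow> complex" where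
  "char_coeff \<Lambda> n = (\<Sum>g\<in>monic_polys n. \<Lambda> g)"

text \<open>The coefficient of \<open>t ^ n\<close> in \<open>t * L'(t) / L(t)\<close>, computed
  from the Euler product. It is the character sum over the extension of degree \<open>n\<close>: an
  irreducible \<open>P\<close> of degree dividing \<open>n\<close> stands for its
  \<open>degree P\<close> conjugate roots.\<close>

definition char_power_sum :: "('a::prime_card mod_ring poly \<Rightarrow> complex) \<Rightarrow> nat \<Rightarrow> complex" where
  "char_power_sum \<Lambda> n = (\<Sum>P\<in>{P\<in>prime_polys n. degree P dvd n}. of_nat (degree P) * \<Lambda> P ^ (n div degree P))"

definition char_on_monic :: "('a::prime_card mod_ring poly \<Rightarrow> complex) \<Rightarrow> bool" where
  "char_on_monic \<Lambda> \<longleftrightarrow> \<Lambda> 1 = 1 \<and> (\<forall>g h. monic g \<longrightarrow> monic h \<longrightarrow> \<Lambda> (g * h) = \<Lambda> g * \<Lambda> h)"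

lemma char_on_monic_power:
  assumes "char_on_monic \<Lambda>" "monic g" shows "\<Lambda> (g ^ i) = \<Lambda> g ^ i"
  using assms by (induction i) (auto simp: char_on_monic_def monic_power)

lemma sum_monic_multiples:
  fixes P :: "'a::prime_card mod_ring poly"
  assumes "char_on_monic \<Lambda>" "monic P"
  shows "(\<Sum>g\<in>{g\<in>monic_polys n. P ^ i dvd g}. \<Lambda> g)
     = (if i * degree P \<le> n then \<Lambda> P ^ i * char_coeff \<Lambda> (n - i * degree P) else 0)"
proof (cases "i * degree P \<le> n")
  case True
  have P0: "P \<noteq> 0" using assms(2) by auto
  have mP: "monic (P ^ i)" using assms(2) by (rule monic_power)
  have "bij_betw (\<lambda>h. P ^ i * h) (monic_polys (n - i * degree P)) {g\<in>monic_polys n. P ^ i dvd g}"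
    unfolding bij_betw_def
  proof
    show "inj_on (\<lambda>h. P ^ i * h) (monic_polys (n - i * degree P))" using P0 by (auto intro: inj_onI)
    show "(\<lambda>h. P ^ i * h) ` monic_polys (n - i * degree P) = {g\<in>monic_polys n. P ^ i dvd g}"
    proof (intro equalityI subsetI)
      fix g assume "g \<in> (\<lambda>h. P ^ i * h) ` monic_polys (n - i * degree P)"
      then obtain h where "g = P ^ i * h" "h \<in> monic_polys (n - i * degree P)" by blast
      then have h: "g = P ^ i * h" "monic h" "degree h = n - i * degree P"
        by (auto simp: monic_polys_def)
      have "h \<noteq> 0" using h by auto
      then have "degree g = n" using h P0 True by (simp add: degree_mult_eq degree_power_eq)
      moreover have "monic g" using h(1,2) mP by (simp add: monic_mult)
      ultimately show "g \<in> {g\<in>monic_polys n. P ^ i dvd g}" using h by (simp add: monic_polys_def)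
    next
      fix g assume "g \<in> {g\<in>monic_polys n. P ^ i dvd g}"
      then have "P ^ i dvd g" "monic g" "degree g = n" by (auto simp: monic_polys_def)
      then obtain h where h: "g = P ^ i * h" "monic g" "degree g = n" by (metis dvdE)
      have "h \<noteq> 0" using h by auto
      then have "degree h = n - i * degree P" using h P0 by (auto simp: degree_mult_eq degree_power_eq)
      moreover have "monic h" using h mP by (metis lead_coeff_mult mult_1)
      ultimately show "g \<in> (\<lambda>h. P ^ i * h) ` monic_polys (n - i * degree P)"
        using h by (auto simp: monic_polys_def)
    qed
  qed
  then have "(\<Sum>g\<in>{g\<in>monic_polys n. P ^ i dvd g}. \<Lambda> g)
      = (\<Sum>h\<in>monic_polys (n - i * degree P). \<Lambda> (P ^ i * h))"
    by (rule sum.reindex_bij_betw[symmetric])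
  also have "\<dots> = (\<Sum>h\<in>monic_polys (n - i * degree P). \<Lambda> P ^ i * \<Lambda> h)"
    using assms mP by (intro sum.cong refl) (auto simp: monic_polys_def char_on_monic_power[symmetric] char_on_monic_def)
  finally show ?thesis using True by (simp add: char_coeff_def sum_distrib_left)
next
  case False
  have "\<not> P ^ i dvd g" if g: "g \<in> monic_polys n" for g
  proof
    assume "P ^ i dvd g"
    moreover have "g \<noteq> 0" "degree g = n" using g by (auto simp: monic_polys_def)
    ultimately have "degree (P ^ i) \<le> n" using dvd_imp_degree_le by blast
    moreover have "P \<noteq> 0" using assms(2) by auto
    ultimately show False using False by (simp add: degree_power_eq mult.commute)
  qed
  then have e: "{g\<in>monic_polys n. P ^ i dvd g} = {}" by blast
  show ?thesis using False unfolding e by simp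
qed

text \<open>The logarithmic derivative of the Euler product, on the level of coefficients.\<close>

lemma newton_identity:
  fixes \<Lambda> :: "'a::prime_card mod_ring poly \<Rightarrow> complex"
  assumes "char_on_monic \<Lambda>"
  shows "of_nat n * char_coeff \<Lambda> n = (\<Sum>j\<in>{1..n}. char_power_sum \<Lambda> j * char_coeff \<Lambda> (n - j))"
proof -
  have "of_nat n * char_coeff \<Lambda> n = (\<Sum>g\<in>monic_polys n. of_nat n * \<Lambda> g)"
    by (simp add: char_coeff_def sum_distrib_left)
  also have "\<dots> = (\<Sum>g\<in>monic_polys n. \<Sum>P\<in>prime_polys n. \<Sum>i\<in>{1..n}. if P ^ i dvd g then of_nat (degree P) * \<Lambda> g else 0)"
  proof (intro sum.cong refl)
    fix g :: "'a mod_ring poly" assume g: "g \<in> monic_polys n"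
    have "of_nat n = (\<Sum>P\<in>prime_polys n. \<Sum>i\<in>{1..n}. if P ^ i dvd g then of_nat (degree P) else 0 :: complex)"
      by (subst (1) degree_eq_sum_prime_powers[OF g]) (simp add: if_distrib[of of_nat] cong: if_cong)
    then show "of_nat n * \<Lambda> g = (\<Sum>P\<in>prime_polys n. \<Sum>i\<in>{1..n}. if P ^ i dvd g then of_nat (degree P) * \<Lambda> g else 0)"
      by (simp only: sum_distrib_right if_distrib[of "\<lambda>x. x * \<Lambda> g"] mult_zero_left)
  qed
  also have "\<dots> = (\<Sum>P\<in>prime_polys n. \<Sum>i\<in>{1..n}. \<Sum>g\<in>monic_polys n. if P ^ i dvd g then of_nat (degree P) * \<Lambda> g else 0)"
    by (subst sum.swap, intro sum.cong refl, subst sum.swap, rule refl)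
  also have "\<dots> = (\<Sum>P\<in>prime_polys n. \<Sum>i\<in>{1..n}. if i * degree P \<le> n then of_nat (degree P) * \<Lambda> P ^ i * char_coeff \<Lambda> (n - i * degree P) else 0)"
  proof (intro sum.cong refl)
    fix P :: "'a mod_ring poly" and i assume "P \<in> prime_polys n"
    then have "monic P" by (simp add: prime_polys_def prime_poly_iff)
    have "(\<Sum>g\<in>monic_polys n. if P ^ i dvd g then of_nat (degree P) * \<Lambda> g else 0)
       = (\<Sum>g\<in>{g\<in>monic_polys n. P ^ i dvd g}. of_nat (degree P) * \<Lambda> g)"
      by (simp only: sum.inter_filter finite_monic_polys)
    also have "\<dots> = of_nat (degree P) * (\<Sum>g\<in>{g\<in>monic_polys n. P ^ i dvd g}. \<Lambda> g)"
      by (simp only: sum_distrib_left)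
    finally show "(\<Sum>g\<in>monic_polys n. if P ^ i dvd g then of_nat (degree P) * \<Lambda> g else 0)
      = (if i * degree P \<le> n then of_nat (degree P) * \<Lambda> P ^ i * char_coeff \<Lambda> (n - i * degree P) else 0)"
      using sum_monic_multiples[OF assms \<open>monic P\<close>, of n i] by simp
  qed
  also have "\<dots> = (\<Sum>P\<in>prime_polys n. \<Sum>j\<in>{1..n}. if degree P dvd j then of_nat (degree P) * \<Lambda> P ^ (j div degree P) * char_coeff \<Lambda> (n - j) else 0)"
  proof (rule sum.cong[OF refl])
    fix P :: "'a mod_ring poly" assume "P \<in> prime_polys n"
    then have D: "degree P > 0" using prime_poly_degree_pos[of P] by (simp add: prime_polys_def)
    let ?f = "\<lambda>i. of_nat (degree P) * \<Lambda> P ^ i * char_coeff \<Lambda> (n - i * degree P)"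
    have "(\<Sum>i\<in>{1..n}. if i * degree P \<le> n then ?f i else 0) = (\<Sum>i\<in>{i\<in>{1..n}. i * degree P \<le> n}. ?f i)"
      by (simp only: sum.inter_filter finite_atLeastAtMost)
    also have "\<dots> = (\<Sum>j\<in>{j\<in>{1..n}. degree P dvd j}. of_nat (degree P) * \<Lambda> P ^ (j div degree P) * char_coeff \<Lambda> (n - j))"
    proof (rule sum.reindex_bij_witness[where i = "\<lambda>j. j div degree P" and j = "\<lambda>i. i * degree P"])
      have le: "i \<le> i * degree P" for i using D by simp
      show "j div degree P \<in> {i\<in>{1..n}. i * degree P \<le> n}" if "j \<in> {j\<in>{1..n}. degree P dvd j}" for j
      proof -
        have "degree P dvd j" using that by simp
        then obtain i where i: "j = i * degree P" by (metis dvdE mult.commute)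
        have "i \<noteq> 0" using that i by auto
        moreover have "i \<le> n" using that i le[of i] by (simp only: mem_Collect_eq atLeastAtMost_iff) linarith
        ultimately show ?thesis using that D i by simp
      qed
      show "i * degree P \<in> {j\<in>{1..n}. degree P dvd j}" if "i \<in> {i\<in>{1..n}. i * degree P \<le> n}" for i
        using that le[of i] by auto
    qed (use D in auto)
    finally show "(\<Sum>i\<in>{1..n}. if i * degree P \<le> n then ?f i else 0)
      = (\<Sum>j\<in>{1..n}. if degree P dvd j then of_nat (degree P) * \<Lambda> P ^ (j div degree P) * char_coeff \<Lambda> (n - j) else 0)"
      by (simp only: sum.inter_filter finite_atLeastAtMost)
  qed
  also have "\<dots> = (\<Sum>j\<in>{1..n}. \<Sum>P\<in>prime_polys n. if degree P dvd j then of_nat (degree P) * \<Lambda> P ^ (j div degree P) * char_coeff \<Lambda> (n - j) else 0)"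
    by (rule sum.swap)
  also have "\<dots> = (\<Sum>j\<in>{1..n}. char_power_sum \<Lambda> j * char_coeff \<Lambda> (n - j))"
  proof (intro sum.cong refl)
    fix j assume j: "j \<in> {1..n}"
    have e: "{P\<in>prime_polys n. degree P dvd j} = {P\<in>prime_polys j. degree P dvd j}"
      using j by (auto simp: prime_polys_def dest: dvd_imp_le)
    have "(\<Sum>P\<in>prime_polys n. if degree P dvd j then of_nat (degree P) * \<Lambda> P ^ (j div degree P) * char_coeff \<Lambda> (n - j) else 0)
      = (\<Sum>P\<in>{P\<in>prime_polys n. degree P dvd j}. of_nat (degree P) * \<Lambda> P ^ (j div degree P) * char_coeff \<Lambda> (n - j))"
      by (rule sum.inter_filter[symmetric]) simp
    then show "(\<Sum>P\<in>prime_polys n. if degree P dvd j then of_nat (degree P) * \<Lambda> P ^ (j div degree P) * char_coeff \<Lambda> (n - j) else 0)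
      = char_power_sum \<Lambda> j * char_coeff \<Lambda> (n - j)"
      unfolding e char_power_sum_def sum_distrib_right .
  qed
  finally show ?thesis .
qed

text \<open>For \<open>\<Lambda> = 1\<close> the coefficients of the L-function are the numbers of
  monic polynomials, \<open>CARD('a) ^ n\<close>, and Newton's identities then determine the power
  sums recursively.\<close>

lemma sum_degree_prime_polys:
  assumes "n \<ge> 1"
  shows "(\<Sum>P\<in>{P\<in>prime_polys n :: 'a::prime_card mod_ring poly set. degree P dvd n}. degree P) = CARD('a) ^ n"
proof -
  define \<Lambda> :: "'a mod_ring poly \<Rightarrow> complex" where "\<Lambda> = (\<lambda>_. 1)"
  have \<Lambda>: "char_on_monic \<Lambda>" by (simp add: \<Lambda>_def char_on_monic_def)
  have A: "char_coeff \<Lambda> n = of_nat (CARD('a)) ^ n" for n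
    by (simp add: char_coeff_def \<Lambda>_def card_monic_polys)
  have "char_power_sum \<Lambda> n = of_nat (CARD('a)) ^ n" if "n \<ge> 1" for n
    using that
  proof (induction n rule: less_induct)
    case (less n)
    have "of_nat n * of_nat (CARD('a)) ^ n = (\<Sum>j\<in>{1..n}. char_power_sum \<Lambda> j * of_nat (CARD('a)) ^ (n - j))"
      using newton_identity[OF \<Lambda>, of n] by (simp add: A)
    also have "{1..n} = insert n {1..<n}" using less.prems by auto
    also have "(\<Sum>j\<in>insert n {1..<n}. char_power_sum \<Lambda> j * of_nat (CARD('a)) ^ (n - j))
       = char_power_sum \<Lambda> n + (\<Sum>j\<in>{1..<n}. char_power_sum \<Lambda> j * of_nat (CARD('a)) ^ (n - j))" by simp
    also have "(\<Sum>j\<in>{1..<n}. char_power_sum \<Lambda> j * of_nat (CARD('a)) ^ (n - j)) = (\<Sum>j\<in>{1..<n}. of_nat (CARD('a)) ^ n)"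
      using less.IH by (intro sum.cong refl) (auto simp flip: power_add)
    also have "\<dots> = (of_nat n - 1) * of_nat (CARD('a)) ^ n" using less.prems by (simp add: of_nat_diff)
    finally show ?case by (simp add: algebra_simps)
  qed
  from this[OF assms] have "of_nat (\<Sum>P\<in>{P\<in>prime_polys n :: 'a mod_ring poly set. degree P dvd n}. degree P) = (of_nat (CARD('a) ^ n) :: complex)"
    by (simp add: char_power_sum_def \<Lambda>_def)
  then show ?thesis by (simp only: of_nat_eq_iff)
qed

text \<open>Since \<open>L(0) = 1\<close>, \<open>L\<close> is the product of
  \<open>1 - t / z\<close> over its zeros, and the linear coefficient is minus the sum of the
  inverse zeros.\<close>

lemma norm_coeff_1_le:
  fixes L :: "complex poly"
  assumes "poly L 0 = 1" "\<rho> > 0" "\<And>z. poly L z = 0 \<Longrightarrow> 1 / \<rho> \<le> norm z"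
  shows "norm (coeff L 1) \<le> real (degree L) * \<rho>"
  using assms(1,3)
proof (induction "degree L" arbitrary: L)
  case 0
  then show ?case by (simp add: coeff_eq_0)
next
  case (Suc n)
  then have "degree L > 0" by simp
  then obtain z where z: "poly L z = 0" using alg_closed_imp_poly_has_root[of L] by blast
  then have z0: "z \<noteq> 0" using Suc.prems by auto
  obtain H where H: "L = [:- z, 1:] * H" using z by (auto simp: poly_eq_0_iff_dvd)
  define H' where "H' = smult (- z) H"
  have L: "L = [:1, - 1 / z:] * H'" using z0 by (simp add: H H'_def algebra_simps)
  have "H' \<noteq> 0" using L \<open>degree L > 0\<close> by auto
  then have dH: "degree L = Suc (degree H')" unfolding L using z0 by (subst degree_mult_eq) auto
  have "norm (coeff H' 1) \<le> real (degree H') * \<rho>"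
  proof (rule Suc.hyps(1))
    show "n = degree H'" using dH Suc.hyps by simp
    show "poly H' 0 = 1" using Suc.prems(1) unfolding L by simp
    show "1 / \<rho> \<le> norm y" if "poly H' y = 0" for y using that Suc.prems(2)[of y] unfolding L by simp
  qed
  moreover have "coeff H' 0 = 1" using Suc.prems(1) unfolding L by (simp add: poly_0_coeff_0)
  then have "coeff L 1 = coeff H' 1 - 1 / z" unfolding L by (simp add: coeff_pCons)
  then have "norm (coeff L 1) \<le> norm (coeff H' 1) + norm (1 / z)" using norm_triangle_ineq4 by metis
  moreover have "norm (1 / z) \<le> \<rho>" using Suc.prems(2)[OF z] z0 \<open>\<rho> > 0\<close> by (simp add: norm_divide field_simps)
  ultimately show ?case using dH by (simp add: algebra_simps)
qed

text \<open>By \<open>newton\<close>, \<open>t * L'(t) = L(t) * B(t)\<close> with \<open>B\<close>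
  the generating series of the \<open>S n\<close>. By \<open>bound\<close> this series converges for
  \<open>norm t < 1 / \<rho>\<close>, while at a zero of \<open>L\<close> other than 0 the quotient
  \<open>t * L'(t) / L(t)\<close> has a pole. The constant \<open>C\<close> does not affect the
  radius of convergence, so it does not reach the conclusion.\<close>

lemma roots_bound_of_power_sums:
  fixes A S :: "nat \<Rightarrow> complex"
  assumes L: "A 0 = 1" "\<And>n. n \<ge> s \<Longrightarrow> A n = 0"
    and newton: "\<And>n. of_nat n * A n = (\<Sum>j\<in>{1..n}. S j * A (n - j))"
    and bound: "\<And>n. n \<ge> n0 \<Longrightarrow> norm (S n) \<le> C * \<rho> ^ n" and "\<rho> > 0"
    and root: "(\<Sum>n<s. A n * z ^ n) = 0"
  shows "1 / \<rho> \<le> norm z"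
proof (rule ccontr)
  assume "\<not> 1 / \<rho> \<le> norm z"
  then have zlt: "norm z < 1 / \<rho>" by simp
  define r where "r = (norm z + 1 / \<rho>) / 2"
  have r: "norm z < r" "r < 1 / \<rho>" "r > 0" using zlt \<open>\<rho> > 0\<close> by (auto simp: r_def intro!: add_nonneg_pos)
  have r\<rho>: "0 < \<rho> * r" "\<rho> * r < 1" using r \<open>\<rho> > 0\<close> by (auto simp: field_simps)
  define b where "b n = (if n = 0 then 0 else S n)" for n
  define Lp where "Lp = (\<Sum>n<s. monom (A n) n)"
  have polyL: "poly Lp t = (\<Sum>n<s. A n * t ^ n)" for t by (simp add: Lp_def poly_sum poly_monom)
  have "s > 0" using L by (cases s) auto
  then have L0: "poly Lp 0 = 1" unfolding polyL using L by (cases s) (auto simp: sum.lessThan_Suc_shift)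
  have z0: "z \<noteq> 0" using root L0 by (auto simp: polyL)
  have sumb: "summable (\<lambda>n. norm (b n * t ^ n))" if "norm t \<le> r" for t
  proof (rule summable_comparison_test_ev)
    show "summable (\<lambda>n. \<bar>C\<bar> * (\<rho> * r) ^ n)" using r\<rho> by (intro summable_mult summable_geometric) auto
    show "\<forall>\<^sub>F n in sequentially. norm (norm (b n * t ^ n)) \<le> \<bar>C\<bar> * (\<rho> * r) ^ n"
    proof (rule eventually_sequentiallyI[of "Suc n0"])
      fix n assume n: "Suc n0 \<le> n"
      have "norm (b n) \<le> C * \<rho> ^ n" using n bound[of n] by (simp add: b_def)
      also have "\<dots> \<le> \<bar>C\<bar> * \<rho> ^ n" using \<open>\<rho> > 0\<close> by (intro mult_right_mono) auto
      finally have "norm (b n) * norm t ^ n \<le> (\<bar>C\<bar> * \<rho> ^ n) * r ^ n"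
        using that \<open>\<rho> > 0\<close> by (intro mult_mono power_mono) auto
      then show "norm (norm (b n * t ^ n)) \<le> \<bar>C\<bar> * (\<rho> * r) ^ n"
        by (simp add: norm_mult norm_power power_mult_distrib mult.assoc)
    qed
  qed
  define B where "B t = (\<Sum>n. b n * t ^ n)" for t
  have main: "t * poly (pderiv Lp) t = poly Lp t * B t" if t: "norm t \<le> r" for t
  proof -
    have "summable (\<lambda>n. norm (A n * t ^ n))"
      by (rule summable_finite[of "{..<s}"]) (use L(2) in auto)
    then have "(\<lambda>n. \<Sum>i\<le>n. (A i * t ^ i) * (b (n - i) * t ^ (n - i))) sums ((\<Sum>n. A n * t ^ n) * B t)"
      unfolding B_def by (rule Cauchy_product_sums) (rule sumb[OF t])
    moreover have "(\<Sum>n. A n * t ^ n) = poly Lp t"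
      unfolding polyL by (rule suminf_finite) (use L(2) in auto)
    moreover have "(\<Sum>i\<le>n. (A i * t ^ i) * (b (n - i) * t ^ (n - i))) = of_nat n * A n * t ^ n" for n
    proof -
      have "(\<Sum>i\<le>n. (A i * t ^ i) * (b (n - i) * t ^ (n - i))) = (\<Sum>i\<le>n. A i * b (n - i) * t ^ n)"
        by (intro sum.cong refl) (auto simp flip: power_add)
      also have "\<dots> = (\<Sum>j\<le>n. A (n - j) * b j * t ^ n)"
        by (rule sum.reindex_bij_witness[where i = "\<lambda>j. n - j" and j = "\<lambda>j. n - j"]) auto
      also have "\<dots> = (\<Sum>j\<in>{1..n}. A (n - j) * b j * t ^ n)"
        by (rule sum.mono_neutral_right) (auto simp: b_def)
      also have "\<dots> = (\<Sum>j\<in>{1..n}. S j * A (n - j)) * t ^ n"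
        unfolding sum_distrib_right by (intro sum.cong refl) (auto simp: b_def)
      finally show ?thesis using newton[of n] by simp
    qed
    moreover have "(\<lambda>n. of_nat n * A n * t ^ n) sums (t * poly (pderiv Lp) t)"
    proof -
      have "(\<lambda>n. of_nat n * A n * t ^ n) sums (\<Sum>n<s. of_nat n * A n * t ^ n)"
        by (rule sums_finite) (use L(2) in auto)
      also have "(\<Sum>n<s. of_nat n * A n * t ^ n) = t * poly (pderiv Lp) t"
        unfolding Lp_def pderiv_sum poly_sum sum_distrib_left pderiv_monom poly_monom
        by (intro sum.cong refl) (auto simp: algebra_simps simp flip: power_Suc split: nat_diff_split)
      finally show ?thesis .
    qed
    ultimately show ?thesis by (simp add: sums_unique2)
  qed
  have Lp0: "Lp \<noteq> 0" using L0 by auto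
  define k where "k = order z Lp"
  obtain H where H: "Lp = [:- z, 1:] ^ k * H" "\<not> [:- z, 1:] dvd H"
    using order_decomp[OF Lp0, of z] by (auto simp: k_def)
  have Hz: "poly H z \<noteq> 0" using H(2) by (simp add: poly_eq_0_iff_dvd)
  have k: "k > 0" using root Hz H(1) by (auto simp: polyL[symmetric] intro: gr0I)
  \<comment> \<open>This is \<open>t * L' - L * B\<close> divided by
    \<open>(t - z) ^ (k - 1)\<close>, where \<open>k\<close> is the order of the zero. It vanishes
    near \<open>z\<close> away from \<open>z\<close>, hence also at \<open>z\<close> by continuity;
    but there all that remains is \<open>z * of_nat k * poly H z\<close>, which is not 0.\<close>
  define \<phi> where "\<phi> t = t * of_nat k * poly H t + t * (t - z) * poly (pderiv H) t - (t - z) * poly H t * B t" for t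
  have "\<phi> t = 0" if t: "norm t \<le> r" "t \<noteq> z" for t
  proof -
    have k': "(t - z) ^ k = (t - z) ^ (k - 1) * (t - z)" using k by (cases k) auto
    have e1: "poly Lp t = (t - z) ^ k * poly H t" by (simp add: H(1) poly_power)
    have e2: "poly (pderiv Lp) t = of_nat k * (t - z) ^ (k - 1) * poly H t + (t - z) ^ k * poly (pderiv H) t"
      unfolding H(1) by (simp add: pderiv_mult pderiv_power pderiv_pCons poly_power algebra_simps)
    have "(t - z) ^ (k - 1) * \<phi> t = 0"
      using main[OF t(1)] unfolding \<phi>_def e1 e2 k' by (simp add: algebra_simps)
    then show ?thesis using t(2) by simp
  qed
  moreover have "\<forall>\<^sub>F t in at z. norm t \<le> r \<and> t \<noteq> z"
  proof -
    have "\<forall>\<^sub>F t in nhds z. norm t < r"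
      using r(1) by (intro order_tendstoD(2)[OF tendsto_norm[OF filterlim_ident]]) auto
    then have "\<forall>\<^sub>F t in at z. norm t < r" by (simp add: eventually_at_filter eventually_mono)
    then show ?thesis by (auto simp: eventually_at_filter elim: eventually_mono)
  qed
  ultimately have "\<forall>\<^sub>F t in at z. \<phi> t = 0" by (auto elim: eventually_mono)
  then have "(\<phi> \<longlongrightarrow> 0) (at z)" by (rule tendsto_eventually)
  moreover have "isCont B z" unfolding B_def
    by (rule isCont_powser[where K = "of_real r"]) (use sumb[of "of_real r"] r in \<open>auto intro: summable_norm_cancel\<close>)
  then have "isCont \<phi> z" unfolding \<phi>_def by (intro continuous_intros) auto
  then have "(\<phi> \<longlongrightarrow> \<phi> z) (at z)" by (simp add: isCont_def)
  ultimately have "\<phi> z = 0" using tendsto_unique[OF at_neq_bot] by blast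
  then show False using z0 k Hz by (simp add: \<phi>_def)
qed

section \<open>Multiplicative characters of the prime field and the Weil bound for degree prime to
  \<open>p - 1\<close>\<close>

definition mult_char :: "('a::prime_card mod_ring \<Rightarrow> complex) \<Rightarrow> bool" where
  "mult_char \<chi> \<longleftrightarrow> \<chi> 0 = 0 \<and> \<chi> 1 = 1 \<and> (\<forall>x y. \<chi> (x * y) = \<chi> x * \<chi> y)"

lemma mult_char_power: "mult_char \<chi> \<Longrightarrow> \<chi> (x ^ n) = \<chi> x ^ n"
  by (induction n) (auto simp: mult_char_def)

lemma mod_ring_power_card_minus_1:
  assumes "(x :: 'a::prime_card mod_ring) \<noteq> 0"
  shows "x ^ (CARD('a) - 1) = 1"
proof -
  have "x ^ (CARD('a) - 1) * x = x ^ CARD('a)"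
    using card_mod_ring_ge_2[where ?'a='a] by (simp flip: power_Suc2)
  then have "x ^ (CARD('a) - 1) * x = 1 * x" by (simp add: mod_ring_power_card)
  then show ?thesis using assms mult_right_cancel by blast
qed

lemma mult_char_power_card:
  assumes "mult_char \<chi>" "(x :: 'a::prime_card mod_ring) \<noteq> 0"
  shows "\<chi> x ^ (CARD('a) - 1) = 1"
  using assms mod_ring_power_card_minus_1[OF assms(2)]
  by (metis mult_char_def mult_char_power)

lemma norm_mult_char:
  assumes "mult_char \<chi>" "(x :: 'a::prime_card mod_ring) \<noteq> 0"
  shows "norm (\<chi> x) = 1"
proof -
  have "norm (\<chi> x) ^ (CARD('a) - 1) = 1"
    using mult_char_power_card[OF assms] by (metis norm_one norm_power)
  then show ?thesis using card_mod_ring_ge_2[where ?'a='a]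
    by (metis norm_ge_zero power_eq_1_iff real_norm_def abs_of_nonneg diff_is_0_eq not_less_eq_eq numeral_2_eq_2 One_nat_def)
qed

lemma sum_mult_char:
  assumes "mult_char \<chi>" "u \<noteq> 0" "\<chi> u \<noteq> 1"
  shows "(\<Sum>x\<in>UNIV - {0}. \<chi> (x :: 'a::prime_card mod_ring)) = 0"
proof -
  have "(\<Sum>x\<in>UNIV - {0}. \<chi> (u * x)) = (\<Sum>x\<in>UNIV - {0}. \<chi> x)"
    by (rule sum.reindex_bij_witness[where i = "\<lambda>x. x / u" and j = "\<lambda>x. u * x"])
      (use assms(2) in auto)
  moreover have "(\<Sum>x\<in>UNIV - {0}. \<chi> (u * x)) = \<chi> u * (\<Sum>x\<in>UNIV - {0}. \<chi> x)"
    using assms(1) by (simp add: mult_char_def sum_distrib_left)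
  ultimately have "(\<chi> u - 1) * (\<Sum>x\<in>UNIV - {0}. \<chi> x) = 0" by (simp add: algebra_simps)
  then show ?thesis using assms(3) by simp
qed

text \<open>With \<open>J\<close> slightly above \<open>M / d\<close> the main terms
  \<open>M * E\<close> and \<open>d * J * E\<close> almost cancel. The surplus, at least
  \<open>(c0 - 1) * d * E\<close> with \<open>d * E\<close> about \<open>M * M\<close>, has to cover
  \<open>m * M * M\<close> and \<open>d * J * J \<le> 4 * d * M * M\<close>; this dictates
  \<open>c0 = 4 * d + m + 2\<close>.\<close>

lemma stepanov_count:
  fixes d m c0 M E q :: nat
  assumes d: "d \<ge> 1" and q: "q = d * E + 1" and M: "M * M \<le> q" "M \<ge> c0" and c0: "c0 = 4 * d + m + 2"
  defines "J \<equiv> M div d + c0"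
  shows "M * (E + M * m) < d * J * (E - J)"
proof -
  have Mlt: "M + d * (c0 - 1) + 1 \<le> d * J"
  proof -
    have "M < d * (M div d) + d" using d by (metis add.commute mod_less_divisor mult_div_mod_eq nat_add_left_cancel_less zero_less_one order_less_le_trans)
    moreover have "d * (c0 - 1) + d = d * c0" using c0 by (simp add: algebra_simps)
    ultimately show ?thesis unfolding J_def by (simp add: algebra_simps)
  qed
  have J2: "J \<le> 2 * M" using M(2) unfolding J_def by (simp add: add_mono mult_2)
  have "M \<ge> 1" using M(2) c0 by simp
  have "int M * (int E + int M * int m) < int d * int J * (int E - int J)"
  proof -
    have "int d * int J * int J \<le> int d * (2 * int M) * (2 * int M)"
      using J2 by (intro mult_mono) auto
    then have a: "int d * int J * int J \<le> 4 * int d * (int M * int M)" by (simp add: algebra_simps)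
    have "int M + int d * int (c0 - 1) + 1 \<le> int d * int J"
      using Mlt by (metis of_nat_mono of_nat_add of_nat_mult of_nat_1)
    moreover have "int (c0 - 1) = 4 * int d + int m + 1" using c0 by simp
    ultimately have "int M + int d * (4 * int d + int m + 1) + 1 \<le> int d * int J" by (simp only:)
    then have "(int M + int d * (4 * int d + int m + 1) + 1) * int E \<le> int d * int J * int E"
      by (intro mult_right_mono) auto
    moreover have "(int M + int d * (4 * int d + int m + 1) + 1) * int E
       = int M * int E + (4 * int d + int m + 1) * (int d * int E) + int E"
      by (simp add: algebra_simps)
    ultimately have b: "int M * int E + (4 * int d + int m + 1) * (int d * int E) + int E \<le> int d * int J * int E"
      by simp
    have c: "int d * int E \<ge> int M * int M - 1" using M(1) q by (metis add_diff_cancel_right' diff_right_mono of_nat_1 of_nat_add of_nat_le_iff of_nat_mult)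
    have "(4 * int d + int m + 1) * (int M * int M - 1) \<le> (4 * int d + int m + 1) * (int d * int E)"
      using c by (intro mult_left_mono) auto
    moreover have "int M * int M \<ge> int c0 * 1" using M(2) \<open>M \<ge> 1\<close> by (intro mult_mono) auto
    moreover have "(4 * int d + int m + 1) * (int M * int M - 1) = 4 * int d * (int M * int M) + int m * (int M * int M) + int M * int M - (4 * int d + int m + 1)"
      by (simp add: algebra_simps)
    ultimately have "4 * int d * (int M * int M) + int m * (int M * int M) < (4 * int d + int m + 1) * (int d * int E) + int E"
      using c0 by simp
    then have "int M * int E + int m * (int M * int M) + 4 * int d * (int M * int M) < int d * int J * int E"
      using b by linarith
    then show ?thesis using a by (simp add: algebra_simps)
  qed
  note main = this
  have "int E > int J"
  proof (rule ccontr)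
    assume "\<not> int J < int E"
    then have "int d * int J * (int E - int J) \<le> 0" by (intro mult_nonneg_nonpos) auto
    moreover have "0 \<le> int M * (int E + int M * int m)" by simp
    ultimately show False using main by linarith
  qed
  then have "int (M * (E + M * m)) < int (d * J * (E - J))" using main by (simp add: of_nat_diff)
  then show ?thesis by (simp only: of_nat_less_iff)
qed

text \<open>Upper bounds for the single terms also control their absolute values once the total is
  bounded below, since \<open>\<bar>x\<bar> \<le> 2 * B - x\<close> whenever
  \<open>x \<le> B\<close> and \<open>B \<ge> 0\<close>. This turns the one-sided result of
  Stepanov's method into equidistribution.\<close>

lemma sum_deviation_le:
  fixes x :: "'b \<Rightarrow> real"
  assumes "finite W" "\<And>w. w \<in> W \<Longrightarrow> x w \<le> B" "B \<ge> 0" "(\<Sum>w\<in>W. x w) \<ge> - s"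
  shows "(\<Sum>w\<in>W. \<bar>x w\<bar>) \<le> 2 * real (card W) * B + s"
proof -
  have "(\<Sum>w\<in>W. \<bar>x w\<bar>) \<le> (\<Sum>w\<in>W. 2 * B - x w)"
    using assms(2,3) by (intro sum_mono abs_leI) fastforce+
  also have "\<dots> = 2 * real (card W) * B - (\<Sum>w\<in>W. x w)" by (simp add: sum_subtractf)
  finally show ?thesis using assms(4) by linarith
qed

text \<open>The symbol \<open>\<Lambda>(g) = \<chi>(Res(g, f))\<close> for \<open>f = \<Prod>(X - c) ^ e c\<close>.\<close>

definition res_value :: "'a::prime_card mod_ring set \<Rightarrow> ('a mod_ring \<Rightarrow> nat) \<Rightarrow> 'a mod_ring poly \<Rightarrow> 'a mod_ring" where
  "res_value C e g = (\<Prod>c\<in>C. ((- 1) ^ degree g * poly g c) ^ e c)"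

lemma char_on_monic_res_value:
  assumes "mult_char \<chi>"
  shows "char_on_monic (\<lambda>g. \<chi> (res_value C e g))"
  unfolding char_on_monic_def
proof (intro conjI allI impI)
  show "\<chi> (res_value C e 1) = 1" using assms by (simp add: res_value_def mult_char_def)
  fix g h :: "'a mod_ring poly" assume "monic g" "monic h"
  then have "g \<noteq> 0" "h \<noteq> 0" by auto
  then have "res_value C e (g * h) = res_value C e g * res_value C e h"
    unfolding res_value_def prod.distrib[symmetric] power_mult_distrib[symmetric]
    by (intro prod.cong refl) (auto simp: degree_mult_eq power_add algebra_simps)
  then show "\<chi> (res_value C e (g * h)) = \<chi> (res_value C e g) * \<chi> (res_value C e h)"
    using assms by (simp add: mult_char_def)
qed

context
  fixes \<chi> :: "'a::prime_card mod_ring \<Rightarrow> complex" and C :: "'a mod_ring set" and e :: "'a mod_ring \<Rightarrow> nat"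
  assumes \<chi>: "mult_char \<chi>" and nontriv: "\<exists>u. u \<noteq> 0 \<and> \<chi> u \<noteq> 1"
    and e_pos: "\<And>c. c \<in> C \<Longrightarrow> e c \<ge> 1"
    and e_coprime: "coprime (\<Sum>c\<in>C. e c) (CARD('a) - 1)"
begin

text \<open>Otherwise the order of \<open>\<chi> u\<close> would divide the sum of all exponents as
  well as \<open>CARD('a) - 1\<close>; these are coprime, so \<open>\<chi> u\<close> would be
  1.\<close>

lemma exists_nontrivial_exponent: "\<exists>c\<in>C. \<exists>u. u \<noteq> 0 \<and> \<chi> u ^ e c \<noteq> 1"
proof (rule ccontr)
  assume neg: "\<not> ?thesis"
  obtain u where u: "u \<noteq> 0" "\<chi> u \<noteq> 1" using nontriv by blast
  have "\<chi> u ^ (\<Sum>c\<in>C. e c) = (\<Prod>c\<in>C. \<chi> u ^ e c)" by (simp add: power_sum)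
  also have "\<dots> = 1" using neg u by (intro prod.neutral) blast
  finally have 1: "\<chi> u ^ (\<Sum>c\<in>C. e c) = 1" .
  have 2: "\<chi> u ^ (CARD('a) - 1) = 1" by (rule mult_char_power_card[OF \<chi> u(1)])
  have mod: "z ^ k = z ^ (k mod n)" if "z ^ n = 1" for z :: complex and k n :: nat
  proof -
    have "z ^ k = z ^ (n * (k div n) + k mod n)" by simp
    also have "\<dots> = z ^ (k mod n)" using that by (simp only: power_add power_mult power_one mult_1)
    finally show ?thesis .
  qed
  obtain x where x: "[(\<Sum>c\<in>C. e c) * x = Suc 0] (mod (CARD('a) - 1))"
    using cong_solve_coprime_nat[OF e_coprime] by blast
  have "\<chi> u ^ ((\<Sum>c\<in>C. e c) * x) = \<chi> u ^ Suc 0"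
    using mod[OF 2, of "(\<Sum>c\<in>C. e c) * x"] mod[OF 2, of "Suc 0"] x unfolding Cong.cong_def by simp
  then show False using 1 u by (simp add: power_mult)
qed

text \<open>For \<open>n \<ge> card C\<close>, adding a multiple of the Lagrange polynomial
  \<open>L\<close> of degree below \<open>n\<close> multiplies the value of \<open>g\<close> at
  \<open>c1\<close> by \<open>u\<close>, keeps its values at the other points of \<open>C\<close>,
  and keeps \<open>g\<close> monic. This permutes the monic polynomials and multiplies every term by
  \<open>\<chi> u ^ e c1\<close>, which is not 1.\<close>

lemma char_coeff_eq_0:
  assumes "n \<ge> card C"
  shows "char_coeff (\<lambda>g. \<chi> (res_value C e g)) n = 0"
proof -
  obtain c1 u where c1: "c1 \<in> C" "u \<noteq> 0" "\<chi> u ^ e c1 \<noteq> 1" using exists_nontrivial_exponent by blast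
  have finC: "finite C" by simp
  define L0 where "L0 = (\<Prod>c\<in>C - {c1}. [:- c, 1:])"
  define L where "L = smult (inverse (poly L0 c1)) L0"
  have L0c1: "poly L0 c1 \<noteq> 0" unfolding L0_def poly_prod by simp
  have L1: "poly L c1 = 1" using L0c1 by (simp add: L_def)
  have L2: "poly L c = 0" if "c \<in> C" "c \<noteq> c1" for c
    using that unfolding L_def L0_def poly_smult poly_prod by (auto intro!: bexI[of _ c])
  have "degree L \<le> degree L0" by (simp add: L_def)
  also have "degree L0 \<le> (\<Sum>c\<in>C - {c1}. degree [:- c, 1:])"
    unfolding L0_def using degree_prod_sum_le[of "C - {c1}" "\<lambda>c. [:- c, 1:]"] by (simp add: comp_def)
  also have "\<dots> = card C - 1" using c1(1) by simp
  finally have degL: "degree L < n" using assms c1(1) finC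
    by (metis One_nat_def card_gt_0_iff diff_Suc_less empty_iff le_less_trans order_less_le_trans)
  define T where "T v g = g + smult ((v - 1) * poly g c1) L" for v g
  have Tmon: "T v g \<in> monic_polys n" if "g \<in> monic_polys n" for v g
  proof -
    have g: "degree g = n" "coeff g n = 1" using that by (auto simp: monic_polys_def)
    have "degree (smult ((v - 1) * poly g c1) L) < n" using degL by (meson degree_smult_le le_less_trans)
    then have "degree (T v g) = n" unfolding T_def using g by (simp add: degree_add_eq_left)
    moreover have "coeff (T v g) n = 1" unfolding T_def using g degL by (simp add: coeff_eq_0)
    ultimately show ?thesis by (simp add: monic_polys_def)
  qed
  have Tc1: "poly (T v g) c1 = v * poly g c1" for v g by (simp add: T_def L1 algebra_simps)
  have Tc: "poly (T v g) c = poly g c" if "c \<in> C" "c \<noteq> c1" for v g c by (simp add: T_def L2 that)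
  have Tinv: "T w (T v g) = g" if "w * v = 1" for w v g
  proof -
    have "T w (T v g) = g + smult ((v - 1) * poly g c1 + (w - 1) * (v * poly g c1)) L"
      by (subst T_def, subst Tc1, subst T_def) (simp add: smult_add_left)
    also have "(v - 1) * poly g c1 + (w - 1) * (v * poly g c1) = (w * v - 1) * poly g c1" by (simp add: algebra_simps)
    finally show ?thesis using that by simp
  qed
  have "res_value C e (T u g) = u ^ e c1 * res_value C e g" if g: "g \<in> monic_polys n" for g
  proof -
    have deg: "degree (T u g) = n" "degree g = n" using g Tmon[OF g] by (auto simp: monic_polys_def)
    have "res_value C e (T u g) = ((- 1) ^ n * poly (T u g) c1) ^ e c1 * (\<Prod>c\<in>C - {c1}. ((- 1) ^ n * poly (T u g) c) ^ e c)"
      unfolding res_value_def deg by (rule prod.remove[OF finC c1(1)])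
    also have "\<dots> = u ^ e c1 * (((- 1) ^ n * poly g c1) ^ e c1 * (\<Prod>c\<in>C - {c1}. ((- 1) ^ n * poly g c) ^ e c))"
    proof -
      have "(\<Prod>c\<in>C - {c1}. ((- 1) ^ n * poly (T u g) c) ^ e c) = (\<Prod>c\<in>C - {c1}. ((- 1) ^ n * poly g c) ^ e c)"
        by (intro prod.cong refl) (simp add: Tc)
      then show ?thesis unfolding Tc1 by (simp add: power_mult_distrib ac_simps)
    qed
    also have "((- 1) ^ n * poly g c1) ^ e c1 * (\<Prod>c\<in>C - {c1}. ((- 1) ^ n * poly g c) ^ e c) = res_value C e g"
      unfolding res_value_def deg by (rule prod.remove[OF finC c1(1), symmetric])
    finally show ?thesis .
  qed
  then have "(\<Sum>g\<in>monic_polys n. \<chi> (res_value C e (T u g))) = \<chi> u ^ e c1 * (\<Sum>g\<in>monic_polys n. \<chi> (res_value C e g))"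
    using \<chi> unfolding sum_distrib_left by (intro sum.cong refl) (simp add: mult_char_def mult_char_power[OF \<chi>, symmetric])
  moreover have "(\<Sum>g\<in>monic_polys n. \<chi> (res_value C e (T u g))) = (\<Sum>g\<in>monic_polys n. \<chi> (res_value C e g))"
    by (rule sum.reindex_bij_witness[where i = "T (inverse u)" and j = "T u"]) (use c1(2) Tmon Tinv in auto)
  ultimately have "(\<chi> u ^ e c1 - 1) * (\<Sum>g\<in>monic_polys n. \<chi> (res_value C e g)) = 0" by (simp add: algebra_simps)
  then show ?thesis using c1(3) by (simp add: char_coeff_def)
qed

text \<open>Grouping by the value \<open>w\<close> of the norm gives the sum of
  \<open>\<chi> w * D w\<close>. Stepanov's method bounds \<open>D w\<close> above by
  \<open>q / d\<close> plus a multiple of \<open>M\<close>, which is at most \<open>sqrt q\<close>;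
  the total is \<open>q\<close> and \<open>D 0\<close> is bounded. So the \<open>D w\<close> with
  \<open>w \<noteq> 0\<close> are nearly equal, and the common part \<open>q / d\<close> cancels in
  the sum over the character.\<close>

lemma char_power_sum_bound:
  "\<exists>B n0. \<forall>n\<ge>n0. norm (char_power_sum (\<lambda>g. \<chi> (res_value C e g)) n) \<le> B * sqrt (real CARD('a)) ^ n"
proof -
  define q0 where "q0 = CARD('a)"
  define f where "f = (\<Prod>c\<in>C. [:- c, 1:] ^ e c)"
  define m where "m = (\<Sum>c\<in>C. e c)"
  define d where "d = q0 - 1"
  define c0 where "c0 = 4 * d + m + 2"
  \<comment> \<open>The factor \<open>q0\<close> pays for \<open>q \<le> q0 * (M * M)\<close>: for
    odd \<open>n\<close> the power \<open>M = q0 ^ (n div 2)\<close> falls short of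
    \<open>sqrt q\<close>. This is a loss that does not depend on \<open>n\<close>.\<close>
  define B where "B = real (c0 + 1 + m) * real q0"
  have q0: "q0 \<ge> 2" using card_mod_ring_ge_2[where ?'a='a] by (simp add: q0_def)
  have d: "d \<ge> 1" using q0 by (simp add: d_def)
  have f0: "f \<noteq> 0" unfolding f_def by simp
  have degf: "degree f = m" unfolding f_def m_def
    by (subst degree_prod_eq_sum_degree) (auto simp: degree_power_eq)
  have "norm (char_power_sum (\<lambda>g. \<chi> (res_value C e g)) n) \<le> (2 * real d * B + real (card C)) * sqrt (real q0) ^ n"
    if n: "n \<ge> 2 * c0 + 2" for n
  proof -
    define h where "h = n div 2"
    define M where "M = q0 ^ h"
    define q where "q = q0 ^ n"
    define E where "E = rep_unit q0 n"
    define J where "J = M div d + c0"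
    define Pr :: "'a mod_ring poly set" where "Pr = {P\<in>prime_polys n. degree P dvd n}"
    define N where "N P = res_value C e P ^ (n div degree P)" for P
    \<comment> \<open>Counted through conjugate roots, \<open>D w\<close> is the number of elements
      of the extension of degree \<open>n\<close> at which the norm of \<open>f\<close> is
      \<open>w\<close>.\<close>
    define D where "D w = (\<Sum>P\<in>{P\<in>Pr. N P = w}. degree P)" for w
    have finPr: "finite Pr" by (simp add: Pr_def)
    have qE: "q = d * E + 1" using rep_unit_mult[of q0 n] q0 by (simp add: q_def d_def E_def)
    have MM: "M * M \<le> q" unfolding M_def q_def h_def power_add[symmetric] using q0 by (intro power_increasing) auto
    have qM: "q \<le> q0 * (M * M)" 
    proof -
      have "q \<le> q0 ^ Suc (h + h)" unfolding q_def h_def using q0 by (intro power_increasing) auto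
      then show ?thesis by (simp add: M_def power_add)
    qed
    have "c0 \<le> h" using n by (simp add: h_def)
    also have "h < 2 ^ h" by (rule less_exp)
    also have "(2::nat) ^ h \<le> M" unfolding M_def using q0 by (intro power_mono) auto
    finally have Mc0: "M \<ge> c0" by simp
    have n1: "n \<ge> 1" using n by simp
    have M1: "M \<ge> 1" using q0 by (simp add: M_def)
    have Pdvd: "P dvd f ^ E - [:N P:]" if "P \<in> Pr" for P
    proof -
      have P: "irreducible P" "monic P" "degree P dvd n"
        using that by (auto simp: Pr_def prime_polys_def prime_poly_iff)
      then have "n = degree P * (n div degree P)" by simp
      then show ?thesis using dvd_power_rep_unit_diff[OF P(1,2), where C = C and e = e and j = "n div degree P"]
        unfolding f_def E_def q0_def N_def res_value_def by (simp only:)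
    qed
    have cnt: "M * (E + M * m) < d * J * (E - J)"
      using stepanov_count[OF d qE MM Mc0 c0_def] unfolding J_def .
    have E1: "E \<ge> 1" using qE q0 n1 by (cases "E = 0") (auto simp: q_def)
    have Dbound: "real (D w) \<le> real q / real d + B * real M" if w: "w \<noteq> 0" for w
    proof -
      have "M * (\<Sum>P\<in>{P\<in>Pr. N P = w}. degree P) \<le> E + d * m * E + J * q"
        unfolding M_def E_def q_def d_def q0_def degf[symmetric]
      proof (rule stepanov[where c = w])
        show "f \<noteq> 0" by (rule f0)
        show "coprime (degree f) (CARD('a) - 1)" using e_coprime unfolding degf m_def .
        show "h \<le> n" "1 \<le> n" using n1 by (auto simp: h_def)
        show "CARD('a) ^ h * (rep_unit CARD('a) n + CARD('a) ^ h * degree f) < (CARD('a) - 1) * J * (rep_unit CARD('a) n - J)"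
          using cnt unfolding M_def E_def d_def q0_def degf .
        show "finite {P\<in>Pr. N P = w}" using finPr by simp
        fix P assume P: "P \<in> {P\<in>Pr. N P = w}"
        then have P': "irreducible P" "monic P" "degree P dvd n"
          by (auto simp: Pr_def prime_polys_def prime_poly_iff)
        show "P dvd [:0, 1:] ^ CARD('a) ^ n - [:0, 1:]" by (rule dvd_frobenius_poly[OF P'])
        show *: "P dvd f ^ rep_unit CARD('a) n - [:w:]" using Pdvd[of P] P by (simp add: E_def q0_def)
        have "\<not> P dvd f"
        proof
          assume "P dvd f"
          then have "P dvd f ^ E" using E1 by (metis dvd_power dvd_trans less_le_trans zero_less_one)
          then have "P dvd [:w:]" using * by (metis E_def q0_def dvd_diff_right_iff dvd_diffD1)
          then show False using w P' by (metis irreducible_not_unit is_unit_const_poly_iff dvd_field_iff dvd_trans)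
        qed
        then show "irreducible P \<and> monic P \<and> \<not> P dvd f" using P' by simp
      qed
      moreover have "E \<le> q"
        using d qE mult_le_mono1[OF d, of E] by linarith
      then have Eq: "real E \<le> real q" by simp
      ultimately have "real M * real (D w) \<le> real E + real d * real m * real E + real J * real q"
        unfolding D_def by (metis (mono_tags, lifting) of_nat_add of_nat_le_iff of_nat_mult)
      also have "real E + real d * real m * real E + real J * real q \<le> real q + real m * real q + (real M / real d + real c0) * real q"
      proof (intro add_mono mult_right_mono)
        show "real E \<le> real q" by (rule Eq)
        have "real d * real E \<le> real q" using qE by simp
        then have "real m * (real d * real E) \<le> real m * real q" by (intro mult_left_mono) auto
        then show "real d * real m * real E \<le> real m * real q" by (simp only: ac_simps)
        show "real J \<le> real M / real d + real c0" 
        proof -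
          have "real (M div d) * real d \<le> real M"
            by (metis div_times_less_eq_dividend of_nat_le_iff of_nat_mult)
          then have "real (M div d) \<le> real M / real d" using d by (simp add: pos_le_divide_eq)
          then show ?thesis by (simp add: J_def)
        qed
      qed simp
      also have "\<dots> = real M * (real q / real d) + real (c0 + 1 + m) * real q" by (simp add: algebra_simps)
      also have "\<dots> \<le> real M * (real q / real d) + real (c0 + 1 + m) * (real q0 * (real M * real M))"
        using qM by (intro add_left_mono mult_left_mono) (auto simp flip: of_nat_mult)
      also have "\<dots> = real M * (real q / real d + B * real M)" by (simp add: B_def algebra_simps)
      finally show ?thesis using M1 by simp
    qed
    have D0: "D 0 \<le> card C"
    proof -
      have "{P\<in>Pr. N P = 0} \<subseteq> (\<lambda>c. [:- c, 1:]) ` C"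
      proof
        fix P assume P: "P \<in> {P\<in>Pr. N P = 0}"
        then have "prime P" "irreducible P" "monic P" by (auto simp: Pr_def prime_polys_def prime_poly_iff)
        have "P dvd f ^ E" using Pdvd[of P] P by simp
        then have "P dvd f" using \<open>prime P\<close> by (metis prime_dvd_power)
        then obtain c where c: "c \<in> C" "P dvd [:- c, 1:] ^ e c"
          using \<open>prime P\<close> unfolding f_def by (auto simp: prime_dvd_prod_iff)
        then have Pc: "P dvd [:- c, 1:]" using \<open>prime P\<close> by (metis prime_dvd_power)
        moreover have "degree P > 0" by (rule prime_poly_degree_pos[OF \<open>prime P\<close>])
        moreover have "degree P \<le> 1" using dvd_imp_degree_le[OF Pc] by simp
        ultimately have "degree P = 1" by simp
        then have "P \<in> monic_polys 1" using \<open>monic P\<close> by (simp add: monic_polys_def)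
        then obtain a where a: "P = [:- a, 1:]" unfolding monic_polys_1 by blast
        have "poly [:- c, 1:] a = 0" using Pc by (simp only: poly_eq_0_iff_dvd a)
        then have "a = c" by simp
        then show "P \<in> (\<lambda>c. [:- c, 1:]) ` C" using a c by blast
      qed
      then have "D 0 \<le> (\<Sum>P\<in>(\<lambda>c. [:- c, 1:]) ` C. degree P)" unfolding D_def by (intro sum_mono2) auto
      also have "\<dots> \<le> (\<Sum>P\<in>(\<lambda>c. [:- c, 1:]) ` C. 1)" by (intro sum_mono) auto
      also have "\<dots> \<le> card C" by (simp add: card_image_le)
      finally show ?thesis .
    qed
    have Dsum: "(\<Sum>w\<in>UNIV. D w) = q"
    proof -
      have "(\<Sum>w\<in>UNIV. D w) = (\<Sum>P\<in>Pr. degree P)"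
        unfolding D_def using sum.group[OF finPr, of UNIV N degree] by simp
      then show ?thesis using sum_degree_prime_polys[OF n1, where ?'a='a] by (simp add: Pr_def q_def q0_def)
    qed
    have S: "char_power_sum (\<lambda>g. \<chi> (res_value C e g)) n = (\<Sum>w\<in>UNIV. \<chi> w * of_nat (D w))"
    proof -
      have "char_power_sum (\<lambda>g. \<chi> (res_value C e g)) n = (\<Sum>P\<in>Pr. \<chi> (N P) * of_nat (degree P))"
        unfolding char_power_sum_def Pr_def N_def mult_char_power[OF \<chi>] by (simp add: mult.commute)
      also have "\<dots> = (\<Sum>w\<in>UNIV. \<Sum>P\<in>{P\<in>Pr. N P = w}. \<chi> (N P) * of_nat (degree P))"
        using sum.group[OF finPr, of UNIV N "\<lambda>P. \<chi> (N P) * of_nat (degree P)"] by simp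
      also have "\<dots> = (\<Sum>w\<in>UNIV. \<chi> w * of_nat (D w))"
        unfolding D_def of_nat_sum sum_distrib_left by (intro sum.cong refl) auto
      finally show ?thesis .
    qed
    define W where "W = UNIV - {0 :: 'a mod_ring}"
    have cardW: "card W = d" unfolding W_def d_def q0_def by simp
    define x where "x w = real (D w) - real q / real d" for w
    have "(\<Sum>w\<in>UNIV. \<chi> w * of_nat (D w)) = (\<Sum>w\<in>W. \<chi> w * of_nat (D w))"
      unfolding W_def using \<chi> by (intro sum.mono_neutral_right) (auto simp: mult_char_def)
    also have "\<dots> = (\<Sum>w\<in>W. \<chi> w * of_real (x w)) + of_real (real q / real d) * (\<Sum>w\<in>W. \<chi> w)"
      unfolding sum_distrib_left sum.distrib[symmetric] by (intro sum.cong refl) (simp add: x_def algebra_simps)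
    also have "(\<Sum>w\<in>W. \<chi> w) = 0" unfolding W_def using sum_mult_char[OF \<chi>] nontriv by blast
    finally have S': "char_power_sum (\<lambda>g. \<chi> (res_value C e g)) n = (\<Sum>w\<in>W. \<chi> w * of_real (x w))" using S by simp
    have "norm (\<Sum>w\<in>W. \<chi> w * of_real (x w)) \<le> (\<Sum>w\<in>W. \<bar>x w\<bar>)"
      using norm_mult_char[OF \<chi>] by (intro sum_norm_le) (auto simp: norm_mult W_def)
    also have "\<dots> \<le> 2 * real (card W) * (B * real M) + real (card C)"
    proof (rule sum_deviation_le)
      show "finite W" by simp
      show "x w \<le> B * real M" if "w \<in> W" for w using Dbound[of w] that by (simp add: W_def x_def)
      show "B * real M \<ge> 0" by (simp add: B_def)
      have "(\<Sum>w\<in>W. D w) + D 0 = q" using Dsum sum.remove[of UNIV 0 D] by (simp add: W_def)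
      then have "(\<Sum>w\<in>W. real (D w)) = real q - real (D 0)" by (metis add_diff_cancel_right' of_nat_add of_nat_sum)
      moreover have "(\<Sum>w\<in>W. x w) = (\<Sum>w\<in>W. real (D w)) - real q"
        unfolding x_def sum_subtractf using cardW d by simp
      ultimately show "(\<Sum>w\<in>W. x w) \<ge> - real (card C)" using D0 by simp
    qed
    also have "\<dots> = 2 * real d * B * real M + real (card C)" by (simp add: cardW)
    also have "\<dots> \<le> 2 * real d * B * sqrt (real q0) ^ n + real (card C) * sqrt (real q0) ^ n"
    proof (intro add_mono mult_left_mono)
      have s1: "1 \<le> sqrt (real q0)" using q0 by simp
      have "real M = sqrt (real q0) ^ (2 * h)" by (simp add: M_def power_mult)
      also have "\<dots> \<le> sqrt (real q0) ^ n" by (rule power_increasing) (use s1 in \<open>auto simp: h_def\<close>)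
      finally show "real M \<le> sqrt (real q0) ^ n" .
      show "0 \<le> 2 * real d * B" by (simp add: B_def)
      have "real (card C) * 1 \<le> real (card C) * sqrt (real q0) ^ n" using s1 by (intro mult_left_mono) auto
      then show "real (card C) \<le> real (card C) * sqrt (real q0) ^ n" by simp
    qed
    finally show ?thesis unfolding S' by (simp add: algebra_simps)
  qed
  then show ?thesis unfolding q0_def by blast
qed

text \<open>The monic polynomials of degree 1 are the \<open>X - x\<close>, so the linear
  coefficient of the L-function is the character sum itself. It is bounded by the number of zeros,
  at most \<open>card C - 1\<close>, times the largest possible inverse zero.\<close>

theorem weil_bound_coprime_degree:
  "norm (\<Sum>x\<in>UNIV. \<chi> (\<Prod>c\<in>C. (x - c) ^ e c)) \<le> real (card C - 1) * sqrt (real CARD('a))"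
proof -
  define \<Lambda> where "\<Lambda> = (\<lambda>g. \<chi> (res_value C e g))"
  define A where "A n = char_coeff \<Lambda> n" for n
  define s where "s = card C"
  define L where "L = (\<Sum>n<s. monom (A n) n)"
  have \<Lambda>: "char_on_monic \<Lambda>" unfolding \<Lambda>_def by (rule char_on_monic_res_value[OF \<chi>])
  have "C \<noteq> {}" using exists_nontrivial_exponent by blast
  then have s: "s \<ge> 1" unfolding s_def by (simp add: Suc_leI card_gt_0_iff)
  have A0: "A 0 = 1" using \<Lambda> by (simp add: A_def char_coeff_def monic_polys_0 char_on_monic_def)
  have As: "A n = 0" if "n \<ge> s" for n
    using char_coeff_eq_0[of n] that by (simp add: A_def \<Lambda>_def s_def)
  have newton: "of_nat n * A n = (\<Sum>j\<in>{1..n}. char_power_sum \<Lambda> j * A (n - j))" for n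
    unfolding A_def by (rule newton_identity[OF \<Lambda>])
  obtain B n0 where B: "\<And>n. n \<ge> n0 \<Longrightarrow> norm (char_power_sum \<Lambda> n) \<le> B * sqrt (real CARD('a)) ^ n"
    using char_power_sum_bound unfolding \<Lambda>_def by blast
  have sq: "sqrt (real CARD('a)) > 0" using card_mod_ring_ge_2[where ?'a='a] by simp
  have polyL: "poly L t = (\<Sum>n<s. A n * t ^ n)" for t by (simp add: L_def poly_sum poly_monom)
  have coeffL: "coeff L n = A n" for n
    using As by (cases "n < s") (auto simp: L_def coeff_sum)
  have "norm (coeff L 1) \<le> real (degree L) * sqrt (real CARD('a))"
  proof (rule norm_coeff_1_le[OF _ sq])
    show "poly L 0 = 1" unfolding polyL using A0 s by (cases s) (auto simp: sum.lessThan_Suc_shift)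
    show "1 / sqrt (real CARD('a)) \<le> norm z" if "poly L z = 0" for z
      by (rule roots_bound_of_power_sums[OF A0 As newton B sq]) (use that in \<open>auto simp: polyL\<close>)
  qed
  also have "\<dots> \<le> real (card C - 1) * sqrt (real CARD('a))"
  proof (intro mult_right_mono)
    have "degree L \<le> s - 1" by (rule degree_le) (use coeffL As in auto)
    then show "real (degree L) \<le> real (card C - 1)" by (simp add: s_def)
  qed simp
  also have "coeff L 1 = (\<Sum>x\<in>UNIV. \<chi> (\<Prod>c\<in>C. (x - c) ^ e c))"
  proof -
    have "A 1 = (\<Sum>g\<in>range (\<lambda>a::'a mod_ring. [:- a, 1:]). \<Lambda> g)" by (simp only: A_def char_coeff_def monic_polys_1)
    also have "\<dots> = (\<Sum>a\<in>UNIV. \<Lambda> [:- a, 1:])" by (subst sum.reindex) (auto simp: inj_on_def)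
    also have "\<dots> = (\<Sum>x\<in>UNIV. \<chi> (\<Prod>c\<in>C. (x - c) ^ e c))"
      by (intro sum.cong refl) (simp add: \<Lambda>_def res_value_def)
    finally show ?thesis using coeffL by simp
  qed
  finally show ?thesis .
qed

end

section \<open>The Weil bound modulo a prime\<close>

text \<open>The substitution \<open>x = c1 + 1 / y\<close> moves a zero of multiplicity prime to \<open>q - 1\<close> to infinity,
  after which the degree is prime to \<open>q - 1\<close>.\<close>

theorem weil_bound_mod_ring:
  fixes \<chi> :: "'a::prime_card mod_ring \<Rightarrow> complex"
  assumes \<chi>: "mult_char \<chi>" and nontriv: "\<exists>u. u \<noteq> 0 \<and> \<chi> u \<noteq> 1"
    and e_pos: "\<And>c. c \<in> C \<Longrightarrow> e c \<ge> 1"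
    and c1: "c1 \<in> C" "coprime (e c1) (CARD('a) - 1)"
  shows "norm (\<Sum>x\<in>UNIV. \<chi> (\<Prod>c\<in>C. (x - c) ^ e c)) \<le> real (card C) * sqrt (real CARD('a))"
proof -
  define q0 where "q0 = CARD('a)"
  define m where "m = (\<Sum>c\<in>C. e c)"
  define C1 where "C1 = C - {c1}"
  define \<delta> where "\<delta> c = 1 / (c - c1)" for c
  define C' where "C' = insert 0 (\<delta> ` C1)"
  \<comment> \<open>Clearing denominators after the substitution leaves the factor
    \<open>y ^ (- m)\<close>. Since \<open>y ^ (q0 - 2) = 1 / y\<close>, it is a genuine power of
    \<open>y\<close> with exponent \<open>m * (q0 - 2)\<close>, which makes 0 a new zero in the
    place of \<open>c1\<close>.\<close>
  define e' where "e' z = (if z = 0 then m * (q0 - 2) else e (c1 + 1 / z))" for z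
  define \<kappa> where "\<kappa> = (\<Prod>c\<in>C1. (c1 - c) ^ e c)"
  have finC: "finite C" by simp
  \<comment> \<open>The field with two elements has no nontrivial character; from here on
    \<open>q0 - 2\<close> is positive, so the exponent at 0 is too.\<close>
  have q3: "q0 \<ge> 3"
  proof (rule ccontr)
    assume "\<not> q0 \<ge> 3"
    then have "q0 = 2" using card_mod_ring_ge_2[where ?'a='a] by (simp add: q0_def)
    obtain u where u: "u \<noteq> 0" "\<chi> u \<noteq> 1" using nontriv by blast
    have "card {0, 1, u} \<le> CARD('a mod_ring)" by (rule card_mono) auto
    moreover have "u \<noteq> 1" using u \<chi> by (auto simp: mult_char_def)
    ultimately show False using u \<open>q0 = 2\<close> by (simp add: q0_def)
  qed
  have m: "m = e c1 + (\<Sum>c\<in>C1. e c)" unfolding m_def C1_def by (rule sum.remove[OF finC c1(1)])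
  have m1: "m \<ge> 1" using m e_pos[OF c1(1)] by simp
  have \<delta>0: "\<delta> c \<noteq> 0" "c1 + 1 / \<delta> c = c" if "c \<in> C1" for c using that by (auto simp: \<delta>_def C1_def)
  have inj\<delta>: "inj_on \<delta> C1" by (rule inj_onI) (metis \<delta>0(2))
  have notin: "0 \<notin> \<delta> ` C1" using \<delta>0(1) by force
  have "card (\<delta> ` C1) = card C1" by (rule card_image[OF inj\<delta>])
  then have cardC': "card C' = card C" unfolding C'_def using notin card_Suc_Diff1[OF finC c1(1)] by (simp add: C1_def)
  have e'\<delta>: "e' (\<delta> c) = e c" if "c \<in> C1" for c using \<delta>0[OF that] by (simp add: e'_def)
  have sume': "(\<Sum>c\<in>C'. e' c) = m * (q0 - 2) + (\<Sum>c\<in>C1. e c)"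
  proof -
    have "(\<Sum>c\<in>C'. e' c) = e' 0 + (\<Sum>c\<in>\<delta> ` C1. e' c)" unfolding C'_def using notin by simp
    also have "(\<Sum>c\<in>\<delta> ` C1. e' c) = (\<Sum>c\<in>C1. e c)" by (simp add: sum.reindex[OF inj\<delta>] e'\<delta>)
    finally show ?thesis by (simp add: e'_def)
  qed
  \<comment> \<open>Modulo \<open>q0 - 1\<close> the new degree is \<open>- e c1\<close>; this is
    how the hypothesis on \<open>e c1\<close> makes the degree prime to
    \<open>q0 - 1\<close>.\<close>
  have eq_sum: "(\<Sum>c\<in>C'. e' c) + e c1 = m * (q0 - 1)"
  proof -
    have "(\<Sum>c\<in>C'. e' c) + e c1 = m * (q0 - 2) + m" using sume' m by simp
    also have "\<dots> = m * ((q0 - 2) + 1)" by (simp only: distrib_left mult_1_right)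
    also have "(q0 - 2) + 1 = q0 - 1" using q3 by simp
    finally show ?thesis .
  qed
  have cop: "coprime (\<Sum>c\<in>C'. e' c) (q0 - 1)"
  proof (intro coprimeI)
    fix k assume k: "k dvd (\<Sum>c\<in>C'. e' c)" "k dvd q0 - 1"
    have "k dvd (\<Sum>c\<in>C'. e' c) + e c1" unfolding eq_sum using k(2) by simp
    then have "k dvd e c1" using k(1) by (simp add: dvd_add_right_iff)
    then show "is_unit k" using coprime_common_divisor[OF c1(2)] k(2) unfolding q0_def by blast
  qed
  have bound: "norm (\<Sum>y\<in>UNIV. \<chi> (\<Prod>c\<in>C'. (y - c) ^ e' c)) \<le> real (card C' - 1) * sqrt (real CARD('a))"
  proof (rule weil_bound_coprime_degree[OF \<chi> nontriv])
    show "e' c \<ge> 1" if cC': "c \<in> C'" for c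
    proof (cases "c = 0")
      case True
      have "1 * 1 \<le> m * (q0 - 2)" using m1 q3 by (intro mult_le_mono) auto
      then show ?thesis using True by (simp add: e'_def)
    next
      case False
      then obtain c' where "c' \<in> C1" "c = \<delta> c'" using cC' unfolding C'_def by blast
      then show ?thesis using e'\<delta> e_pos by (simp add: C1_def)
    qed
    show "coprime (\<Sum>c\<in>C'. e' c) (CARD('a) - 1)" using cop by (simp add: q0_def)
  qed
  have eq: "(\<Prod>c\<in>C. (c1 + 1 / y - c) ^ e c) = \<kappa> * (\<Prod>c\<in>C'. (y - c) ^ e' c)" if y: "y \<noteq> 0" for y
  proof -
    have yinv: "y ^ (q0 - 2) = 1 / y"
    proof -
      have "y ^ (q0 - 2) * y = y ^ (q0 - 1)" using q3
        by (metis Suc_1 Suc_diff_Suc Suc_le_lessD diff_Suc_eq_diff_pred numeral_3_eq_3 plus_1_eq_Suc power_Suc2 Suc_leD diff_Suc_1 One_nat_def lessI)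
      also have "\<dots> = 1" unfolding q0_def by (rule mod_ring_power_card_minus_1[OF y])
      finally show ?thesis using y by (simp add: field_simps)
    qed
    have "(\<Prod>c\<in>C'. (y - c) ^ e' c) = (y - 0) ^ e' 0 * (\<Prod>c\<in>\<delta> ` C1. (y - c) ^ e' c)"
      unfolding C'_def using notin by simp
    also have "(\<Prod>c\<in>\<delta> ` C1. (y - c) ^ e' c) = (\<Prod>c\<in>C1. (y - \<delta> c) ^ e c)"
      by (simp add: prod.reindex[OF inj\<delta>] e'\<delta>)
    also have "(y - 0) ^ e' 0 = (1 / y) ^ m"
      using yinv by (simp add: e'_def power_mult mult.commute[of m])
    also have "(1 / y) ^ m = (1 / y) ^ e c1 * (\<Prod>c\<in>C1. (1 / y) ^ e c)"
      unfolding m power_add power_sum ..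
    finally have r: "(\<Prod>c\<in>C'. (y - c) ^ e' c) = (1 / y) ^ e c1 * ((\<Prod>c\<in>C1. (1 / y) ^ e c) * (\<Prod>c\<in>C1. (y - \<delta> c) ^ e c))"
      by (simp only: mult.assoc)
    have "(\<Prod>c\<in>C. (c1 + 1 / y - c) ^ e c) = (1 / y) ^ e c1 * (\<Prod>c\<in>C1. (c1 + 1 / y - c) ^ e c)"
      unfolding C1_def by (subst prod.remove[OF finC c1(1)]) simp
    also have "(\<Prod>c\<in>C1. (c1 + 1 / y - c) ^ e c) = (\<Prod>c\<in>C1. (c1 - c) ^ e c * ((1 / y) ^ e c * (y - \<delta> c) ^ e c))"
    proof (intro prod.cong refl)
      fix c assume "c \<in> C1"
      then have "c \<noteq> c1" by (simp add: C1_def)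
      then have d: "(c1 - c) * \<delta> c = - 1"
      proof -
        have "(c - c1) * \<delta> c = 1" using \<open>c \<noteq> c1\<close> by (simp add: \<delta>_def)
        moreover have "(c1 - c) * \<delta> c = - ((c - c1) * \<delta> c)" by (simp only: minus_mult_left minus_diff_eq)
        ultimately show ?thesis by simp
      qed
      have alg: "u * (v * (y - w)) = u * (v * y) - v * (u * w)" for u v w by (simp add: algebra_simps)
      have "(c1 - c) * ((1 / y) * (y - \<delta> c)) = (c1 - c) * ((1 / y) * y) - (1 / y) * ((c1 - c) * \<delta> c)"
        by (rule alg)
      then have "c1 + 1 / y - c = (c1 - c) * ((1 / y) * (y - \<delta> c))"
        using y by (simp add: d)
      then show "(c1 + 1 / y - c) ^ e c = (c1 - c) ^ e c * ((1 / y) ^ e c * (y - \<delta> c) ^ e c)"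
        by (simp only: power_mult_distrib)
    qed
    finally show ?thesis unfolding r \<kappa>_def prod.distrib by (simp only: ac_simps)
  qed
  have "(\<Sum>x\<in>UNIV. \<chi> (\<Prod>c\<in>C. (x - c) ^ e c)) = (\<Sum>x\<in>UNIV - {c1}. \<chi> (\<Prod>c\<in>C. (x - c) ^ e c))"
  proof (rule sum.mono_neutral_right)
    have "(\<Prod>c\<in>C. (c1 - c) ^ e c) = 0" using c1 e_pos[OF c1(1)] by (auto intro!: bexI[of _ c1])
    then have "\<chi> (\<Prod>c\<in>C. (c1 - c) ^ e c) = 0" using \<chi> by (metis mult_char_def)
    then show "\<forall>x\<in>UNIV - (UNIV - {c1}). \<chi> (\<Prod>c\<in>C. (x - c) ^ e c) = 0" by (metis DiffD2 DiffI UNIV_I singletonD)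
  qed auto
  also have "\<dots> = (\<Sum>y\<in>UNIV - {0}. \<chi> (\<Prod>c\<in>C. (c1 + 1 / y - c) ^ e c))"
    by (rule sum.reindex_bij_witness[where i = "\<lambda>y. c1 + 1 / y" and j = "\<lambda>x. 1 / (x - c1)"]) auto
  also have "\<dots> = (\<Sum>y\<in>UNIV - {0}. \<chi> \<kappa> * \<chi> (\<Prod>c\<in>C'. (y - c) ^ e' c))"
    using \<chi> by (intro sum.cong refl) (simp add: eq mult_char_def)
  also have "\<dots> = (\<Sum>y\<in>UNIV. \<chi> \<kappa> * \<chi> (\<Prod>c\<in>C'. (y - c) ^ e' c))"
  proof (rule sum.mono_neutral_left)
    have "e' 0 \<noteq> 0" using m1 q3 by (simp add: e'_def)
    then have "(\<Prod>c\<in>C'. (0 - c) ^ e' c) = 0" by (auto simp: C'_def intro!: bexI[of _ 0])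
    then have "\<chi> \<kappa> * \<chi> (\<Prod>c\<in>C'. (0 - c) ^ e' c) = 0" using \<chi> by (metis mult_char_def mult_zero_right)
    then show "\<forall>y\<in>UNIV - (UNIV - {0}). \<chi> \<kappa> * \<chi> (\<Prod>c\<in>C'. (y - c) ^ e' c) = 0" by (metis DiffD2 DiffI UNIV_I singletonD)
  qed auto
  also have "\<dots> = \<chi> \<kappa> * (\<Sum>y\<in>UNIV. \<chi> (\<Prod>c\<in>C'. (y - c) ^ e' c))" by (simp add: sum_distrib_left)
  finally have "norm (\<Sum>x\<in>UNIV. \<chi> (\<Prod>c\<in>C. (x - c) ^ e c)) = norm (\<chi> \<kappa>) * norm (\<Sum>y\<in>UNIV. \<chi> (\<Prod>c\<in>C'. (y - c) ^ e' c))"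
    by (simp add: norm_mult)
  moreover have "\<kappa> \<noteq> 0" unfolding \<kappa>_def C1_def by auto
  then have "norm (\<chi> \<kappa>) = 1" by (rule norm_mult_char[OF \<chi>])
  ultimately have "norm (\<Sum>x\<in>UNIV. \<chi> (\<Prod>c\<in>C. (x - c) ^ e c)) = norm (\<Sum>y\<in>UNIV. \<chi> (\<Prod>c\<in>C'. (y - c) ^ e' c))"
    by simp
  also note bound
  also have "real (card C' - 1) * sqrt (real CARD('a)) \<le> real (card C) * sqrt (real CARD('a))"
    using cardC' by (intro mult_right_mono) auto
  finally show ?thesis .
qed

section \<open>Transfer to Dirichlet characters modulo a prime\<close>

lemma dirichlet_character_mod:
  assumes "dirichlet_character q \<chi>" shows "\<chi> (m mod int q) = \<chi> m"
proof -
  have step: "\<chi> (m + int q) = \<chi> m" for m using assms by (simp add: dirichlet_character_def)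
  have nat: "\<chi> (m + int n * int q) = \<chi> m" for m n
    by (induction n) (use step[of "m + int _ * int q"] in \<open>auto simp: algebra_simps\<close>)
  have "\<chi> (m + k * int q) = \<chi> m" for m k
  proof (cases "k \<ge> 0")
    case True
    then show ?thesis using nat[of m "nat k"] by simp
  next
    case False
    then show ?thesis using nat[of "m + k * int q" "nat (- k)"] by simp
  qed
  from this[of "m mod int q" "m div int q"] show ?thesis by simp
qed

lemma dirichlet_character_cong:
  assumes "dirichlet_character q \<chi>" "[m = n] (mod int q)" shows "\<chi> m = \<chi> n"
  using assms dirichlet_character_mod[OF assms(1)] by (metis Cong.cong_def)

lemma dirichlet_character_mult: "dirichlet_character q \<chi> \<Longrightarrow> \<chi> (m * n) = \<chi> m * \<chi> n"
  by (simp add: dirichlet_character_def)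

lemma dirichlet_character_1:
  assumes "dirichlet_character q \<chi>" shows "\<chi> 1 = 1"
proof -
  have "\<chi> 1 * \<chi> 1 = \<chi> 1" using dirichlet_character_mult[OF assms, of 1 1] by simp
  moreover have "\<chi> 1 \<noteq> 0" using assms by (simp add: dirichlet_character_def)
  ultimately show ?thesis by simp
qed

text \<open>Phrased as a predicate of a number so that it can be proved for the cardinality of a
  type and then compared between primes. Zeros are given as \<open>- c\<close> with
  \<open>c < p\<close>, the form in which the shifts \<open>x + v\<close> occur later.\<close>

definition weil_property :: "nat \<Rightarrow> bool" where
  "weil_property p \<longleftrightarrow> (\<forall>\<chi> C e c1. dirichlet_character p \<chi> \<longrightarrow> \<chi> \<noteq> principal_character p \<longrightarrow>
     C \<subseteq> {..<p} \<longrightarrow> (\<forall>c\<in>C. e c \<ge> 1) \<longrightarrow> c1 \<in> C \<longrightarrow> coprime (e c1) (p - 1) \<longrightarrow>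
     norm (\<Sum>x<p. \<chi> (\<Prod>c\<in>C. (int x + int c) ^ e c)) \<le> real (card C) * sqrt (real p))"

lemma weil_property_CARD: "weil_property CARD('a::prime_card)"
  unfolding weil_property_def
proof (intro allI impI)
  fix \<chi> :: "int \<Rightarrow> complex" and C :: "nat set" and e :: "nat \<Rightarrow> nat" and c1
  assume \<chi>: "dirichlet_character CARD('a) \<chi>" "\<chi> \<noteq> principal_character CARD('a)"
    and C: "C \<subseteq> {..<CARD('a)}" "\<forall>c\<in>C. e c \<ge> 1" "c1 \<in> C" "coprime (e c1) (CARD('a) - 1)"
  let ?p = "CARD('a)"
  define \<psi> :: "'a mod_ring \<Rightarrow> complex" where "\<psi> y = \<chi> (to_int_mod_ring y)" for y
  have of_int: "\<psi> (of_int x) = \<chi> x" for x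
  proof -
    have "to_int_mod_ring (of_int x :: 'a mod_ring) = x mod int ?p"
      unfolding of_int_of_int_mod_ring by (rule of_int_mod_ring.rep_eq[folded to_int_mod_ring.rep_eq])
    then show ?thesis using dirichlet_character_mod[OF \<chi>(1)] by (simp add: \<psi>_def)
  qed
  have of_int_surj: "\<exists>x. y = of_int x" for y :: "'a mod_ring"
    by (metis of_int_mod_ring_to_int_mod_ring of_int_of_int_mod_ring)
  have \<psi>: "mult_char \<psi>"
    unfolding mult_char_def
  proof (intro conjI allI)
    have "\<not> coprime 0 (int ?p)" using prime_card[where ?'a='a] by auto
    then have "\<chi> 0 = 0" using \<chi>(1) by (metis dirichlet_character_def)
    then show "\<psi> 0 = 0" using of_int[of 0] by simp
    show "\<psi> 1 = 1" using of_int[of 1] dirichlet_character_1[OF \<chi>(1)] by simp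
    fix x y :: "'a mod_ring"
    obtain x' y' where "x = of_int x'" "y = of_int y'" using of_int_surj by meson
    then show "\<psi> (x * y) = \<psi> x * \<psi> y"
      using of_int[of "x' * y'"] by (simp add: of_int dirichlet_character_mult[OF \<chi>(1)])
  qed
  have nontriv: "\<exists>u. u \<noteq> 0 \<and> \<psi> u \<noteq> 1"
  proof -
    obtain n where n: "\<chi> n \<noteq> principal_character ?p n" using \<chi>(2) by blast
    then have "coprime n (int ?p)"
      using \<chi>(1) by (auto simp: principal_character_def dirichlet_character_def split: if_splits)
    then have "\<chi> n \<noteq> 0" "\<chi> n \<noteq> 1" using n \<chi>(1) by (auto simp: principal_character_def dirichlet_character_def)
    then have "\<psi> (of_int n) \<noteq> 0" "\<psi> (of_int n) \<noteq> 1" by (auto simp: of_int)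
    moreover have "\<psi> 0 = 0" using \<psi> by (simp add: mult_char_def)
    ultimately show ?thesis by metis
  qed
  define CF where "CF = (\<lambda>c. - of_nat c :: 'a mod_ring) ` C"
  define eF where "eF z = e (nat (to_int_mod_ring (- z)))" for z :: "'a mod_ring"
  have rep_of_nat: "nat (to_int_mod_ring (of_nat c :: 'a mod_ring)) = c" if "c < ?p" for c
    using that by (simp add: of_nat_of_int_mod_ring)
  have inj: "inj_on (\<lambda>c. - of_nat c :: 'a mod_ring) C"
    using rep_of_nat C(1) by (intro inj_onI) (metis minus_minus lessThan_iff subset_iff)
  have eF: "eF (- of_nat c) = e c" if "c \<in> C" for c using that C(1) rep_of_nat[of c] by (auto simp: eF_def)
  have cardCF: "card CF = card C" unfolding CF_def by (rule card_image[OF inj])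
  have "norm (\<Sum>x\<in>UNIV. \<psi> (\<Prod>c\<in>CF. (x - c) ^ eF c)) \<le> real (card CF) * sqrt (real ?p)"
  proof (rule weil_bound_mod_ring[OF \<psi> nontriv])
    show "eF c \<ge> 1" if "c \<in> CF" for c using that C(2) eF by (auto simp: CF_def)
    show "- of_nat c1 \<in> CF" using C(3) by (simp add: CF_def)
    show "coprime (eF (- of_nat c1)) (?p - 1)" using C(3,4) eF by simp
  qed
  also have "(\<Sum>x\<in>UNIV. \<psi> (\<Prod>c\<in>CF. (x - c) ^ eF c)) = (\<Sum>x<?p. \<chi> (\<Prod>c\<in>C. (int x + int c) ^ e c))"
  proof -
    have "(\<Sum>x\<in>UNIV. \<psi> (\<Prod>c\<in>CF. (x - c) ^ eF c)) = (\<Sum>x<?p. \<psi> (\<Prod>c\<in>CF. (of_nat x - c) ^ eF c))"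
    proof (rule sum.reindex_bij_witness[where i = of_nat and j = "\<lambda>y. nat (to_int_mod_ring y)"])
      fix y :: "'a mod_ring"
      have "to_int_mod_ring y \<in> {0..<int ?p}" using range_to_int_mod_ring[where ?'a='a] by blast
      then show "nat (to_int_mod_ring y) \<in> {..<?p}" by auto
      show "of_nat (nat (to_int_mod_ring y)) = y"
        using \<open>to_int_mod_ring y \<in> {0..<int ?p}\<close> by (simp add: of_nat_of_int_mod_ring)
      then show "\<psi> (\<Prod>c\<in>CF. (of_nat (nat (to_int_mod_ring y)) - c) ^ eF c) = \<psi> (\<Prod>c\<in>CF. (y - c) ^ eF c)" by simp
    qed (use rep_of_nat in auto)
    also have "\<dots> = (\<Sum>x<?p. \<chi> (\<Prod>c\<in>C. (int x + int c) ^ e c))"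
    proof (intro sum.cong refl)
      fix x
      have "(\<Prod>c\<in>CF. (of_nat x - c) ^ eF c) = (\<Prod>c\<in>C. (of_nat x + of_nat c) ^ e c :: 'a mod_ring)"
        unfolding CF_def by (subst prod.reindex[OF inj]) (use eF in auto)
      also have "\<dots> = of_int (\<Prod>c\<in>C. (int x + int c) ^ e c)" by simp
      finally show "\<psi> (\<Prod>c\<in>CF. (of_nat x - c) ^ eF c) = \<chi> (\<Prod>c\<in>C. (int x + int c) ^ e c)" by (simp only: of_int)
    qed
    finally show ?thesis .
  qed
  finally show "norm (\<Sum>x<?p. \<chi> (\<Prod>c\<in>C. (int x + int c) ^ e c)) \<le> real (card C) * sqrt (real ?p)"
    by (simp add: cardCF)
qed

text \<open>HOL has no types that depend on a term \<open>p\<close>, so a field with \<open>p\<close> elements cannot be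
  formed for a variable \<open>p\<close>. It can be formed for the closed term below, which is a prime violating
  the Weil bound if there is one.\<close>

definition weil_prime :: nat where
  "weil_prime = (SOME p. prime p \<and> ((\<exists>q. prime q \<and> \<not> weil_property q) \<longrightarrow> \<not> weil_property p))"

lemma weil_prime_properties:
  "prime weil_prime" "\<exists>q. prime q \<and> \<not> weil_property q \<Longrightarrow> \<not> weil_property weil_prime"
proof -
  have "\<exists>p::nat. prime p \<and> ((\<exists>q. prime q \<and> \<not> weil_property q) \<longrightarrow> \<not> weil_property p)"
    using two_is_prime_nat by blast
  from someI_ex[OF this] show "prime weil_prime"
    "\<exists>q. prime q \<and> \<not> weil_property q \<Longrightarrow> \<not> weil_property weil_prime"
    unfolding weil_prime_def by blast+
qed

typedef weil_index = "{..<weil_prime}"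
  using weil_prime_properties(1) prime_gt_0_nat by blast

lemma CARD_weil_index: "CARD(weil_index) = weil_prime"
  using type_definition.card[OF type_definition_weil_index] by simp

instance weil_index :: prime_card
  by standard (simp add: CARD_weil_index weil_prime_properties(1))

theorem weil_bound:
  assumes "prime p" "dirichlet_character p \<chi>" "\<chi> \<noteq> principal_character p"
    "C \<subseteq> {..<p}" "\<And>c. c \<in> C \<Longrightarrow> e c \<ge> 1" "c1 \<in> C" "coprime (e c1) (p - 1)"
  shows "norm (\<Sum>x<p. \<chi> (\<Prod>c\<in>C. (int x + int c) ^ e c)) \<le> real (card C) * sqrt (real p)"
proof -
  have "weil_property weil_prime"
    using weil_property_CARD[where ?'a=weil_index] by (simp add: CARD_weil_index)
  then have "weil_property p" using weil_prime_properties(2) assms(1) by blast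
  then show ?thesis using assms unfolding weil_property_def by blast
qed

section \<open>Moments of short character sums\<close>

lemma dirichlet_character_power: "dirichlet_character q \<chi> \<Longrightarrow> \<chi> (m ^ n) = \<chi> m ^ n"
  by (induction n) (auto simp: dirichlet_character_1 dirichlet_character_mult)

lemma dirichlet_character_prod: "dirichlet_character q \<chi> \<Longrightarrow> \<chi> (prod f S) = (\<Prod>s\<in>S. \<chi> (f s))"
  by (induction S rule: infinite_finite_induct) (auto simp: dirichlet_character_1 dirichlet_character_mult)

lemma dirichlet_character_eq_0: "dirichlet_character q \<chi> \<Longrightarrow> \<not> coprime m (int q) \<Longrightarrow> \<chi> m = 0"
  by (auto simp: dirichlet_character_def)

lemma dirichlet_character_power_prime:
  assumes "prime p" "dirichlet_character p \<chi>" "coprime m (int p)"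
  shows "\<chi> m ^ (p - 1) = 1"
proof -
  have "[m ^ (p - 1) = 1] (mod int p)"
  proof -
    define k where "k = nat (m mod int p)"
    have pos: "int p > 0" using assms(1) prime_gt_0_nat by simp
    have k: "int k = m mod int p" using pos by (simp add: k_def)
    have "coprime (int k) (int p)" using assms(3) pos unfolding k by (simp add: coprime_mod_left_iff)
    then have "coprime k p" by simp
    then have "\<not> p dvd k" using assms(1) by (metis coprime_absorb_right not_prime_unit)
    then have "[k ^ (p - 1) = 1] (mod p)" using fermat_theorem[OF assms(1)] by blast
    then have "[int k ^ (p - 1) = 1] (mod int p)" by (metis cong_int_iff of_nat_1 of_nat_power)
    moreover have "[int k = m] (mod int p)" unfolding k by (simp add: Cong.cong_def)
    ultimately show ?thesis by (meson cong_pow cong_sym cong_trans)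
  qed
  then have "\<chi> (m ^ (p - 1)) = \<chi> 1" by (rule dirichlet_character_cong[OF assms(2)])
  then show ?thesis by (simp add: dirichlet_character_power[OF assms(2)] dirichlet_character_1[OF assms(2)])
qed

lemma norm_dirichlet_character:
  assumes "prime p" "dirichlet_character p \<chi>" "coprime m (int p)"
  shows "norm (\<chi> m) = 1"
proof -
  have "norm (\<chi> m) ^ (p - 1) = 1"
    using dirichlet_character_power_prime[OF assms] by (metis norm_one norm_power)
  moreover have "p - 1 > 0" using prime_gt_1_nat[OF assms(1)] by simp
  ultimately show ?thesis by (metis norm_ge_zero power_eq_1_iff real_norm_def abs_of_nonneg neq0_conv)
qed

lemma norm_dirichlet_character_le:
  assumes "prime p" "dirichlet_character p \<chi>"
  shows "norm (\<chi> m) \<le> 1"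
  using norm_dirichlet_character[OF assms, of m] dirichlet_character_eq_0[OF assms(2), of m]
  by (cases "coprime m (int p)") auto

text \<open>A nonzero value is a root of unity of order dividing \<open>p - 1\<close>, so its
  conjugate is its inverse; for \<open>p \<ge> 3\<close> the exponent is positive, which makes both
  sides vanish at multiples of \<open>p\<close>. Conjugated factors can thus be merged into the
  argument of \<open>\<chi>\<close>.\<close>

lemma cnj_dirichlet_character:
  assumes "prime p" "p \<ge> 3" "dirichlet_character p \<chi>"
  shows "cnj (\<chi> m) = \<chi> m ^ (p - 2)"
proof (cases "coprime m (int p)")
  case True
  have "p - 1 = Suc (p - 2)" using assms(2) by simp
  then have "\<chi> m * \<chi> m ^ (p - 2) = 1"
    using dirichlet_character_power_prime[OF assms(1,3) True] by simp
  moreover have "\<chi> m * cnj (\<chi> m) = 1"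
    using norm_dirichlet_character[OF assms(1,3) True] complex_norm_square[of "\<chi> m"] by simp
  ultimately show ?thesis by (metis mult_cancel_left mult_zero_left zero_neq_one)
next
  case False
  then show ?thesis using dirichlet_character_eq_0[OF assms(3)] assms(2) by simp
qed

text \<open>After the conjugates are rewritten as powers, the value \<open>f i0\<close> receives
  exponent \<open>1\<close> or \<open>p - 2\<close>, because no other index shares it. Both are
  prime to \<open>p - 1\<close>, so it can serve as \<open>c1\<close> in
  \<open>weil_bound\<close>.\<close>

lemma complete_sum_bound:
  fixes f :: "nat \<Rightarrow> nat"
  assumes p: "prime p" "p \<ge> 3" and \<chi>: "dirichlet_character p \<chi>" "\<chi> \<noteq> principal_character p"
    and f: "\<And>i. i < 2 * r \<Longrightarrow> f i < p"
    and i0: "i0 < 2 * r" "\<And>j. j < 2 * r \<Longrightarrow> j \<noteq> i0 \<Longrightarrow> f j \<noteq> f i0"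
  shows "norm (\<Sum>x<p. \<Prod>i<2*r. if i < r then \<chi> (int x + int (f i)) else cnj (\<chi> (int x + int (f i))))
     \<le> 2 * real r * sqrt (real p)"
proof -
  define w where "w i = (if i < r then 1 else p - 2)" for i
  define C where "C = f ` {..<2*r}"
  define e where "e c = (\<Sum>i\<in>{i\<in>{..<2*r}. f i = c}. w i)" for c
  have "p - 2 \<ge> 1" using p(2) by linarith
  then have w1: "w i \<ge> 1" for i by (simp add: w_def)
  have "(\<Prod>i<2*r. if i < r then \<chi> (int x + int (f i)) else cnj (\<chi> (int x + int (f i))))
     = \<chi> (\<Prod>c\<in>C. (int x + int c) ^ e c)" for x
  proof -
    have "(\<Prod>i<2*r. if i < r then \<chi> (int x + int (f i)) else cnj (\<chi> (int x + int (f i))))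
       = (\<Prod>i<2*r. \<chi> (int x + int (f i)) ^ w i)"
      by (intro prod.cong refl) (simp add: w_def cnj_dirichlet_character[OF p \<chi>(1)])
    also have "\<dots> = (\<Prod>c\<in>C. \<Prod>i\<in>{i\<in>{..<2*r}. f i = c}. \<chi> (int x + int (f i)) ^ w i)"
      by (rule prod.group[symmetric]) (auto simp: C_def)
    also have "\<dots> = (\<Prod>c\<in>C. \<chi> (int x + int c) ^ e c)"
      unfolding e_def power_sum by (intro prod.cong refl) auto
    finally show ?thesis by (simp add: dirichlet_character_prod[OF \<chi>(1)] dirichlet_character_power[OF \<chi>(1)])
  qed
  then have "norm (\<Sum>x<p. \<Prod>i<2*r. if i < r then \<chi> (int x + int (f i)) else cnj (\<chi> (int x + int (f i))))
     = norm (\<Sum>x<p. \<chi> (\<Prod>c\<in>C. (int x + int c) ^ e c))" by simp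
  also have "\<dots> \<le> real (card C) * sqrt (real p)"
  proof (rule weil_bound[OF p(1) \<chi>])
    show "C \<subseteq> {..<p}" using f by (auto simp: C_def)
    show "e c \<ge> 1" if c: "c \<in> C" for c
    proof -
      obtain i where i: "i < 2 * r" "f i = c" using c by (auto simp: C_def)
      have "w i \<le> e c" unfolding e_def by (rule member_le_sum) (use i in auto)
      then show ?thesis using w1[of i] by simp
    qed
    show "f i0 \<in> C" using i0(1) by (simp add: C_def)
    have "{i\<in>{..<2*r}. f i = f i0} = {i0}" using i0 by auto
    then have "e (f i0) = w i0" by (simp add: e_def)
    moreover have "p - 1 = Suc (p - 2)" using p(2) by simp
    then have "coprime (p - 2) (p - 1)" by (metis coprime_Suc_right_nat)
    ultimately show "coprime (e (f i0)) (p - 1)" by (simp add: w_def)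
  qed
  also have "\<dots> \<le> 2 * real r * sqrt (real p)"
  proof (intro mult_right_mono)
    have "card C \<le> 2 * r" unfolding C_def using card_image_le[of "{..<2*r}" f] by simp
    then show "real (card C) \<le> 2 * real r" by simp
  qed simp
  finally show ?thesis .
qed

text \<open>If every value is taken at least twice, at most \<open>r\<close> values occur, and
  \<open>f\<close> factors through \<open>{..<r}\<close>. The bound counts the pairs consisting of
  an enumeration of the values and an assignment of the indices.\<close>

lemma card_paired_functions:
  fixes I :: "'b set"
  assumes "finite I" "r \<ge> 1"
  shows "card {f \<in> {..<2*r} \<rightarrow>\<^sub>E I. \<forall>i<2*r. \<exists>j<2*r. j \<noteq> i \<and> f j = f i} \<le> card I ^ r * r ^ (2 * r)"
proof -
  let ?bad = "{f \<in> {..<2*r} \<rightarrow>\<^sub>E I. \<forall>i<2*r. \<exists>j<2*r. j \<noteq> i \<and> f j = f i}"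
  let ?P = "({..<r} \<rightarrow>\<^sub>E I) \<times> ({..<2*r} \<rightarrow>\<^sub>E {..<r})"
  let ?F = "\<lambda>(g, \<sigma>). restrict (\<lambda>i. g (\<sigma> i)) {..<2*r}"
  have "?bad \<subseteq> ?F ` ?P"
  proof
    fix f assume f: "f \<in> ?bad"
    define S where "S = f ` {..<2*r}"
    have S: "finite S" "S \<noteq> {}" "S \<subseteq> I" using f assms(2) by (auto simp: S_def lessThan_empty_iff)
    have "2 * card S = (\<Sum>s\<in>S. 2)" by simp
    also have "\<dots> \<le> (\<Sum>s\<in>S. card {i\<in>{..<2*r}. f i = s})"
    proof (rule sum_mono)
      fix s assume "s \<in> S"
      then obtain i where i: "i < 2 * r" "f i = s" by (auto simp: S_def)
      then obtain j where j: "j < 2 * r" "j \<noteq> i" "f j = s" using f by auto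
      have "card {i, j} \<le> card {i\<in>{..<2*r}. f i = s}" by (rule card_mono) (use i j in auto)
      then show "2 \<le> card {i\<in>{..<2*r}. f i = s}" using j by simp
    qed
    also have "\<dots> = card {..<2*r}"
      using sum.group[of "{..<2*r}" S f "\<lambda>_. 1::nat"] S(1) by (simp add: S_def)
    finally have cS: "card S \<le> r" by simp
    obtain h where h: "bij_betw h {0..<card S} S" using ex_bij_betw_nat_finite[OF S(1)] by blast
    have c0: "card S > 0" using S by (simp add: card_gt_0_iff)
    define g where "g = restrict (\<lambda>i. if i < card S then h i else h 0) {..<r}"
    have hS: "h i \<in> S" if "i < card S" for i using h that by (auto simp: bij_betw_def)
    have g: "g \<in> {..<r} \<rightarrow>\<^sub>E I" using hS c0 S(3) by (auto simp: g_def)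
    have "\<exists>k<r. g k = f i" if "i < 2 * r" for i
    proof -
      have "f i \<in> h ` {0..<card S}" using that h by (simp add: S_def bij_betw_def)
      then obtain k where "k < card S" "h k = f i" by auto
      then show ?thesis using cS by (intro exI[of _ k]) (simp add: g_def)
    qed
    then obtain \<sigma>0 where \<sigma>0: "\<And>i. i < 2 * r \<Longrightarrow> \<sigma>0 i < r \<and> g (\<sigma>0 i) = f i" by metis
    define \<sigma> where "\<sigma> = restrict \<sigma>0 {..<2*r}"
    have "\<sigma> \<in> {..<2*r} \<rightarrow>\<^sub>E {..<r}" using \<sigma>0 by (auto simp: \<sigma>_def)
    moreover have "f = ?F (g, \<sigma>)"
    proof
      fix i show "f i = ?F (g, \<sigma>) i"
        using \<sigma>0[of i] f by (cases "i < 2 * r") (auto simp: \<sigma>_def PiE_def extensional_def)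
    qed
    ultimately show "f \<in> ?F ` ?P" using g by blast
  qed
  moreover have finP: "finite ?P" using assms(1) by (intro finite_cartesian_product finite_PiE) auto
  ultimately have "card ?bad \<le> card (?F ` ?P)" by (intro card_mono) auto
  also have "\<dots> \<le> card ?P" by (rule card_image_le[OF finP])
  also have "\<dots> = card I ^ r * r ^ (2 * r)"
    using assms(1) by (simp add: card_cartesian_product card_PiE)
  finally show ?thesis .
qed

text \<open>The expanded power is a sum over tuples \<open>f\<close> of shifts. A tuple with a value
  taken just once gives a complete sum of size \<open>sqrt p\<close>; the remaining tuples number
  only about \<open>card I ^ r\<close> and are estimated trivially by \<open>p\<close>.\<close>

lemma moment_bound:
  assumes p: "prime p" "p \<ge> 3" and \<chi>: "dirichlet_character p \<chi>" "\<chi> \<noteq> principal_character p"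
    and I: "I \<subseteq> {..<p}" and r: "r \<ge> 1"
  shows "(\<Sum>x<p. norm (\<Sum>v\<in>I. \<chi> (int x + int v)) ^ (2 * r))
     \<le> 2 * real r * real (card I) ^ (2 * r) * sqrt (real p) + real r ^ (2 * r) * real (card I) ^ r * real p"
proof -
  have finI: "finite I" using I finite_subset by blast
  define g where "g i x v = (if i < r then \<chi> (int x + int v) else cnj (\<chi> (int x + int v)))" for i x v :: nat
  define F where "F = {..<2*r} \<rightarrow>\<^sub>E I"
  define bad where "bad = {f \<in> F. \<forall>i<2*r. \<exists>j<2*r. j \<noteq> i \<and> f j = f i}"
  have finF: "finite F" unfolding F_def by (intro finite_PiE finI) auto
  have expand: "of_real (norm (\<Sum>v\<in>I. \<chi> (int x + int v)) ^ (2 * r)) = (\<Sum>f\<in>F. \<Prod>i<2*r. g i x (f i))" for x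
  proof -
    define z where "z = (\<Sum>v\<in>I. \<chi> (int x + int v))"
    have "complex_of_real (norm z ^ (2 * r)) = (z * cnj z) ^ r"
      by (simp add: complex_norm_square[symmetric] power_mult)
    also have "\<dots> = (\<Prod>i<2*r. if i < r then z else cnj z)"
    proof -
      have "(\<Prod>i<2*r. if i < r then z else cnj z) = (\<Prod>i\<in>{..<r} \<union> {r..<2*r}. if i < r then z else cnj z)"
        by (intro prod.cong) auto
      also have "\<dots> = (\<Prod>i\<in>{..<r}. if i < r then z else cnj z) * (\<Prod>i\<in>{r..<2*r}. if i < r then z else cnj z)"
        by (rule prod.union_disjoint) auto
      also have "\<dots> = z ^ r * cnj z ^ r" by simp
      finally show ?thesis by (simp add: power_mult_distrib)
    qed
    also have "\<dots> = (\<Prod>i<2*r. \<Sum>v\<in>I. g i x v)"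
      by (intro prod.cong refl) (simp add: z_def g_def)
    also have "\<dots> = (\<Sum>f\<in>F. \<Prod>i<2*r. g i x (f i))"
      unfolding F_def by (rule prod_sum_PiE) (auto simp: finI)
    finally show ?thesis by (simp add: z_def)
  qed
  have "of_real (\<Sum>x<p. norm (\<Sum>v\<in>I. \<chi> (int x + int v)) ^ (2 * r)) = (\<Sum>x<p. \<Sum>f\<in>F. \<Prod>i<2*r. g i x (f i))"
    using expand by simp
  also have "\<dots> = (\<Sum>f\<in>F. \<Sum>x<p. \<Prod>i<2*r. g i x (f i))" by (rule sum.swap)
  finally have eq: "complex_of_real (\<Sum>x<p. norm (\<Sum>v\<in>I. \<chi> (int x + int v)) ^ (2 * r)) = (\<Sum>f\<in>F. \<Sum>x<p. \<Prod>i<2*r. g i x (f i))" .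
  have "(\<Sum>x<p. norm (\<Sum>v\<in>I. \<chi> (int x + int v)) ^ (2 * r)) = norm (complex_of_real (\<Sum>x<p. norm (\<Sum>v\<in>I. \<chi> (int x + int v)) ^ (2 * r)))"
    by (simp only: norm_of_real) (simp add: sum_nonneg)
  also have "\<dots> \<le> (\<Sum>f\<in>F. norm (\<Sum>x<p. \<Prod>i<2*r. g i x (f i)))" unfolding eq by (rule norm_sum)
  also have "\<dots> \<le> (\<Sum>f\<in>F. 2 * real r * sqrt (real p) + (if f \<in> bad then real p else 0))"
  proof (rule sum_mono)
    fix f assume f: "f \<in> F"
    show "norm (\<Sum>x<p. \<Prod>i<2*r. g i x (f i)) \<le> 2 * real r * sqrt (real p) + (if f \<in> bad then real p else 0)"
    proof (cases "f \<in> bad")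
      case True
      have "norm (\<Sum>x<p. \<Prod>i<2*r. g i x (f i)) \<le> (\<Sum>x<p. 1)"
      proof (rule sum_norm_le)
        fix x
        have "norm (g i x (f i)) \<le> 1" for i
          using norm_dirichlet_character_le[OF p(1) \<chi>(1)] by (simp add: g_def)
        then show "norm (\<Prod>i<2*r. g i x (f i)) \<le> 1"
          unfolding prod_norm[symmetric] by (intro prod_le_1) auto
      qed
      then show ?thesis using True by (simp add: add_increasing)
    next
      case False
      then obtain i0 where i0: "i0 < 2 * r" "\<And>j. j < 2 * r \<Longrightarrow> j \<noteq> i0 \<Longrightarrow> f j \<noteq> f i0"
        using f by (auto simp: bad_def)
      have "norm (\<Sum>x<p. \<Prod>i<2*r. g i x (f i)) \<le> 2 * real r * sqrt (real p)" unfolding g_def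
      proof (rule complete_sum_bound[OF p \<chi> _ i0(1)])
        show "f i < p" if "i < 2 * r" for i using f that I by (auto simp: F_def)
      qed (use i0 in auto)
      then show ?thesis using False by simp
    qed
  qed
  also have "\<dots> = real (card F) * (2 * real r * sqrt (real p)) + real (card bad) * real p"
  proof -
    have "(\<Sum>f\<in>F. if f \<in> bad then real p else 0) = (\<Sum>f\<in>{f\<in>F. f \<in> bad}. real p)"
      using finF by (rule sum.inter_filter[symmetric])
    also have "{f\<in>F. f \<in> bad} = bad" by (auto simp: bad_def)
    finally show ?thesis by (simp add: sum.distrib)
  qed
  also have "\<dots> \<le> real (card I ^ (2 * r)) * (2 * real r * sqrt (real p)) + real (card I ^ r * r ^ (2 * r)) * real p"
  proof (intro add_mono mult_right_mono)
    have "card F = card I ^ (2 * r)" by (simp add: F_def card_PiE)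
    then show "real (card F) \<le> real (card I ^ (2 * r))" by simp
    show "real (card bad) \<le> real (card I ^ r * r ^ (2 * r))"
      using card_paired_functions[OF finI r] unfolding bad_def F_def of_nat_le_iff .
  qed auto
  finally show ?thesis by (simp add: algebra_simps)
qed

text \<open>A prefix of length \<open>n\<close> is a disjoint union of dyadic blocks, one for each binary digit of \<open>n\<close>.\<close>

lemma norm_prefix_le_dyadic:
  fixes a :: "nat \<Rightarrow> complex"
  assumes block: "\<And>l j. (j + 1) * 2 ^ l \<le> 2 ^ L0 \<Longrightarrow> norm (\<Sum>v\<in>{j * 2 ^ l..<(j + 1) * 2 ^ l}. a v) \<le> m l"
    and m: "\<And>l. m l \<ge> 0" and n: "n \<le> 2 ^ L0"
  shows "norm (\<Sum>v<n. a v) \<le> (\<Sum>l\<le>L0. m l)"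
proof -
  have claim: "norm (\<Sum>v\<in>{j * 2 ^ L..<j * 2 ^ L + n}. a v) \<le> (\<Sum>l<L. m l)"
    if "(j + 1) * 2 ^ L \<le> 2 ^ L0" "n < 2 ^ L" for L j n
    using that
  proof (induction L arbitrary: j n)
    case (Suc L)
    show ?case
    proof (cases "n < 2 ^ L")
      case True
      have "(2 * j + 1) * 2 ^ L \<le> 2 ^ L0" using Suc.prems(1) by (simp add: algebra_simps)
      from Suc.IH[OF this True] show ?thesis using m[of L] by (simp add: algebra_simps)
    next
      case False
      have 1: "(2 * j + 1 + 1) * 2 ^ L \<le> 2 ^ L0" using Suc.prems(1) by (simp add: algebra_simps)
      have 2: "(2 * j + 1) * 2 ^ L \<le> 2 ^ L0" using Suc.prems(1) by (simp add: algebra_simps)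
      have "n - 2 ^ L < 2 ^ L" using Suc.prems(2) False by simp
      from Suc.IH[OF 1 this] have A: "norm (\<Sum>v\<in>{(2 * j + 1) * 2 ^ L..<(2 * j + 1) * 2 ^ L + (n - 2 ^ L)}. a v) \<le> (\<Sum>l<L. m l)" .
      have B: "norm (\<Sum>v\<in>{2 * j * 2 ^ L..<(2 * j + 1) * 2 ^ L}. a v) \<le> m L" using block[OF 2] .
      have "{j * 2 ^ Suc L..<j * 2 ^ Suc L + n} = {2 * j * 2 ^ L..<(2 * j + 1) * 2 ^ L} \<union> {(2 * j + 1) * 2 ^ L..<(2 * j + 1) * 2 ^ L + (n - 2 ^ L)}"
        using False by (auto simp: algebra_simps)
      then have "(\<Sum>v\<in>{j * 2 ^ Suc L..<j * 2 ^ Suc L + n}. a v) = (\<Sum>v\<in>{2 * j * 2 ^ L..<(2 * j + 1) * 2 ^ L}. a v)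
         + (\<Sum>v\<in>{(2 * j + 1) * 2 ^ L..<(2 * j + 1) * 2 ^ L + (n - 2 ^ L)}. a v)"
        by (simp only:) (rule sum.union_disjoint, auto)
      then have "norm (\<Sum>v\<in>{j * 2 ^ Suc L..<j * 2 ^ Suc L + n}. a v) \<le> m L + (\<Sum>l<L. m l)"
        using A B by (metis add_mono norm_triangle_le)
      then show ?thesis by simp
    qed
  qed simp
  show ?thesis
  proof (cases "n = 2 ^ L0")
    case True
    have "norm (\<Sum>v<n. a v) \<le> m L0" using block[of 0 L0] True by (simp add: atLeast0LessThan)
    also have "\<dots> \<le> (\<Sum>l\<le>L0. m l)" by (rule member_le_sum) (use m in auto)
    finally show ?thesis .
  next
    case False
    then have "norm (\<Sum>v<n. a v) \<le> (\<Sum>l<L0. m l)" using claim[of 0 L0 n] n by (simp add: atLeast0LessThan)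
    also have "\<dots> \<le> (\<Sum>l\<le>L0. m l)" by (rule sum_mono2) (use m in auto)
    finally show ?thesis .
  qed
qed

text \<open>By Bernoulli's inequality the graph of \<open>y ^ r\<close> lies above its tangent at
  the mean \<open>t\<close>, and the linear terms of the tangent sum to zero.\<close>

lemma sum_power_le_power_mean:
  fixes x :: "'b \<Rightarrow> real"
  assumes "finite S" "\<And>s. s \<in> S \<Longrightarrow> x s \<ge> 0" "r \<ge> 1"
  shows "(\<Sum>s\<in>S. x s) ^ r \<le> real (card S) ^ (r - 1) * (\<Sum>s\<in>S. x s ^ r)"
proof (cases "(\<Sum>s\<in>S. x s) = 0")
  case True
  then show ?thesis using assms by (simp add: power_0_left sum_nonneg)
next
  case False
  define \<sigma> where "\<sigma> = (\<Sum>s\<in>S. x s)"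
  define n where "n = real (card S)"
  define t where "t = \<sigma> / n"
  have "\<sigma> > 0" using False sum_nonneg[of S x] assms(2) unfolding \<sigma>_def by force
  have "S \<noteq> {}" using False by auto
  then have n: "n > 0" using assms(1) by (simp add: n_def card_gt_0_iff)
  have t: "t > 0" using n \<open>\<sigma> > 0\<close> by (simp add: t_def)
  have bern: "t ^ r + real r * t ^ (r - 1) * (y - t) \<le> y ^ r" if "y \<ge> 0" for y
  proof -
    have "1 + real r * (y / t - 1) \<le> (1 + (y / t - 1)) ^ r"
      using that t by (intro Bernoulli_inequality) simp
    then have "t ^ r * (1 + real r * (y / t - 1)) \<le> t ^ r * (y / t) ^ r"
      using t by (intro mult_left_mono) auto
    moreover have "t ^ r * (y / t) ^ r = y ^ r" using t by (simp flip: power_mult_distrib)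
    moreover have "t ^ r = t ^ (r - 1) * t" using assms(3) by (cases r) auto
    then have "t ^ r * (1 + real r * (y / t - 1)) = t ^ r + real r * t ^ (r - 1) * (y - t)"
      using t by (simp add: field_simps)
    ultimately show ?thesis by simp
  qed
  have "(\<Sum>s\<in>S. t ^ r + real r * t ^ (r - 1) * (x s - t)) \<le> (\<Sum>s\<in>S. x s ^ r)"
    using bern assms(2) by (intro sum_mono) auto
  moreover have "(\<Sum>s\<in>S. t ^ r + real r * t ^ (r - 1) * (x s - t)) = n * t ^ r"
  proof -
    have "(\<Sum>s\<in>S. x s - t) = \<sigma> - n * t" by (simp add: sum_subtractf \<sigma>_def n_def)
    also have "\<dots> = 0" using n by (simp add: t_def)
    finally show ?thesis by (simp add: sum.distrib n_def flip: sum_distrib_left)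
  qed
  ultimately have "n ^ (r - 1) * (n * t ^ r) \<le> n ^ (r - 1) * (\<Sum>s\<in>S. x s ^ r)"
    using n by (intro mult_left_mono) auto
  moreover have "n ^ (r - 1) * (n * t ^ r) = (n * t) ^ r"
    using assms(3) by (cases r) (auto simp: power_mult_distrib)
  moreover have "n * t = \<sigma>" using n by (simp add: t_def)
  ultimately show ?thesis by (simp add: \<sigma>_def n_def)
qed

text \<open>The maximum over the dyadic blocks of one length is at most the sum of the
  \<open>2 * r\<close>-th powers over these blocks. There are at most \<open>2 ^ (L - l)\<close>
  blocks of length \<open>2 ^ l\<close>, and the bound for each of their moments is smaller than
  that for length \<open>2 ^ L\<close> by at least this factor, so every length costs the same and
  only the number \<open>L + 1\<close> of lengths is lost.\<close>

lemma maximal_moment_bound: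
  assumes p: "prime p" "p \<ge> 3" and \<chi>: "dirichlet_character p \<chi>" "\<chi> \<noteq> principal_character p"
    and L: "2 ^ L \<le> p" and r: "r \<ge> 1"
  obtains G :: "nat \<Rightarrow> real" where "\<And>x. G x \<ge> 0"
    "\<And>x n1 n2. n1 \<le> n2 \<Longrightarrow> n2 \<le> 2 ^ L \<Longrightarrow> norm (\<Sum>v\<in>{n1..<n2}. \<chi> (int x + int v)) \<le> G x"
    "(\<Sum>x<p. G x ^ (2 * r)) \<le> (2 * (real L + 1)) ^ (2 * r) * (real L + 1) *
        (2 * real r * 2 ^ (2 * r * L) * sqrt (real p) + real r ^ (2 * r) * 2 ^ (r * L) * real p)"
proof -
  define bl where "bl x l j = norm (\<Sum>v\<in>{j * 2 ^ l..<(j + 1) * 2 ^ l}. \<chi> (int x + int v))" for x l j :: nat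
  define Js where "Js l = {j. (j + 1) * 2 ^ l \<le> (2::nat) ^ L}" for l
  define m where "m x l = Max (insert 0 (bl x l ` Js l))" for x l
  \<comment> \<open>The 2 is there because an interval is the difference of two prefixes.\<close>
  define G where "G x = 2 * (\<Sum>l\<le>L. m x l)" for x
  have finJ: "finite (Js l)" for l
  proof (rule finite_subset)
    show "Js l \<subseteq> {..<2 ^ L}"
    proof
      fix j assume "j \<in> Js l"
      then have "(j + 1) * 2 ^ l \<le> (2::nat) ^ L" by (simp add: Js_def)
      moreover have "(j + 1) * 1 \<le> (j + 1) * (2::nat) ^ l" by (intro mult_le_mono) auto
      ultimately show "j \<in> {..<2 ^ L}" by simp
    qed
  qed simp
  have m0: "m x l \<ge> 0" for x l unfolding m_def using finJ by simp
  have mb: "bl x l j \<le> m x l" if "j \<in> Js l" for x l j unfolding m_def using finJ that by simp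
  have cardJ: "card (Js l) \<le> 2 ^ (L - l)" "l \<le> L \<or> Js l = {}" for l
  proof -
    show "l \<le> L \<or> Js l = {}"
    proof (rule ccontr)
      assume neg: "\<not> (l \<le> L \<or> Js l = {})"
      then obtain j where "(j + 1) * 2 ^ l \<le> (2::nat) ^ L" by (auto simp: Js_def)
      moreover have "1 * 2 ^ l \<le> (j + 1) * (2::nat) ^ l" by (intro mult_le_mono) auto
      moreover have "(2::nat) ^ L < 2 ^ l" using neg by (intro power_strict_increasing) auto
      ultimately show False by simp
    qed
    moreover have "Js l \<subseteq> {..<2 ^ (L - l)}" if "l \<le> L"
    proof
      fix j assume "j \<in> Js l"
      then have "(j + 1) * 2 ^ l \<le> 2 ^ (L - l) * (2::nat) ^ l" using that by (simp add: Js_def flip: power_add)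
      then have "j + 1 \<le> 2 ^ (L - l)" by (simp only: mult_le_cancel2) simp
      then show "j \<in> {..<2 ^ (L - l)}" by simp
    qed
    ultimately show "card (Js l) \<le> 2 ^ (L - l)" using card_mono[of "{..<2 ^ (L - l)}" "Js l"] by auto
  qed
  show thesis
  proof (rule that)
    show "G x \<ge> 0" for x unfolding G_def using m0 by (simp add: sum_nonneg)
    show "norm (\<Sum>v\<in>{n1..<n2}. \<chi> (int x + int v)) \<le> G x" if "n1 \<le> n2" "n2 \<le> 2 ^ L" for x n1 n2
    proof -
      have pre: "norm (\<Sum>v<n. \<chi> (int x + int v)) \<le> (\<Sum>l\<le>L. m x l)" if "n \<le> 2 ^ L" for n
      proof (rule norm_prefix_le_dyadic[OF _ m0 that])
        fix l j assume "(j + 1) * 2 ^ l \<le> (2::nat) ^ L"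
        then show "norm (\<Sum>v\<in>{j * 2 ^ l..<(j + 1) * 2 ^ l}. \<chi> (int x + int v)) \<le> m x l"
          using mb[of j l x] by (simp add: Js_def bl_def)
      qed
      have "(\<Sum>v\<in>{n1..<n2}. \<chi> (int x + int v)) = (\<Sum>v<n2. \<chi> (int x + int v)) - (\<Sum>v<n1. \<chi> (int x + int v))"
        using that(1) by (simp add: sum_diff_nat_ivl flip: atLeast0LessThan)
      then have "norm (\<Sum>v\<in>{n1..<n2}. \<chi> (int x + int v)) \<le> norm (\<Sum>v<n2. \<chi> (int x + int v)) + norm (\<Sum>v<n1. \<chi> (int x + int v))"
        by (simp add: norm_triangle_ineq4)
      then show ?thesis using pre[of n1] pre[of n2] that by (simp add: G_def)
    qed
    have Gx: "G x ^ (2 * r) \<le> (2 * (real L + 1)) ^ (2 * r) * (\<Sum>l\<le>L. \<Sum>j\<in>Js l. bl x l j ^ (2 * r))" for x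
    proof -
      have "(\<Sum>l\<le>L. m x l) ^ (2 * r) \<le> real (card {..L}) ^ (2 * r - 1) * (\<Sum>l\<le>L. m x l ^ (2 * r))"
        by (rule sum_power_le_power_mean) (use m0 r in auto)
      also have "\<dots> \<le> real (card {..L}) ^ (2 * r) * (\<Sum>l\<le>L. m x l ^ (2 * r))"
        by (intro mult_right_mono power_increasing sum_nonneg) auto
      also have "\<dots> \<le> real (card {..L}) ^ (2 * r) * (\<Sum>l\<le>L. \<Sum>j\<in>Js l. bl x l j ^ (2 * r))"
      proof (intro mult_left_mono sum_mono)
        fix l
        have "m x l \<in> insert 0 (bl x l ` Js l)" unfolding m_def using finJ by (intro Max_in) auto
        then show "m x l ^ (2 * r) \<le> (\<Sum>j\<in>Js l. bl x l j ^ (2 * r))"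
        proof
          assume "m x l = 0"
          then show ?thesis using r by (simp add: sum_nonneg bl_def power_0_left)
        next
          assume "m x l \<in> bl x l ` Js l"
          then obtain j where "j \<in> Js l" "m x l = bl x l j" by auto
          then show ?thesis using member_le_sum[of j "Js l" "\<lambda>j. bl x l j ^ (2 * r)"] finJ by (simp add: bl_def)
        qed
      qed simp
      finally have "2 ^ (2 * r) * (\<Sum>l\<le>L. m x l) ^ (2 * r) \<le> 2 ^ (2 * r) * (real (card {..L}) ^ (2 * r) * (\<Sum>l\<le>L. \<Sum>j\<in>Js l. bl x l j ^ (2 * r)))"
        by (intro mult_left_mono) auto
      then show ?thesis unfolding G_def power_mult_distrib by (simp add: add.commute mult.assoc)
    qed
    define R where "R = 2 * real r * 2 ^ (2 * r * L) * sqrt (real p) + real r ^ (2 * r) * 2 ^ (r * L) * real p"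
    have block: "(\<Sum>x<p. \<Sum>j\<in>Js l. bl x l j ^ (2 * r)) \<le> R" for l
    proof (cases "l \<le> L")
      case False
      then have "Js l = {}" using cardJ(2) by blast
      then show ?thesis by (simp add: R_def)
    next
      case True
      define T where "T = 2 * real r * 2 ^ (2 * r * l) * sqrt (real p) + real r ^ (2 * r) * 2 ^ (r * l) * real p"
      have "(\<Sum>x<p. \<Sum>j\<in>Js l. bl x l j ^ (2 * r)) = (\<Sum>j\<in>Js l. \<Sum>x<p. bl x l j ^ (2 * r))" by (rule sum.swap)
      also have "\<dots> \<le> (\<Sum>j\<in>Js l. T)"
      proof (rule sum_mono)
        fix j assume "j \<in> Js l"
        then have "(j + 1) * 2 ^ l \<le> p" using L unfolding Js_def by simp
        then have "{j * 2 ^ l..<(j + 1) * 2 ^ l} \<subseteq> {..<p}" by auto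
        from moment_bound[OF p \<chi> this r] show "(\<Sum>x<p. bl x l j ^ (2 * r)) \<le> T"
        proof -
          have c: "real (card {j * 2 ^ l..<(j + 1) * 2 ^ l}) ^ n = 2 ^ (n * l)" for n
            by (simp add: mult.commute flip: power_mult)
          assume "(\<Sum>x<p. norm (\<Sum>v\<in>{j * 2 ^ l..<(j + 1) * 2 ^ l}. \<chi> (int x + int v)) ^ (2 * r))
            \<le> 2 * real r * real (card {j * 2 ^ l..<(j + 1) * 2 ^ l}) ^ (2 * r) * sqrt (real p)
              + real r ^ (2 * r) * real (card {j * 2 ^ l..<(j + 1) * 2 ^ l}) ^ r * real p"
          then show ?thesis unfolding c bl_def T_def .
        qed
      qed
      also have "\<dots> = real (card (Js l)) * T" by simp
      also have "\<dots> \<le> 2 ^ (L - l) * T"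
      proof (rule mult_right_mono)
        show "real (card (Js l)) \<le> 2 ^ (L - l)" using cardJ(1)[of l] by (metis of_nat_le_iff of_nat_numeral of_nat_power)
      qed (simp add: T_def)
      also have "\<dots> = 2 * real r * (2 ^ (L - l) * 2 ^ (2 * r * l)) * sqrt (real p) + real r ^ (2 * r) * (2 ^ (L - l) * 2 ^ (r * l)) * real p"
        by (simp add: T_def algebra_simps)
      also have "\<dots> \<le> R"
        unfolding R_def
      proof (intro add_mono mult_right_mono mult_left_mono)
        have e: "L - l + c * l \<le> c * L" if "c \<ge> 1" for c
        proof -
          have "1 * (L - l) \<le> c * (L - l)" using that by (rule mult_le_mono1)
          then have "L - l + c * l \<le> c * (L - l) + c * l" by simp
          also have "\<dots> = c * L" using True by (simp flip: distrib_left)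
          finally show ?thesis .
        qed
        show "(2::real) ^ (L - l) * 2 ^ (2 * r * l) \<le> 2 ^ (2 * r * L)"
          unfolding power_add[symmetric] using e[of "2 * r"] r by (intro power_increasing) auto
        show "(2::real) ^ (L - l) * 2 ^ (r * l) \<le> 2 ^ (r * L)"
          unfolding power_add[symmetric] using e[of r] r by (intro power_increasing) auto
      qed auto
      finally show ?thesis .
    qed
    have "(\<Sum>x<p. G x ^ (2 * r)) \<le> (\<Sum>x<p. (2 * (real L + 1)) ^ (2 * r) * (\<Sum>l\<le>L. \<Sum>j\<in>Js l. bl x l j ^ (2 * r)))"
      by (intro sum_mono Gx)
    also have "\<dots> = (2 * (real L + 1)) ^ (2 * r) * (\<Sum>x<p. \<Sum>l\<le>L. \<Sum>j\<in>Js l. bl x l j ^ (2 * r))"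
      by (simp only: sum_distrib_left)
    also have "(\<Sum>x<p. \<Sum>l\<le>L. \<Sum>j\<in>Js l. bl x l j ^ (2 * r)) = (\<Sum>l\<le>L. \<Sum>x<p. \<Sum>j\<in>Js l. bl x l j ^ (2 * r))"
      by (rule sum.swap)
    also have "(2 * (real L + 1)) ^ (2 * r) * \<dots> \<le> (2 * (real L + 1)) ^ (2 * r) * (\<Sum>l\<le>L. R)"
      by (intro mult_left_mono sum_mono block) auto
    finally show "(\<Sum>x<p. G x ^ (2 * r)) \<le> (2 * (real L + 1)) ^ (2 * r) * (real L + 1) *
        (2 * real r * 2 ^ (2 * r * L) * sqrt (real p) + real r ^ (2 * r) * 2 ^ (r * L) * real p)"
      by (simp add: R_def algebra_simps)
  qed
qed

section \<open>Counting the congruence\<close>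

lemma card_congruent_le:
  fixes S :: "int set" and q :: int
  assumes "S \<subseteq> {lo..hi}" "q \<ge> 1" "\<And>s s'. s \<in> S \<Longrightarrow> s' \<in> S \<Longrightarrow> q dvd s - s'" "lo \<le> hi"
  shows "real (card S) \<le> real_of_int (hi - lo) / real_of_int q + 1"
proof -
  have inj: "inj_on (\<lambda>s. (s - lo) div q) S"
  proof (rule inj_onI)
    fix s s' assume s: "s \<in> S" "s' \<in> S" "(s - lo) div q = (s' - lo) div q"
    have "q dvd (s - lo) - (s' - lo)" using assms(3)[OF s(1,2)] by simp
    then have "(s - lo) mod q = (s' - lo) mod q" by (simp add: mod_eq_dvd_iff)
    then show "s = s'" using s(3) by (metis add_diff_cancel_right' diff_add_cancel mult_div_mod_eq)
  qed
  have "(\<lambda>s. (s - lo) div q) ` S \<subseteq> {0..(hi - lo) div q}"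
  proof clarify
    fix s assume "s \<in> S"
    then have "lo \<le> s" "s \<le> hi" using assms(1) by auto
    then show "(s - lo) div q \<in> {0..(hi - lo) div q}"
      using assms(2) by (simp add: pos_imp_zdiv_nonneg_iff zdiv_mono1)
  qed
  then have "card S \<le> card {0..(hi - lo) div q}" by (intro card_inj_on_le[OF inj]) auto
  moreover have "(hi - lo) div q \<ge> 0" using assms(2,4) by (simp add: pos_imp_zdiv_nonneg_iff)
  ultimately have "int (card S) \<le> (hi - lo) div q + 1" by simp
  then have "real_of_int (int (card S)) \<le> real_of_int ((hi - lo) div q + 1)" by (simp only: of_int_le_iff)
  then show ?thesis using real_of_int_div4[of "hi - lo" q] by simp
qed

definition hsum :: "nat \<Rightarrow> real" where
  "hsum Z = (\<Sum>i\<in>{1..Z}. 1 / real i)"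

lemma hsum_mono: "Z \<le> Y \<Longrightarrow> hsum Z \<le> hsum Y"
  unfolding hsum_def by (rule sum_mono2) auto

lemma hsum_nonneg: "hsum Z \<ge> 0"
  unfolding hsum_def by (rule sum_nonneg) auto

lemma hsum_le_ln: "Z \<ge> 1 \<Longrightarrow> hsum Z \<le> 1 + ln (real Z)"
proof (induction Z rule: dec_induct)
  case (step n)
  have "ln (real n / real (Suc n)) \<le> real n / real (Suc n) - 1"
    using step by (intro ln_le_minus_one) auto
  also have "\<dots> = - (1 / real (Suc n))" by (simp add: field_simps)
  finally have "1 / real (Suc n) \<le> ln (real (Suc n)) - ln (real n)" using step by (simp add: ln_div)
  then show ?case using step by (simp add: hsum_def)
qed (simp add: hsum_def)

lemma sum_inverse_multiples_le:
  assumes "q \<ge> 1"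
  shows "(\<Sum>u\<in>{u\<in>{1..U}. q dvd u}. real q / real u) \<le> hsum U"
proof -
  have inj: "inj_on (\<lambda>u. u div q) {u\<in>{1..U}. q dvd u}"
    by (rule inj_onI) (metis (no_types, lifting) dvd_mult_div_cancel mem_Collect_eq)
  have "(\<Sum>u\<in>{u\<in>{1..U}. q dvd u}. real q / real u) = (\<Sum>u\<in>{u\<in>{1..U}. q dvd u}. 1 / real (u div q))"
    using assms by (intro sum.cong refl) (auto simp: real_of_nat_div)
  also have "\<dots> = (\<Sum>w\<in>(\<lambda>u. u div q) ` {u\<in>{1..U}. q dvd u}. 1 / real w)"
    by (subst sum.reindex[OF inj]) (simp add: o_def)
  also have "\<dots> \<le> hsum U" unfolding hsum_def
  proof (rule sum_mono2)
    show "(\<lambda>u. u div q) ` {u\<in>{1..U}. q dvd u} \<subseteq> {1..U}"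
    proof clarify
      fix u assume u: "u \<in> {1..U}" "q dvd u"
      have "q \<le> u" using u by (auto intro: dvd_imp_le)
      then have "1 \<le> u div q" using assms by (simp add: Suc_le_eq div_greater_zero_iff)
      moreover have "u div q \<le> U" using u by (auto intro: order_trans[OF div_le_dividend])
      ultimately show "u div q \<in> {1..U}" by simp
    qed
  qed auto
  finally show ?thesis .
qed

text \<open>The gcd is itself one of the divisors \<open>c\<close> of \<open>b\<close> that divide
  \<open>u\<close>, so it is at most their sum; for each fixed \<open>c\<close> the sum over the
  multiples of \<open>c\<close> is harmonic.\<close>

lemma sum_gcd_div_le:
  fixes b :: int
  assumes "b \<noteq> 0" "real (card {c::nat. int c dvd b}) \<le> Db"
  shows "(\<Sum>u\<in>{1..U}. real (nat (gcd b (int u))) / real u) \<le> Db * hsum U"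
proof -
  define C where "C = {c::nat. int c dvd b}"
  have "finite C"
  proof (rule finite_subset)
    show "C \<subseteq> {..nat \<bar>b\<bar>}" using assms(1) by (auto simp: C_def dest!: dvd_imp_le_int)
  qed simp
  have C1: "c \<ge> 1" if "c \<in> C" for c using that assms(1) by (cases c) (auto simp: C_def)
  have "(\<Sum>u\<in>{1..U}. real (nat (gcd b (int u))) / real u) \<le> (\<Sum>u\<in>{1..U}. \<Sum>c\<in>C. if c dvd u then real c / real u else 0)"
  proof (rule sum_mono)
    fix u assume "u \<in> {1..U}"
    have "nat (gcd b (int u)) \<in> C" by (simp add: C_def)
    moreover have "nat (gcd b (int u)) dvd u" by (metis gcd_dvd2 gcd_ge_0_int int_dvd_int_iff nat_0_le)
    ultimately show "real (nat (gcd b (int u))) / real u \<le> (\<Sum>c\<in>C. if c dvd u then real c / real u else 0)"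
      using member_le_sum[of "nat (gcd b (int u))" C "\<lambda>c. if c dvd u then real c / real u else 0"] \<open>finite C\<close> by simp
  qed
  also have "\<dots> = (\<Sum>c\<in>C. \<Sum>u\<in>{1..U}. if c dvd u then real c / real u else 0)" by (rule sum.swap)
  also have "\<dots> \<le> (\<Sum>c\<in>C. hsum U)"
  proof (rule sum_mono)
    fix c assume c: "c \<in> C"
    have "(\<Sum>u\<in>{1..U}. if c dvd u then real c / real u else 0) = (\<Sum>u\<in>{u\<in>{1..U}. c dvd u}. real c / real u)"
      by (rule sum.inter_filter[symmetric]) simp
    then show "(\<Sum>u\<in>{1..U}. if c dvd u then real c / real u else 0) \<le> hsum U"
      using sum_inverse_multiples_le[OF C1[OF c]] by simp
  qed
  also have "\<dots> = real (card C) * hsum U" by simp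
  also have "\<dots> \<le> Db * hsum U" using assms(2) hsum_nonneg by (intro mult_right_mono) (auto simp: C_def)
  finally show ?thesis .
qed

text \<open>With \<open>x = xval a b (k, m, n, u)\<close> and \<open>y = yval (k, m, n, u)\<close> the shifted argument
  \<open>a k + b (m + u v) n\<close> is \<open>b y (x / (b y) + v)\<close> modulo \<open>p\<close>.\<close>

definition xval :: "int \<Rightarrow> int \<Rightarrow> nat \<times> int \<times> nat \<times> nat \<Rightarrow> int" where
  "xval a b = (\<lambda>(k, m, n, u). a * int k + b * m * int n)"

definition yval :: "nat \<times> int \<times> nat \<times> nat \<Rightarrow> nat" where
  "yval = (\<lambda>(k, m, n, u). u * n)"

text \<open>With \<open>n\<close> prime to \<open>a\<close>, the factor \<open>a\<close> can be
  cancelled from congruences for \<open>k\<close> modulo divisors of \<open>n\<close>. The counting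
  below rests on this.\<close>

definition nset :: "int \<Rightarrow> nat \<Rightarrow> nat set" where
  "nset a N = {n\<in>{1..N}. coprime (int n) a}"

text \<open>The range of \<open>m\<close> is symmetric because the original variable is
  \<open>m + u * v\<close>, in \<open>1..M\<close>, with
  \<open>0 \<le> u * v \<le> M\<close>.\<close>

definition quads :: "int \<Rightarrow> nat \<Rightarrow> nat \<Rightarrow> nat \<Rightarrow> nat \<Rightarrow> (nat \<times> int \<times> nat \<times> nat) set" where
  "quads a K M N U = {1..K} \<times> {- int M..int M} \<times> nset a N \<times> {1..U}"

lemma finite_quads: "finite (quads a K M N U)"
  by (simp add: quads_def nset_def)

context
  fixes a b :: int and K M N U :: nat and D Db :: real
  assumes nz: "a \<noteq> 0" "b \<noteq> 0" and pos: "K \<ge> 1" "M \<ge> 1" "N \<ge> 1" "U \<ge> 1" and UM: "U \<le> M"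
    and D: "\<And>y::nat. 1 \<le> y \<Longrightarrow> y \<le> U * N \<Longrightarrow> real (card {d. d dvd y}) \<le> D"
    and Db: "real (card {c::nat. int c dvd b}) \<le> Db"
begin

lemma card_quads_le: "real (card (quads a K M N U)) \<le> 3 * real K * real M * real N * real U"
proof -
  have "card (nset a N) \<le> card {1..N}" unfolding nset_def by (rule card_mono) auto
  moreover have "card {- int M..int M} = 2 * M + 1" by simp
  ultimately have "card (quads a K M N U) \<le> K * ((2 * M + 1) * (N * U))"
    unfolding quads_def card_cartesian_product by (intro mult_le_mono) auto
  also have "\<dots> \<le> K * ((3 * M) * (N * U))" using pos by (intro mult_le_mono) auto
  finally have "real (card (quads a K M N U)) \<le> real (K * ((3 * M) * (N * U)))" by (simp only: of_nat_le_iff)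
  then show ?thesis by (simp add: algebra_simps)
qed

lemma D_nonneg: "D \<ge> 0"
  using D[of 1] pos by (metis le_trans mult_le_mono nat_mult_1 of_nat_0_le_iff order_refl order_trans)

text \<open>Modulo \<open>n\<close> the equation reads \<open>a * k = x\<close>, which fixes the
  class of \<open>k\<close>; then \<open>m\<close> is determined by \<open>k\<close>, since
  \<open>b * n\<close> is not 0.\<close>

lemma card_solutions_le:
  assumes "n \<in> (nset a N)"
  shows "real (card {(k, m). k \<in> {1..K} \<and> m \<in> {- int M..int M} \<and> a * int k + b * m * int n = x}) \<le> real K / real n + 1"
proof -
  have n: "n \<ge> 1" "coprime (int n) a" using assms by (auto simp: nset_def)
  define S where "S = {(k, m). k \<in> {1..K} \<and> m \<in> {- int M..int M} \<and> a * int k + b * m * int n = x}"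
  have inj: "inj_on (\<lambda>(k, m). int k) S"
    using n nz by (auto simp: inj_on_def S_def)
  have "real (card ((\<lambda>(k, m). int k) ` S)) \<le> real_of_int (int K - 1) / real_of_int (int n) + 1"
  proof (rule card_congruent_le)
    show "(\<lambda>(k, m). int k) ` S \<subseteq> {1..int K}" by (auto simp: S_def)
    show "int n dvd s - s'" if ss: "s \<in> (\<lambda>(k, m). int k) ` S" "s' \<in> (\<lambda>(k, m). int k) ` S" for s s'
    proof -
      obtain k m k' m' where "s = int k" "s' = int k'"
        "a * int k + b * m * int n = x" "a * int k' + b * m' * int n = x"
        using ss by (auto simp: S_def)
      then have "a * (s - s') = int n * (b * (m' - m))" by (simp add: algebra_simps)
      then have "int n dvd a * (s - s')" by simp
      then show ?thesis using n(2) by (simp add: coprime_dvd_mult_right_iff)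
    qed
  qed (use n pos in auto)
  also have "\<dots> \<le> real K / real n + 1" by (simp add: divide_right_mono)
  finally show ?thesis unfolding S_def[symmetric] by (simp add: card_image[OF inj])
qed

text \<open>Write \<open>g = g1 * g2\<close> with \<open>g1 = gcd g n\<close>. As \<open>n\<close>
  is prime to \<open>a\<close>, \<open>g1\<close> must divide \<open>k\<close>, which saves the
  factor \<open>g1\<close>. For given \<open>k\<close>, the variable \<open>m\<close> lies in one
  class modulo \<open>g2 / gcd(b, g2)\<close>, and \<open>g2\<close> divides \<open>u\<close>; so
  what is not saved is at most \<open>gcd(b, u)\<close>.\<close>

lemma card_divisible_le:
  assumes n: "n \<in> (nset a N)" and u: "u \<in> {1..U}" and g: "g dvd u * n"
  shows "real g * real (card {(k, m). k \<in> {1..K} \<and> m \<in> {- int M..int M} \<and> int g dvd a * int k + b * m * int n})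
     \<le> 3 * real K * real M * real (nat (gcd b (int u)))"
proof -
  have n': "n \<ge> 1" "coprime (int n) a" using n by (auto simp: nset_def)
  define g1 where "g1 = gcd g n"
  define g2 where "g2 = g div g1"
  define nn where "nn = n div g1"
  have "u * n > 0" using u n' by simp
  then have g0: "g > 0" using g by (auto intro: gr0I)
  have g1: "g1 > 0" "g = g1 * g2" "n = g1 * nn" using n' by (auto simp: g1_def g2_def nn_def)
  have g2: "g2 > 0" using g0 g1 by (auto intro: gr0I)
  have cop: "coprime g2 nn" using n' unfolding g2_def nn_def g1_def by (intro div_gcd_coprime) auto
  have "g1 * g2 dvd g1 * (u * nn)" using g unfolding g1(3) by (subst (asm) g1(2)) (simp add: ac_simps)
  then have "g2 dvd u * nn" using g1 by simp
  then have g2u: "g2 dvd u" using cop by (simp add: coprime_dvd_mult_left_iff)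
  \<comment> \<open>Here \<open>U \<le> M\<close> enters: the modulus does not exceed the range of
    \<open>m\<close>, so the \<open>+ 1\<close> in counting a residue class is absorbed into
    \<open>3 * M / q\<close>.\<close>
  then have g2M: "g2 \<le> M" using u UM by (auto dest!: dvd_imp_le)
  define c where "c = gcd b (int g2)"
  have c: "c > 0" "c dvd b" "c dvd int g2" using g2 by (auto simp: c_def)
  define q where "q = int g2 div c"
  have q: "int g2 = q * c" "q \<ge> 1"
  proof -
    show *: "int g2 = q * c" using c by (simp add: q_def)
    show "q \<ge> 1" using * g2 c by (metis int_one_le_iff_zero_less mult.commute of_nat_0_less_iff zero_less_mult_pos)
  qed
  have qM: "q \<le> int M"
  proof -
    have "q * 1 \<le> q * c" using q c by (intro mult_left_mono) auto
    then show ?thesis using q g2M by linarith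
  qed
  define Ks where "Ks = {k\<in>{1..K}. g1 dvd k}"
  define Ms where "Ms k = {m\<in>{- int M..int M}. int g dvd a * int k + b * m * int n}" for k
  have "{(k, m). k \<in> {1..K} \<and> m \<in> {- int M..int M} \<and> int g dvd a * int k + b * m * int n} = Sigma Ks Ms"
  proof -
    have "g1 dvd k" if "int g dvd a * int k + b * m * int n" for k m
    proof -
      have "int g1 dvd a * int k + b * m * int n" using that by (metis g1(2) dvd_mult_left of_nat_mult)
      moreover have "int g1 dvd b * m * int n" using g1(3) by simp
      ultimately have "int g1 dvd a * int k" by (simp add: dvd_add_left_iff)
      moreover have "coprime (int g1) a" using n'(2) g1(3) by (metis coprime_mult_left_iff of_nat_mult)
      ultimately have "int g1 dvd int k" by (simp add: coprime_dvd_mult_right_iff)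
      then show ?thesis by simp
    qed
    then show ?thesis unfolding Ks_def Ms_def by blast
  qed
  then have "card {(k, m). k \<in> {1..K} \<and> m \<in> {- int M..int M} \<and> int g dvd a * int k + b * m * int n} = card (Sigma Ks Ms)"
    by (rule arg_cong)
  also have "\<dots> = (\<Sum>k\<in>Ks. card (Ms k))"
    by (rule card_SigmaI) (simp_all add: Ks_def Ms_def del: atLeastAtMost_iff)
  finally have "card {(k, m). k \<in> {1..K} \<and> m \<in> {- int M..int M} \<and> int g dvd a * int k + b * m * int n} = (\<Sum>k\<in>Ks. card (Ms k))" .
  moreover have "real (\<Sum>k\<in>Ks. card (Ms k)) \<le> (\<Sum>k\<in>Ks. 3 * real M / real_of_int q)"
    unfolding of_nat_sum
  proof (rule sum_mono)
    fix k assume "k \<in> Ks"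
    have "real (card (Ms k)) \<le> real_of_int (int M - (- int M)) / real_of_int q + 1"
    proof (rule card_congruent_le)
      show "q dvd s - s'" if "s \<in> Ms k" "s' \<in> Ms k" for s s'
      proof -
        have "int g dvd (a * int k + b * s * int n) - (a * int k + b * s' * int n)"
          using that unfolding Ms_def by (intro dvd_diff) auto
        also have "\<dots> = int g1 * (b * (s - s') * int nn)" by (simp add: g1(3) algebra_simps)
        finally have "int g2 dvd b * (s - s') * int nn" using g1 by (simp add: g1(2))
        then have "int g2 dvd b * (s - s')" using cop by (simp add: coprime_dvd_mult_left_iff)
        then have "int g2 div c dvd (b div c) * (s - s')"
          using c by (metis dvd_div_mult dvd_div_iff_mult div_mult_swap dvd_mult2 less_irrefl mult.commute mult.assoc q(1) q_def nonzero_mult_div_cancel_left dvd_mult_cancel_left dvd_mult_div_cancel)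
        moreover have "coprime (int g2 div c) (b div c)"
          unfolding c_def using g2 by (metis coprime_commute div_gcd_coprime of_nat_eq_0_iff not_less_iff_gr_or_eq)
        ultimately show ?thesis unfolding q_def by (simp add: coprime_dvd_mult_right_iff)
      qed
    qed (use q in \<open>auto simp: Ms_def\<close>)
    also have "\<dots> \<le> 3 * real M / real_of_int q"
    proof -
      have "real_of_int q \<le> real M" using qM by linarith
      then have "1 \<le> real M / real_of_int q" using q(2) by simp
      then show ?thesis by (simp add: add_divide_distrib)
    qed
    finally show "real (card (Ms k)) \<le> 3 * real M / real_of_int q" .
  qed
  moreover have "real g1 * real (card Ks) \<le> real K"
  proof -
    have "Ks \<subseteq> (\<lambda>j. g1 * j) ` {1..K div g1}"
    proof
      fix k assume k: "k \<in> Ks"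
      then obtain j where j: "k = g1 * j" by (auto simp: Ks_def elim: dvdE)
      have "j \<ge> 1" using k j by (cases j) (auto simp: Ks_def)
      moreover have "j \<le> K div g1" using k j g1 by (auto simp: Ks_def less_eq_div_iff_mult_less_eq mult.commute)
      ultimately show "k \<in> (\<lambda>j. g1 * j) ` {1..K div g1}" using j by auto
    qed
    then have "card Ks \<le> card ((\<lambda>j. g1 * j) ` {1..K div g1})" by (intro card_mono) auto
    also have "\<dots> \<le> K div g1" using card_image_le[of "{1..K div g1}" "\<lambda>j. g1 * j"] by simp
    finally have "g1 * card Ks \<le> g1 * (K div g1)" by (rule mult_le_mono2)
    also have "\<dots> \<le> K" by simp
    finally show ?thesis by (simp flip: of_nat_mult)
  qed
  ultimately have le: "real (card {(k, m). k \<in> {1..K} \<and> m \<in> {- int M..int M} \<and> int g dvd a * int k + b * m * int n})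
     \<le> real (card Ks) * (3 * real M / real_of_int q)" "real g1 * real (card Ks) \<le> real K" by simp_all
  have "real g * real (card {(k, m). k \<in> {1..K} \<and> m \<in> {- int M..int M} \<and> int g dvd a * int k + b * m * int n})
    \<le> real g * (real (card Ks) * (3 * real M / real_of_int q))" using le by (intro mult_left_mono) auto
  also have "\<dots> = (real g1 * real (card Ks)) * (3 * real M * real_of_int c)"
  proof -
    have "real g = real g1 * (real_of_int q * real_of_int c)"
      using g1(2) q(1) by (metis of_int_mult of_int_of_nat_eq of_nat_mult)
    then show ?thesis using q by (simp add: field_simps)
  qed
  also have "\<dots> \<le> real K * (3 * real M * real_of_int c)" using le(2) c by (intro mult_right_mono) auto
  also have "\<dots> \<le> real K * (3 * real M * real (nat (gcd b (int u))))"
  proof (intro mult_left_mono)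
    have "c dvd gcd b (int u)" using c g2u by (metis dvd_trans gcd_greatest int_dvd_int_iff)
    moreover have "gcd b (int u) > 0" using nz by simp
    ultimately have "c \<le> gcd b (int u)" by (rule zdvd_imp_le)
    then show "real_of_int c \<le> real (nat (gcd b (int u)))" by simp
  qed auto
  finally show ?thesis by (simp add: algebra_simps)
qed

text \<open>Replace the gcd by the sum over all \<open>g\<close> dividing both \<open>u * n\<close>
  and \<open>xval\<close>. The bound of \<open>card_divisible_le\<close> is the same for every
  \<open>g\<close>, so there are at most \<open>D\<close> equal contributions, and the weights
  \<open>1 / n\<close> and \<open>gcd(b, u) / u\<close> have harmonic sums.\<close>

lemma sum_gcd_over_quads:
  "(\<Sum>q\<in>(quads a K M N U). real (nat (gcd (xval a b q) (int (yval q)))) / real (yval q))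
     \<le> 3 * real K * real M * D * hsum N * (Db * hsum U)"
proof -
  let ?KM = "{1..K} \<times> {- int M..int M}"
  have "(\<Sum>q\<in>(quads a K M N U). real (nat (gcd (xval a b q) (int (yval q)))) / real (yval q))
     = (\<Sum>(n, u)\<in>(nset a N) \<times> {1..U}. \<Sum>(k, m)\<in>?KM. real (nat (gcd (a * int k + b * m * int n) (int (u * n)))) / real (u * n))"
    unfolding case_prod_unfold sum.cartesian_product
    by (rule sum.reindex_bij_witness[where i = "\<lambda>z. (fst (snd z), snd (snd z), fst (fst z), snd (fst z))" and j = "\<lambda>(k, m, n, u). ((n, u), (k, m))"])
      (auto simp: quads_def xval_def yval_def)
  also have "\<dots> \<le> (\<Sum>(n, u)\<in>(nset a N) \<times> {1..U}. 3 * real K * real M * D * (1 / real n * (real (nat (gcd b (int u))) / real u)))"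
  proof (rule sum_mono, clarify)
    fix n u assume n: "n \<in> (nset a N)" and u: "u \<in> {1..U}"
    have nu: "1 \<le> u * n" "u * n \<le> U * N" "n \<ge> 1" "u \<ge> 1" using n u by (auto simp: nset_def intro: mult_le_mono)
    define Dv where "Dv = {g. g dvd u * n}"
    have finDv: "finite Dv" using nu by (simp add: Dv_def)
    have "(\<Sum>(k, m)\<in>?KM. real (nat (gcd (a * int k + b * m * int n) (int (u * n)))))
      \<le> (\<Sum>(k, m)\<in>?KM. \<Sum>g\<in>Dv. if int g dvd a * int k + b * m * int n then real g else 0)"
    proof (rule sum_mono, clarify)
      fix k m
      let ?g = "nat (gcd (a * int k + b * m * int n) (int (u * n)))"
      have "int ?g dvd int (u * n)" "int ?g dvd a * int k + b * m * int n"
        by simp_all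
      moreover from this(1) have "?g \<in> Dv" unfolding Dv_def mem_Collect_eq by (simp only: of_nat_dvd_iff)
      ultimately show "real ?g \<le> (\<Sum>g\<in>Dv. if int g dvd a * int k + b * m * int n then real g else 0)"
        using member_le_sum[of ?g Dv "\<lambda>g. if int g dvd a * int k + b * m * int n then real g else 0"] finDv by simp
    qed
    also have "\<dots> = (\<Sum>g\<in>Dv. \<Sum>(k, m)\<in>?KM. if int g dvd a * int k + b * m * int n then real g else 0)"
      unfolding case_prod_unfold by (rule sum.swap)
    also have "\<dots> \<le> (\<Sum>g\<in>Dv. 3 * real K * real M * real (nat (gcd b (int u))))"
    proof (rule sum_mono)
      fix g assume "g \<in> Dv"
      have "(\<Sum>(k, m)\<in>?KM. if int g dvd a * int k + b * m * int n then real g else 0)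
        = (\<Sum>z\<in>{z\<in>?KM. int g dvd a * int (fst z) + b * snd z * int n}. real g)"
        unfolding case_prod_unfold by (rule sum.inter_filter[symmetric]) simp
      also have "{z\<in>?KM. int g dvd a * int (fst z) + b * snd z * int n}
        = {(k, m). k \<in> {1..K} \<and> m \<in> {- int M..int M} \<and> int g dvd a * int k + b * m * int n}" by auto
      finally show "(\<Sum>(k, m)\<in>?KM. if int g dvd a * int k + b * m * int n then real g else 0)
        \<le> 3 * real K * real M * real (nat (gcd b (int u)))"
        using card_divisible_le[OF n u, of g] \<open>g \<in> Dv\<close> by (simp add: Dv_def mult.commute)
    qed
    also have "\<dots> = real (card Dv) * (3 * real K * real M * real (nat (gcd b (int u))))" by simp
    also have "\<dots> \<le> D * (3 * real K * real M * real (nat (gcd b (int u))))"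
      using D[OF nu(1,2)] by (intro mult_right_mono) (auto simp: Dv_def)
    finally have "(\<Sum>(k, m)\<in>?KM. real (nat (gcd (a * int k + b * m * int n) (int (u * n))))) / real (u * n)
      \<le> D * (3 * real K * real M * real (nat (gcd b (int u)))) / real (u * n)" by (rule divide_right_mono) simp
    then show "(\<Sum>(k, m)\<in>?KM. real (nat (gcd (a * int k + b * m * int n) (int (u * n)))) / real (u * n))
      \<le> 3 * real K * real M * D * (1 / real n * (real (nat (gcd b (int u))) / real u))"
      by (simp add: sum_divide_distrib case_prod_unfold algebra_simps)
  qed
  also have "\<dots> = 3 * real K * real M * D * ((\<Sum>n\<in>(nset a N). 1 / real n) * (\<Sum>u\<in>{1..U}. real (nat (gcd b (int u))) / real u))"
    unfolding sum_product sum.cartesian_product by (simp add: sum_distrib_left case_prod_unfold)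
  also have "\<dots> \<le> 3 * real K * real M * D * (hsum N * (Db * hsum U))"
  proof (intro mult_left_mono mult_mono)
    show "(\<Sum>n\<in>(nset a N). 1 / real n) \<le> hsum N" unfolding hsum_def nset_def by (rule sum_mono2) auto
    show "(\<Sum>u\<in>{1..U}. real (nat (gcd b (int u))) / real u) \<le> Db * hsum U"
      by (rule sum_gcd_div_le[OF nz(2) Db])
  qed (auto intro!: sum_nonneg mult_nonneg_nonneg simp: hsum_nonneg D_nonneg)
  finally show ?thesis by (simp add: algebra_simps)
qed

text \<open>The equation puts \<open>y = yval q1\<close> into a class modulo
  \<open>q' = y2 / gcd(x2, y2)\<close> and then determines \<open>xval q1\<close>. For each
  \<open>y\<close> there are at most \<open>D\<close> factorisations \<open>y = u * n\<close>, and
  \<open>card_solutions_le\<close> counts the pairs \<open>(k, m)\<close>.\<close>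

lemma card_larger_solutions:
  assumes q2: "q2 \<in> (quads a K M N U)"
  shows "real (card {q1\<in>(quads a K M N U). xval a b q1 * int (yval q2) - xval a b q2 * int (yval q1) = s \<and> yval q2 \<le> yval q1})
    \<le> D * real U * (real K * hsum (U * N) + real N) * (real (nat (gcd (xval a b q2) (int (yval q2)))) / real (yval q2))"
proof -
  define x2 where "x2 = xval a b q2"
  define y2 where "y2 = yval q2"
  define g where "g = nat (gcd x2 (int y2))"
  define q' where "q' = y2 div g"
  define Z where "Z = U * N"
  have y2: "1 \<le> y2" "y2 \<le> Z" using q2 by (auto simp: quads_def nset_def y2_def yval_def Z_def intro: mult_le_mono)
  have gy: "int g = gcd x2 (int y2)" by (simp add: g_def)
  have g: "g dvd y2" "g \<ge> 1"
  proof -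
    show "g dvd y2" using gy by (metis gcd_dvd2 int_dvd_int_iff)
    then show "g \<ge> 1" using y2 by (cases g) auto
  qed
  have yq: "y2 = g * q'" "q' \<ge> 1" using g y2 by (auto simp: q'_def div_greater_zero_iff dvd_imp_le Suc_le_eq)
  define G where "G = {(n, u). n \<in> (nset a N) \<and> u \<in> {1..U} \<and> y2 \<le> u * n \<and> int y2 dvd x2 * int (u * n) + s}"
  define Y where "Y = {y\<in>{y2..Z}. int y2 dvd x2 * int y + s}"
  have finG: "finite G"
    by (rule finite_subset[of _ "(nset a N) \<times> {1..U}"]) (auto simp: G_def nset_def)
  define sol where "sol n u = {(k, m). k \<in> {1..K} \<and> m \<in> {- int M..int M} \<and> a * int k + b * m * int n = (x2 * int (u * n) + s) div int y2}" for n u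
  have finsol: "finite (sol n u)" for n u
    by (rule finite_subset[of _ "{1..K} \<times> {- int M..int M}"]) (auto simp: sol_def)
  let ?A = "{q1\<in>(quads a K M N U). xval a b q1 * int y2 - x2 * int (yval q1) = s \<and> y2 \<le> yval q1}"
  have "?A \<subseteq> (\<lambda>((n, u), (k, m)). (k, m, n, u)) ` (Sigma G (\<lambda>(n, u). sol n u))"
  proof
    fix q1 assume q1: "q1 \<in> ?A"
    obtain k m n u where q: "q1 = (k, m, n, u)" by (cases q1) auto
    have 1: "k \<in> {1..K}" "m \<in> {- int M..int M}" "n \<in> (nset a N)" "u \<in> {1..U}" using q1 by (auto simp: q quads_def)
    have 2: "(a * int k + b * m * int n) * int y2 = x2 * int (u * n) + s" "y2 \<le> u * n"
      using q1 by (auto simp: q xval_def yval_def)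
    have "int y2 dvd x2 * int (u * n) + s" using 2(1) by (metis dvd_triv_right)
    moreover have "a * int k + b * m * int n = (x2 * int (u * n) + s) div int y2"
      using y2 unfolding 2(1)[symmetric] by simp
    ultimately have "((n, u), (k, m)) \<in> Sigma G (\<lambda>(n, u). sol n u)" using 1 2 by (auto simp: G_def sol_def)
    then show "q1 \<in> (\<lambda>((n, u), (k, m)). (k, m, n, u)) ` (Sigma G (\<lambda>(n, u). sol n u))"
      unfolding q by (rule rev_image_eqI) simp
  qed
  moreover have finS: "finite (Sigma G (\<lambda>(n, u). sol n u))" using finG finsol by auto
  ultimately have "card ?A \<le> card (Sigma G (\<lambda>(n, u). sol n u))"
    by (meson card_image_le card_mono finite_imageI order_trans)
  also have "\<dots> = (\<Sum>(n, u)\<in>G. card (sol n u))"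
    using finG finsol by (subst card_SigmaI) (auto simp: case_prod_unfold)
  finally have "real (card ?A) \<le> real (\<Sum>(n, u)\<in>G. card (sol n u))" by (simp only: of_nat_le_iff)
  also have "\<dots> = (\<Sum>(n, u)\<in>G. real (card (sol n u)))" by (simp add: case_prod_unfold)
  finally have "real (card ?A) \<le> (\<Sum>(n, u)\<in>G. real (card (sol n u)))" .
  also have "\<dots> \<le> (\<Sum>(n, u)\<in>G. real K * real U / real (u * n) + 1)"
  proof (rule sum_mono, clarify)
    fix n u assume nu: "(n, u) \<in> G"
    then have n: "n \<in> (nset a N)" "u \<in> {1..U}" "n \<ge> 1" by (auto simp: G_def nset_def)
    have "real (card (sol n u)) \<le> real K / real n + 1" unfolding sol_def by (rule card_solutions_le[OF n(1)])
    \<comment> \<open>The bound has to depend on \<open>n\<close> only through the product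
      \<open>y = u * n\<close>, by which the terms are grouped next.\<close>
    also have "real K / real n = real K * real u / real (u * n)" using n by simp
    also have "\<dots> \<le> real K * real U / real (u * n)" using n by (intro divide_right_mono mult_left_mono) auto
    finally show "real (card (sol n u)) \<le> real K * real U / real (u * n) + 1" by simp
  qed
  also have "\<dots> = (\<Sum>y\<in>Y. \<Sum>(n, u)\<in>{z\<in>G. (\<lambda>(n, u). u * n) z = y}. real K * real U / real (u * n) + 1)"
  proof (rule sum.group[symmetric, OF finG])
    show "finite Y" by (simp add: Y_def)
    show "(\<lambda>(n, u). u * n) ` G \<subseteq> Y" by (auto simp: G_def Y_def Z_def nset_def intro: mult_le_mono)
  qed
  also have "\<dots> \<le> (\<Sum>y\<in>Y. D * (real K * real U / real y + 1))"
  proof (rule sum_mono)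
    fix y assume y: "y \<in> Y"
    then have y': "1 \<le> y" "y \<le> U * N" using y2 by (auto simp: Y_def Z_def)
    let ?F = "{z\<in>G. (\<lambda>(n, u). u * n) z = y}"
    have "(\<Sum>(n, u)\<in>?F. real K * real U / real (u * n) + 1) = (\<Sum>z\<in>?F. real K * real U / real y + 1)"
      by (intro sum.cong refl) auto
    also have "\<dots> = real (card ?F) * (real K * real U / real y + 1)" by simp
    also have "\<dots> \<le> D * (real K * real U / real y + 1)"
    proof (rule mult_right_mono)
      have "inj_on fst ?F" using y'(1) by (auto simp: inj_on_def)
      moreover have "fst ` ?F \<subseteq> {d. d dvd y}" by auto
      moreover have "finite {d. d dvd y}" using y'(1) by simp
      ultimately have "card ?F \<le> card {d. d dvd y}" by (rule card_inj_on_le)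
      then show "real (card ?F) \<le> D" using D[OF y'] by linarith
    qed simp
    finally show "(\<Sum>(n, u)\<in>?F. real K * real U / real (u * n) + 1) \<le> D * (real K * real U / real y + 1)" .
  qed
  also have "\<dots> = D * (real K * real U * (\<Sum>y\<in>Y. 1 / real y) + real (card Y))"
    by (simp add: sum_distrib_left sum.distrib algebra_simps)
  also have "\<dots> \<le> D * (real K * real U * (hsum Z / real q') + real Z / real q')"
  proof -
    \<comment> \<open>Elements of one residue class have distinct quotients by \<open>q'\<close>.
      These are positive because \<open>y \<ge> y2 \<ge> q'\<close>, which is why \<open>q1\<close>
      is taken to have the larger \<open>yval\<close>: otherwise a single small \<open>y\<close>
      could spoil the saving of \<open>q'\<close>.\<close>
    define j where "j y = y div q'" for y
    have injj: "inj_on j Y"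
    proof (rule inj_onI)
      fix y y' assume y: "y \<in> Y" "y' \<in> Y" "j y = j y'"
      have "int y2 dvd (x2 * int y + s) - (x2 * int y' + s)" using y by (intro dvd_diff) (auto simp: Y_def)
      then have "int y2 dvd x2 * (int y - int y')" by (simp add: algebra_simps)
      then have "int g * int q' dvd int g * ((x2 div int g) * (int y - int y'))"
        using yq(1) gy by (metis dvd_mult_div_cancel gcd_dvd1 mult.assoc of_nat_mult)
      then have "int q' dvd (x2 div int g) * (int y - int y')" using g by simp
      moreover have "coprime (int q') (x2 div int g)"
      proof -
        have "coprime (x2 div gcd x2 (int y2)) (int y2 div gcd x2 (int y2))" using y2 by (intro div_gcd_coprime) auto
        moreover have "int y2 div gcd x2 (int y2) = int q'" unfolding gy[symmetric] q'_def by (simp add: zdiv_int)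
        ultimately show ?thesis unfolding gy by (simp add: coprime_commute)
      qed
      ultimately have "int q' dvd int y - int y'" by (simp add: coprime_dvd_mult_right_iff)
      then have "int y mod int q' = int y' mod int q'" by (simp add: mod_eq_dvd_iff)
      then have "y mod q' = y' mod q'" by (metis of_nat_eq_iff zmod_int)
      then show "y = y'" using y(3) unfolding j_def by (metis mult_div_mod_eq)
    qed
    have jY: "j ` Y \<subseteq> {1..Z div q'}"
    proof
      fix i assume "i \<in> j ` Y"
      then obtain y where y: "y \<in> Y" "i = y div q'" by (auto simp: j_def)
      have "q' * 1 \<le> q' * g" using g by (intro mult_le_mono) auto
      then have "q' \<le> y2" using yq by (simp add: mult.commute)
      also have "y2 \<le> y" using y by (simp add: Y_def)
      finally have "q' \<le> y" .
      then have "y div q' \<ge> 1" using yq by (simp add: div_greater_zero_iff Suc_le_eq)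
      moreover have "y div q' \<le> Z div q'" using y by (intro div_le_mono) (simp add: Y_def)
      ultimately show "i \<in> {1..Z div q'}" using y by simp
    qed
    have "(\<Sum>y\<in>Y. 1 / real y) \<le> (\<Sum>y\<in>Y. 1 / real (j y) / real q')"
    proof (rule sum_mono)
      fix y assume y: "y \<in> Y"
      have "j y \<in> {1..Z div q'}" using jY y by blast
      then have "real (j y) * real q' > 0" using yq by simp
      moreover have "j y * q' \<le> y" by (simp add: j_def)
      then have "real (j y) * real q' \<le> real y" by (simp flip: of_nat_mult)
      ultimately have "1 / real y \<le> 1 / (real (j y) * real q')" by (intro divide_left_mono) auto
      then show "1 / real y \<le> 1 / real (j y) / real q'" by simp
    qed
    also have "\<dots> = (\<Sum>i\<in>j ` Y. 1 / real i) / real q'"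
      by (simp add: sum.reindex[OF injj] sum_divide_distrib)
    also have "\<dots> \<le> hsum Z / real q'" unfolding hsum_def
    proof (intro divide_right_mono sum_mono2)
      have "{1..Z div q'} \<subseteq> {1..Z}" using div_le_dividend[of Z q'] by auto
      then show "j ` Y \<subseteq> {1..Z}" using jY by blast
    qed auto
    finally have A: "(\<Sum>y\<in>Y. 1 / real y) \<le> hsum Z / real q'" .
    have "card Y \<le> card {1..Z div q'}" by (rule card_inj_on_le[OF injj jY]) simp
    then have "real (card Y) \<le> real (Z div q')" by simp
    also have "\<dots> \<le> real Z / real q'"
    proof -
      have "real (Z div q') * real q' \<le> real Z" by (metis div_times_less_eq_dividend of_nat_le_iff of_nat_mult)
      then show ?thesis using yq by (simp add: pos_le_divide_eq)
    qed
    finally have B: "real (card Y) \<le> real Z / real q'" .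
    show ?thesis using A B D_nonneg by (intro mult_left_mono add_mono) auto
  qed
  also have "\<dots> = D * real U * (real K * hsum Z + real N) * (1 / real q')"
    by (simp add: Z_def algebra_simps add_divide_distrib)
  also have "1 / real q' = real g / real y2" using yq g by simp
  finally show ?thesis by (simp add: x2_def y2_def g_def Z_def)
qed

lemma abs_xval_le:
  assumes "q \<in> (quads a K M N U)" shows "\<bar>xval a b q\<bar> \<le> \<bar>a\<bar> * int K + \<bar>b\<bar> * int M * int N"
proof -
  obtain k m n u where q: "q = (k, m, n, u)" by (cases q) auto
  have k: "k \<le> K" "\<bar>m\<bar> \<le> int M" "n \<le> N" using assms by (auto simp: q quads_def nset_def)
  have "\<bar>xval a b q\<bar> \<le> \<bar>a * int k\<bar> + \<bar>b * m * int n\<bar>" unfolding q xval_def by simp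
  also have "\<dots> = \<bar>a\<bar> * int k + \<bar>b\<bar> * \<bar>m\<bar> * int n" by (simp add: abs_mult)
  also have "\<dots> \<le> \<bar>a\<bar> * int K + \<bar>b\<bar> * int M * int N" using k by (intro add_mono mult_mono) auto
  finally show ?thesis .
qed

lemma yval_le: "q \<in> (quads a K M N U) \<Longrightarrow> yval q \<le> U * N"
  by (auto simp: quads_def nset_def yval_def intro: mult_le_mono)

text \<open>The difference is antisymmetric, so a factor 2 reduces to pairs with
  \<open>yval q2 \<le> yval q1\<close>. Its size is at most \<open>2 * L * U * N\<close>, so it is
  one of at most \<open>2 * T + 1\<close> multiples of \<open>p\<close>, and
  \<open>card_larger_solutions\<close> applies to each; the bound it gives is summable over
  \<open>q2\<close> by \<open>sum_gcd_over_quads\<close>.\<close>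

lemma card_congruence_pairs:
  fixes p :: nat
  assumes "p \<ge> 1"
  defines "L \<equiv> real_of_int \<bar>a\<bar> * real K + real_of_int \<bar>b\<bar> * real M * real N"
  shows "real (card {(q1, q2) \<in> (quads a K M N U) \<times> (quads a K M N U). int p dvd xval a b q1 * int (yval q2) - xval a b q2 * int (yval q1)})
    \<le> 2 * (4 * L * real U * real N / real p + 1) * (D * real U * (real K * hsum (U * N) + real N))
        * (3 * real K * real M * D * hsum N * (Db * hsum U))"
proof -
  define dd where "dd q1 q2 = xval a b q1 * int (yval q2) - xval a b q2 * int (yval q1)" for q1 q2
  define R where "R = {(q1, q2) \<in> (quads a K M N U) \<times> (quads a K M N U). int p dvd dd q1 q2}"
  define R1 where "R1 = {(q1, q2) \<in> (quads a K M N U) \<times> (quads a K M N U). int p dvd dd q1 q2 \<and> yval q2 \<le> yval q1}"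
  define LL where "LL = \<bar>a\<bar> * int K + \<bar>b\<bar> * int M * int N"
  define T where "T = (2 * LL * int (U * N)) div int p"
  define c where "c = D * real U * (real K * hsum (U * N) + real N)"
  define w where "w q = real (nat (gcd (xval a b q) (int (yval q)))) / real (yval q)" for q
  have LLL: "real_of_int LL = L" by (simp add: LL_def L_def)
  have LL0: "LL \<ge> 0" by (simp add: LL_def)
  have T0: "T \<ge> 0" unfolding T_def using LL0 assms(1) by (intro pos_imp_zdiv_nonneg_iff[THEN iffD2]) auto
  have c0: "c \<ge> 0" unfolding c_def using D_nonneg hsum_nonneg by (intro mult_nonneg_nonneg add_nonneg_nonneg) auto
  have finR: "finite ((quads a K M N U) \<times> (quads a K M N U))" using finite_quads by simp
  have dd_swap: "dd q2 q1 = - dd q1 q2" for q1 q2 by (simp add: dd_def)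
  have "R \<subseteq> R1 \<union> prod.swap ` R1"
  proof clarify
    fix q1 q2 assume q: "(q1, q2) \<in> R" "(q1, q2) \<notin> prod.swap ` R1"
    have "(q2, q1) \<notin> R1" using q(2) by (metis image_eqI swap_simp)
    then show "(q1, q2) \<in> R1" using q(1) by (auto simp: R_def R1_def dd_swap[of q2 q1])
  qed
  moreover have finR1: "finite R1" by (rule finite_subset[OF _ finR]) (auto simp: R1_def)
  ultimately have "card R \<le> card (R1 \<union> prod.swap ` R1)" by (intro card_mono) auto
  also have "\<dots> \<le> card R1 + card (prod.swap ` R1)" by (rule card_Un_le)
  also have "card (prod.swap ` R1) \<le> card R1" by (rule card_image_le[OF finR1])
  finally have R2: "real (card R) \<le> 2 * real (card R1)" by simp
  have "R1 \<subseteq> (\<Union>t\<in>{- T..T}. \<Union>q2\<in>(quads a K M N U). (\<lambda>q1. (q1, q2)) ` {q1\<in>(quads a K M N U). dd q1 q2 = int p * t \<and> yval q2 \<le> yval q1})"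
  proof clarify
    fix q1 q2 assume "(q1, q2) \<in> R1"
    then have q: "q1 \<in> (quads a K M N U)" "q2 \<in> (quads a K M N U)" "int p dvd dd q1 q2" "yval q2 \<le> yval q1" by (auto simp: R1_def)
    obtain t where t: "dd q1 q2 = int p * t" using q(3) by (elim dvdE)
    have "\<bar>dd q1 q2\<bar> \<le> \<bar>xval a b q1\<bar> * int (yval q2) + \<bar>xval a b q2\<bar> * int (yval q1)"
      unfolding dd_def using abs_triangle_ineq4[of "xval a b q1 * int (yval q2)" "xval a b q2 * int (yval q1)"] by (simp add: abs_mult)
    also have "\<dots> \<le> LL * int (U * N) + LL * int (U * N)"
    proof (intro add_mono mult_mono)
      show "int (yval q2) \<le> int (U * N)" "int (yval q1) \<le> int (U * N)"
        using yval_le q by (metis of_nat_le_iff)+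
    qed (use abs_xval_le q LL0 in \<open>auto simp: LL_def\<close>)
    finally have "int p * \<bar>t\<bar> \<le> 2 * LL * int (U * N)" unfolding t by (simp add: abs_mult algebra_simps)
    then have "\<bar>t\<bar> \<le> T" 
    proof -
      assume "int p * \<bar>t\<bar> \<le> 2 * LL * int (U * N)"
      then have "(int p * \<bar>t\<bar>) div int p \<le> T" unfolding T_def using assms(1) by (intro zdiv_mono1) auto
      then show ?thesis using assms(1) by simp
    qed
    then have "t \<in> {- T..T}" by auto
    then show "(q1, q2) \<in> (\<Union>t\<in>{- T..T}. \<Union>q2\<in>(quads a K M N U). (\<lambda>q1. (q1, q2)) ` {q1\<in>(quads a K M N U). dd q1 q2 = int p * t \<and> yval q2 \<le> yval q1})"
      using q t by blast
  qed
  then have "card R1 \<le> card (\<Union>t\<in>{- T..T}. \<Union>q2\<in>(quads a K M N U). (\<lambda>q1. (q1, q2)) ` {q1\<in>(quads a K M N U). dd q1 q2 = int p * t \<and> yval q2 \<le> yval q1})"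
    using finite_quads by (intro card_mono) auto
  also have "\<dots> \<le> (\<Sum>t\<in>{- T..T}. card (\<Union>q2\<in>(quads a K M N U). (\<lambda>q1. (q1, q2)) ` {q1\<in>(quads a K M N U). dd q1 q2 = int p * t \<and> yval q2 \<le> yval q1}))"
    by (rule card_UN_le) simp
  also have "\<dots> \<le> (\<Sum>t\<in>{- T..T}. \<Sum>q2\<in>(quads a K M N U). card ((\<lambda>q1. (q1, q2)) ` {q1\<in>(quads a K M N U). dd q1 q2 = int p * t \<and> yval q2 \<le> yval q1}))"
    by (intro sum_mono card_UN_le finite_quads)
  also have "\<dots> \<le> (\<Sum>t\<in>{- T..T}. \<Sum>q2\<in>(quads a K M N U). card {q1\<in>(quads a K M N U). dd q1 q2 = int p * t \<and> yval q2 \<le> yval q1})"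
    using finite_quads by (intro sum_mono card_image_le) auto
  finally have "real (card R1) \<le> real (\<Sum>t\<in>{- T..T}. \<Sum>q2\<in>(quads a K M N U). card {q1\<in>(quads a K M N U). dd q1 q2 = int p * t \<and> yval q2 \<le> yval q1})"
    by (simp only: of_nat_le_iff)
  also have "\<dots> = (\<Sum>t\<in>{- T..T}. \<Sum>q2\<in>(quads a K M N U). real (card {q1\<in>(quads a K M N U). dd q1 q2 = int p * t \<and> yval q2 \<le> yval q1}))"
    by (simp only: of_nat_sum)
  also have "\<dots> \<le> (\<Sum>t\<in>{- T..T}. \<Sum>q2\<in>(quads a K M N U). c * w q2)"
    unfolding dd_def c_def w_def by (intro sum_mono card_larger_solutions)
  also have "\<dots> = real_of_int (2 * T + 1) * (c * (\<Sum>q2\<in>(quads a K M N U). w q2))"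
    using T0 by (simp add: sum_distrib_left)
  also have "\<dots> \<le> (4 * L * real U * real N / real p + 1) * (c * (3 * real K * real M * D * hsum N * (Db * hsum U)))"
  proof (rule mult_mono)
    have "real_of_int T \<le> real_of_int (2 * LL * int (U * N)) / real_of_int (int p)"
      unfolding T_def by (rule real_of_int_div4)
    then show "real_of_int (2 * T + 1) \<le> 4 * L * real U * real N / real p + 1"
    proof -
      assume "real_of_int T \<le> real_of_int (2 * LL * int (U * N)) / real_of_int (int p)"
      moreover have "2 * (real_of_int (2 * LL * int (U * N)) / real_of_int (int p)) = 4 * L * real U * real N / real p"
        unfolding LLL[symmetric] by simp
      moreover have "real_of_int (2 * T + 1) = 2 * real_of_int T + 1" by simp
      ultimately show ?thesis by linarith
    qed
    show "c * (\<Sum>q2\<in>(quads a K M N U). w q2) \<le> c * (3 * real K * real M * D * hsum N * (Db * hsum U))"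
      unfolding w_def by (intro mult_left_mono sum_gcd_over_quads c0)
    show "0 \<le> 4 * L * real U * real N / real p + 1" by (simp add: L_def)
    show "0 \<le> c * (\<Sum>q2\<in>(quads a K M N U). w q2)" using c0 by (intro mult_nonneg_nonneg sum_nonneg) (auto simp: w_def)
  qed
  finally have "real (card R) \<le> 2 * ((4 * L * real U * real N / real p + 1) * (c * (3 * real K * real M * D * hsum N * (Db * hsum U))))"
    using R2 by linarith
  then show ?thesis unfolding R_def dd_def c_def by (simp only: mult.assoc)
qed

end

section \<open>The divisor bound\<close>

lemma card_divisors_prime_power_mult_le:
  fixes p e m :: nat
  assumes "prime p" "m \<ge> 1"
  shows "card {d. d dvd p ^ e * m} \<le> (e + 1) * card {d. d dvd m}"
proof -
  have fin: "finite ({..e} \<times> {d. d dvd m})" using assms(2) by simp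
  have "{d. d dvd p ^ e * m} \<subseteq> (\<lambda>(i, d). p ^ i * d) ` ({..e} \<times> {d. d dvd m})"
  proof clarify
    fix d assume "d dvd p ^ e * m"
    then obtain x y where xy: "d = x * y" "x dvd p ^ e" "y dvd m" by (rule dvd_productE)
    then obtain i where "i \<le> e" "x = p ^ i" using assms(1) by (auto simp: divides_primepow_nat)
    then show "d \<in> (\<lambda>(i, d). p ^ i * d) ` ({..e} \<times> {d. d dvd m})"
      using xy by (intro rev_image_eqI[of "(i, y)"]) auto
  qed
  then have "card {d. d dvd p ^ e * m} \<le> card ((\<lambda>(i, d). p ^ i * d) ` ({..e} \<times> {d. d dvd m}))"
    using fin by (intro card_mono) auto
  also have "\<dots> \<le> card ({..e} \<times> {d. d dvd m})" by (rule card_image_le[OF fin])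
  finally show ?thesis by (simp add: card_cartesian_product)
qed

text \<open>The quotient of the divisor function by \<open>n powr \<epsilon>\<close> is bounded by a
  product of factors \<open>(e + 1) / p powr (\<epsilon> * e)\<close>. Such a factor is at most 1
  once \<open>p powr \<epsilon> \<ge> 2\<close>, that is for \<open>p \<ge> P0\<close>, and at most
  \<open>C1\<close> for the finitely many smaller primes.\<close>

lemma divisor_bound:
  fixes \<epsilon> :: real
  assumes "\<epsilon> > 0"
  obtains C where "C \<ge> 1" "\<And>n::nat. n \<ge> 1 \<Longrightarrow> real (card {d. d dvd n}) \<le> C * real n powr \<epsilon>"
proof -
  define P0 where "P0 = nat \<lceil>2 powr (1 / \<epsilon>)\<rceil>"
  \<comment> \<open>Chosen so that \<open>e + 1 \<le> C1 * (1 + \<epsilon> * e * ln 2)\<close> for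
    every \<open>e\<close>; the right side is at most
    \<open>C1 * 2 powr (\<epsilon> * e)\<close>.\<close>
  define C1 where "C1 = 1 + 1 / (\<epsilon> * ln 2)"
  have C1: "C1 \<ge> 1" using assms by (simp add: C1_def)
  have large: "real (e + 1) \<le> real p powr (\<epsilon> * real e)" if "p \<ge> P0" for p e :: nat
  proof -
    have "2 powr (1 / \<epsilon>) \<le> real p" using that by (simp add: P0_def nat_le_iff ceiling_le_iff)
    then have "(2 powr (1 / \<epsilon>)) powr \<epsilon> \<le> real p powr \<epsilon>" using assms by (intro powr_mono2) auto
    then have "2 \<le> real p powr \<epsilon>" using assms by (simp add: powr_powr)
    then have "2 ^ e \<le> (real p powr \<epsilon>) ^ e" by (intro power_mono) auto
    also have "(real p powr \<epsilon>) ^ e = real p powr (\<epsilon> * real e)" 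
    proof -
      have "0 < real p powr \<epsilon>" using \<open>2 \<le> real p powr \<epsilon>\<close> by linarith
      from powr_realpow[OF this, of e] show ?thesis by (simp add: powr_powr)
    qed
    finally have "2 ^ e \<le> real p powr (\<epsilon> * real e)" .
    moreover have "e < 2 ^ e" by (rule less_exp)
    then have "Suc e \<le> 2 ^ e" by (rule Suc_leI)
    then have "real (Suc e) \<le> 2 ^ e" by (metis of_nat_le_iff of_nat_numeral of_nat_power)
    ultimately show ?thesis by simp
  qed
  have small: "real (e + 1) \<le> C1 * real p powr (\<epsilon> * real e)" if "p \<ge> 2" for p e :: nat
  proof -
    have "real (e + 1) \<le> C1 * (1 + \<epsilon> * real e * ln 2)" using assms by (simp add: C1_def field_simps)
    also have "\<dots> \<le> C1 * exp (\<epsilon> * real e * ln 2)" using C1 by (intro mult_left_mono exp_ge_add_one_self) auto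
    also have "\<epsilon> * real e * ln 2 \<le> \<epsilon> * real e * ln (real p)" using assms that by (intro mult_left_mono) auto
    also have "exp (\<epsilon> * real e * ln (real p)) = real p powr (\<epsilon> * real e)" using that by (simp add: powr_def)
    finally show ?thesis using C1 by (simp add: mult_left_mono)
  qed
  define \<omega> where "\<omega> n = card {p. prime p \<and> p < P0 \<and> p dvd n}" for n :: nat
  have fin: "finite {p. prime p \<and> p < P0 \<and> p dvd n}" for n :: nat
    by (rule finite_subset[of _ "{..<P0}"]) auto
  have claim: "real (card {d. d dvd n}) \<le> C1 ^ \<omega> n * real n powr \<epsilon>" if "n \<ge> 1" for n
    using that
  proof (induction n rule: less_induct)
    case (less n)
    show ?case
    proof (cases "n = 1")
      case True
      have "C1 ^ \<omega> 1 \<ge> 1" using C1 by (rule one_le_power)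
      then show ?thesis using True by simp
    next
      case False
      then obtain p where p: "prime p" "p dvd n" using prime_factor_nat by blast
      define e where "e = multiplicity p n"
      have np: "n \<noteq> 0" "\<not> is_unit p" using less.prems p(1) by auto
      obtain m where m: "n = p ^ e * m" "\<not> p dvd m"
        using multiplicity_decompose'[OF np] by (auto simp: e_def)
      have "p \<ge> 2" using p(1) by (rule prime_ge_2_nat)
      have m1: "m \<ge> 1" using m np by (cases m) auto
      have "e \<ge> 1" using m p by (cases e) auto
      have "m < n"
      proof -
        have "p ^ 1 \<le> p ^ e" using \<open>e \<ge> 1\<close> \<open>p \<ge> 2\<close> by (intro power_increasing) auto
        then have "1 < p ^ e" using \<open>p \<ge> 2\<close> by simp
        then show ?thesis using m(1) m1 by simp
      qed
      have IH: "real (card {d. d dvd m}) \<le> C1 ^ \<omega> m * real m powr \<epsilon>" by (rule less.IH[OF \<open>m < n\<close> m1])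
      have step: "C1 ^ \<omega> m * real (e + 1) \<le> C1 ^ \<omega> n * real p powr (\<epsilon> * real e)"
      proof (cases "p < P0")
        case True
        have "{q. prime q \<and> q < P0 \<and> q dvd n} \<supseteq> insert p {q. prime q \<and> q < P0 \<and> q dvd m}"
          using p True m by auto
        then have "card (insert p {q. prime q \<and> q < P0 \<and> q dvd m}) \<le> \<omega> n"
          unfolding \<omega>_def by (intro card_mono fin) auto
        then have "Suc (\<omega> m) \<le> \<omega> n" using m(2) fin by (simp add: \<omega>_def)
        then have "C1 ^ Suc (\<omega> m) \<le> C1 ^ \<omega> n" using C1 by (intro power_increasing) auto
        have "C1 ^ \<omega> m * real (e + 1) \<le> C1 ^ \<omega> m * (C1 * real p powr (\<epsilon> * real e))"
          using small[OF \<open>p \<ge> 2\<close>] C1 by (intro mult_left_mono) auto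
        also have "\<dots> = C1 ^ Suc (\<omega> m) * real p powr (\<epsilon> * real e)" by simp
        also have "\<dots> \<le> C1 ^ \<omega> n * real p powr (\<epsilon> * real e)" by (intro mult_right_mono) (fact, simp)
        finally show ?thesis .
      next
        case False
        have "\<omega> m \<le> \<omega> n" unfolding \<omega>_def using m by (intro card_mono fin) auto
        then have "C1 ^ \<omega> m \<le> C1 ^ \<omega> n" using C1 by (intro power_increasing) auto
        then show ?thesis using large[of p e] False C1 by (intro mult_mono) auto
      qed
      have "real (card {d. d dvd n}) \<le> real ((e + 1) * card {d. d dvd m})"
        unfolding of_nat_le_iff m(1) by (rule card_divisors_prime_power_mult_le[OF p(1) m1])
      also have "\<dots> \<le> real (e + 1) * (C1 ^ \<omega> m * real m powr \<epsilon>)"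
        unfolding of_nat_mult using IH by (rule mult_left_mono) simp
      also have "\<dots> = (C1 ^ \<omega> m * real (e + 1)) * real m powr \<epsilon>" by simp
      also have "\<dots> \<le> (C1 ^ \<omega> n * real p powr (\<epsilon> * real e)) * real m powr \<epsilon>"
        using step by (rule mult_right_mono) simp
      also have "\<dots> = C1 ^ \<omega> n * real n powr \<epsilon>"
      proof -
        have "real n powr \<epsilon> = (real p ^ e) powr \<epsilon> * real m powr \<epsilon>" by (simp add: m(1) powr_mult)
        also have "(real p ^ e) powr \<epsilon> = real p powr (\<epsilon> * real e)"
          using \<open>p \<ge> 2\<close> by (simp add: powr_powr mult.commute flip: powr_realpow)
        finally show ?thesis by simp
      qed
      finally show ?thesis .
    qed
  qed
  have \<omega>: "\<omega> n \<le> P0" for n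
  proof -
    have "\<omega> n \<le> card {..<P0}" unfolding \<omega>_def by (rule card_mono) auto
    then show ?thesis by simp
  qed
  show thesis
  proof (rule that[of "C1 ^ P0"])
    show "C1 ^ P0 \<ge> 1" using C1 by (rule one_le_power)
    show "real (card {d. d dvd n}) \<le> C1 ^ P0 * real n powr \<epsilon>" if "n \<ge> 1" for n
    proof -
      have "C1 ^ \<omega> n \<le> C1 ^ P0" using \<omega> C1 by (intro power_increasing) auto
      then have "C1 ^ \<omega> n * real n powr \<epsilon> \<le> C1 ^ P0 * real n powr \<epsilon>" by (rule mult_right_mono) simp
      then show ?thesis using claim[OF that] by linarith
    qed
  qed
qed

section \<open>Shifting by products\<close>

text \<open>Power means pass from the sum of \<open>G (\<mu> q)\<close> to that of its
  \<open>r\<close>-th powers, and Cauchy's inequality separates the multiplicities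
  \<open>\<nu>\<close> from \<open>G\<close>. The second moment of \<open>\<nu>\<close> is the
  number of pairs with the same \<open>\<mu>\<close>.\<close>

lemma holder_multiplicity:
  fixes G :: "'c \<Rightarrow> real" and \<mu> :: "'b \<Rightarrow> 'c"
  assumes "finite Q" "finite P" "\<And>q. q \<in> Q \<Longrightarrow> \<mu> q \<in> P" "\<And>x. G x \<ge> 0" "r \<ge> 1"
  shows "(\<Sum>q\<in>Q. G (\<mu> q)) ^ (2 * r)
     \<le> real (card Q) ^ (2 * (r - 1)) * real (card {(q1, q2) \<in> Q \<times> Q. \<mu> q1 = \<mu> q2}) * (\<Sum>x\<in>P. G x ^ (2 * r))"
proof -
  define \<nu> where "\<nu> x = real (card {q\<in>Q. \<mu> q = x})" for x
  have "(\<Sum>q\<in>Q. G (\<mu> q) ^ r) = (\<Sum>x\<in>P. \<Sum>q\<in>{q\<in>Q. \<mu> q = x}. G (\<mu> q) ^ r)"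
    by (rule sum.group[symmetric]) (use assms in auto)
  also have "\<dots> = (\<Sum>x\<in>P. \<nu> x * G x ^ r)" unfolding \<nu>_def by (intro sum.cong refl) simp
  finally have 1: "(\<Sum>q\<in>Q. G (\<mu> q) ^ r) = (\<Sum>x\<in>P. \<nu> x * G x ^ r)" .
  have "(\<Sum>x\<in>P. \<nu> x * G x ^ r)\<^sup>2 \<le> (\<Sum>x\<in>P. (\<nu> x)\<^sup>2) * (\<Sum>x\<in>P. (G x ^ r)\<^sup>2)"
    by (rule Cauchy_Schwarz_ineq_sum)
  also have "(\<Sum>x\<in>P. (\<nu> x)\<^sup>2) = real (card {(q1, q2) \<in> Q \<times> Q. \<mu> q1 = \<mu> q2})"
  proof -
    have "{(q1, q2) \<in> Q \<times> Q. \<mu> q1 = \<mu> q2} = (\<Union>x\<in>P. {q\<in>Q. \<mu> q = x} \<times> {q\<in>Q. \<mu> q = x})"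
      using assms(3) by auto
    then have "card {(q1, q2) \<in> Q \<times> Q. \<mu> q1 = \<mu> q2} = (\<Sum>x\<in>P. card ({q\<in>Q. \<mu> q = x} \<times> {q\<in>Q. \<mu> q = x}))"
      using assms(1,2) by (simp only:) (rule card_UN_disjoint, auto)
    then show ?thesis by (simp add: \<nu>_def card_cartesian_product power2_eq_square)
  qed
  finally have 2: "(\<Sum>q\<in>Q. G (\<mu> q) ^ r)\<^sup>2 \<le> real (card {(q1, q2) \<in> Q \<times> Q. \<mu> q1 = \<mu> q2}) * (\<Sum>x\<in>P. G x ^ (2 * r))"
    unfolding 1 by (simp add: power_mult[symmetric] mult.commute)
  have "(\<Sum>q\<in>Q. G (\<mu> q)) ^ r \<le> real (card Q) ^ (r - 1) * (\<Sum>q\<in>Q. G (\<mu> q) ^ r)"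
    by (rule sum_power_le_power_mean) (use assms in auto)
  then have "((\<Sum>q\<in>Q. G (\<mu> q)) ^ r)\<^sup>2 \<le> (real (card Q) ^ (r - 1) * (\<Sum>q\<in>Q. G (\<mu> q) ^ r))\<^sup>2"
    using assms(4) by (intro power_mono) (auto intro: sum_nonneg zero_le_power)
  also have "\<dots> = real (card Q) ^ (2 * (r - 1)) * (\<Sum>q\<in>Q. G (\<mu> q) ^ r)\<^sup>2"
    by (simp add: power_mult_distrib mult.commute flip: power_mult)
  also have "\<dots> \<le> real (card Q) ^ (2 * (r - 1)) * (real (card {(q1, q2) \<in> Q \<times> Q. \<mu> q1 = \<mu> q2}) * (\<Sum>x\<in>P. G x ^ (2 * r)))"
    using 2 by (rule mult_left_mono) simp
  finally show ?thesis by (simp add: mult.assoc mult.commute[of r] flip: power_mult)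
qed

lemma convex_nat_set_interval:
  fixes S :: "nat set"
  assumes "S \<subseteq> {..<V}" "\<And>x y z. x \<in> S \<Longrightarrow> z \<in> S \<Longrightarrow> x \<le> y \<Longrightarrow> y \<le> z \<Longrightarrow> y \<in> S"
  obtains n1 n2 where "n1 \<le> n2" "n2 \<le> V" "S = {n1..<n2}"
proof (cases "S = {}")
  case True
  then show ?thesis using that[of 0 0] by simp
next
  case False
  have fin: "finite S" using assms(1) finite_subset by blast
  have "Min S \<in> S" "Max S \<in> S" using fin False by auto
  have "S = {Min S..<Suc (Max S)}"
  proof
    show "S \<subseteq> {Min S..<Suc (Max S)}" using fin by (auto simp: less_Suc_eq_le)
    show "{Min S..<Suc (Max S)} \<subseteq> S"
      using assms(2)[OF \<open>Min S \<in> S\<close> \<open>Max S \<in> S\<close>] by (auto simp: less_Suc_eq_le)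
  qed
  moreover have "Min S \<le> Suc (Max S)" using fin False by (simp add: le_SucI)
  moreover have "Suc (Max S) \<le> V" using \<open>Max S \<in> S\<close> assms(1) by auto
  ultimately show ?thesis using that by blast
qed

lemma shifted_sum_bound:
  fixes \<beta> :: "nat \<Rightarrow> nat \<Rightarrow> complex" and K M N U V :: nat and a b :: int
  assumes p: "prime p" and \<chi>: "dirichlet_character p \<chi>"
    and b: "coprime b (int p)" and UV: "4 * (U * V) \<le> M" "U \<ge> 1" "V \<ge> 1" and lt: "M < p" "N < p"
    and G: "\<And>x n1 n2. n1 \<le> n2 \<Longrightarrow> n2 \<le> V \<Longrightarrow> norm (\<Sum>v\<in>{n1..<n2}. \<chi> (int x + int v)) \<le> G x"
    and \<beta>: "\<And>k n. k \<in> {1..K} \<Longrightarrow> n \<in> nset a N \<Longrightarrow> norm (\<beta> k n) \<le> W" and W: "W \<ge> 0"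
  obtains \<mu> where "\<And>q. q \<in> quads a K M N U \<Longrightarrow> \<mu> q < p"
    "\<And>q. q \<in> quads a K M N U \<Longrightarrow> [b * int (yval q) * int (\<mu> q) = xval a b q] (mod int p)"
    "real (U * V) * norm (\<Sum>k\<in>{1..K}. \<Sum>m\<in>{1..M}. \<Sum>n\<in>nset a N. \<beta> k n * \<chi> (a * int k + b * int m * int n))
       \<le> W * (\<Sum>q\<in>quads a K M N U. G (\<mu> q))"
proof -
  have p0: "int p > 0" using p prime_gt_0_nat by simp
  have UM: "U \<le> M"
  proof -
    have "U * 1 \<le> U * V" using UV(3) by (rule mult_le_mono2)
    then show ?thesis using UV(1) by linarith
  qed
  have cop: "coprime (b * int u * int n) (int p)" if "u \<in> {1..U}" "n \<in> nset a N" for u n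
  proof -
    have "\<not> p dvd u" "\<not> p dvd n" using that lt UM by (auto simp: nset_def dest!: dvd_imp_le)
    then have "coprime p u" "coprime p n" using p by (auto intro: prime_imp_coprime)
    then have "coprime (int u) (int p)" "coprime (int n) (int p)" by (simp_all add: coprime_commute)
    then show ?thesis using b by simp
  qed
  have "\<exists>l. l < p \<and> [b * int u * int n * int l = x] (mod int p)" if un: "u \<in> {1..U}" "n \<in> nset a N" for u n x
  proof -
    obtain c where c: "[b * int u * int n * c = 1] (mod int p)"
      using cong_solve_coprime_int[OF cop[OF un]] by blast
    define l where "l = nat ((c * x) mod int p)"
    have l: "int l = (c * x) mod int p" "l < p" using p0 by (auto simp: l_def nat_less_iff)
    have "[b * int u * int n * int l = b * int u * int n * (c * x)] (mod int p)"
      unfolding l(1) by (intro cong_mult cong_refl) (simp add: Cong.cong_def)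
    also have "[b * int u * int n * (c * x) = 1 * x] (mod int p)"
      using cong_mult[OF c cong_refl, of x] by (simp add: mult.assoc)
    finally show ?thesis using l(2) by auto
  qed
  \<comment> \<open>\<open>l u n x\<close> represents \<open>x / (b * u * n)\<close> modulo
    \<open>p\<close>; the denominator is invertible because \<open>u\<close> and \<open>n\<close>
    are positive and below \<open>p\<close>.\<close>
  then obtain l where l: "\<And>u n x. u \<in> {1..U} \<Longrightarrow> n \<in> nset a N \<Longrightarrow> l u n x < p \<and> [b * int u * int n * int (l u n x) = x] (mod int p)"
    by metis
  define \<mu> where "\<mu> = (\<lambda>(k, m, n, u). l u n (a * int k + b * m * int n))"
  have inner: "norm (of_nat (U * V) * (\<Sum>m\<in>{1..M}. \<chi> (a * int k + b * int m * int n)))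
      \<le> (\<Sum>u\<in>{1..U}. \<Sum>m\<in>{- int M..int M}. G (\<mu> (k, m, n, u)))" if n: "n \<in> nset a N" for k n
  proof -
    \<comment> \<open>Extension by zero lets \<open>m\<close> run over one and the same range for
      all shifts. Since \<open>u * v \<le> M\<close>, this range contains every shifted copy of
      \<open>1..M\<close>.\<close>
    define F where "F m = (if m \<in> {1..int M} then \<chi> (a * int k + b * m * int n) else 0)" for m :: int
    have shift: "(\<Sum>m\<in>{1..M}. \<chi> (a * int k + b * int m * int n)) = (\<Sum>m\<in>{- int M..int M}. F (m + int u * int v))"
      if uv: "u \<in> {1..U}" "v < V" for u v
    proof -
      have "u * v \<le> U * V" using uv by (intro mult_le_mono) auto
      then have "u * v \<le> M" using UV(1) by linarith
      then have uvM: "int u * int v \<le> int M" "int u * int v \<ge> 0" by (auto simp flip: of_nat_mult)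
      have "(\<Sum>m\<in>{1..M}. \<chi> (a * int k + b * int m * int n)) = (\<Sum>m\<in>{1..int M}. F m)"
        by (rule sum.reindex_bij_witness[where i = nat and j = int]) (auto simp: F_def)
      also have "\<dots> = (\<Sum>m\<in>{1 - int u * int v..int M - int u * int v}. F (m + int u * int v))"
        by (rule sum.reindex_bij_witness[where i = "\<lambda>m. m + int u * int v" and j = "\<lambda>m. m - int u * int v"]) auto
      also have "\<dots> = (\<Sum>m\<in>{- int M..int M}. F (m + int u * int v))"
        by (rule sum.mono_neutral_left) (use uvM in \<open>auto simp: F_def\<close>)
      finally show ?thesis .
    qed
    have "of_nat (U * V) * (\<Sum>m\<in>{1..M}. \<chi> (a * int k + b * int m * int n))
        = (\<Sum>u\<in>{1..U}. \<Sum>v<V. \<Sum>m\<in>{1..M}. \<chi> (a * int k + b * int m * int n))" by simp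
    also have "\<dots> = (\<Sum>u\<in>{1..U}. \<Sum>v<V. \<Sum>m\<in>{- int M..int M}. F (m + int u * int v))"
      by (intro sum.cong refl shift) auto
    also have "\<dots> = (\<Sum>u\<in>{1..U}. \<Sum>m\<in>{- int M..int M}. \<Sum>v<V. F (m + int u * int v))"
      by (rule sum.cong[OF refl], rule sum.swap)
    finally have "norm (of_nat (U * V) * (\<Sum>m\<in>{1..M}. \<chi> (a * int k + b * int m * int n)))
       = norm (\<Sum>u\<in>{1..U}. \<Sum>m\<in>{- int M..int M}. \<Sum>v<V. F (m + int u * int v))" by simp
    also have "\<dots> \<le> (\<Sum>u\<in>{1..U}. \<Sum>m\<in>{- int M..int M}. norm (\<Sum>v<V. F (m + int u * int v)))"
      by (rule order_trans[OF norm_sum], rule sum_mono, rule norm_sum)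
    also have "\<dots> \<le> (\<Sum>u\<in>{1..U}. \<Sum>m\<in>{- int M..int M}. G (\<mu> (k, m, n, u)))"
    proof (intro sum_mono)
      fix u m assume u: "u \<in> {1..U}"
      define x where "x = a * int k + b * m * int n"
      \<comment> \<open>The \<open>v\<close> for which the shifted variable lies in
        \<open>1..M\<close> form an interval depending on \<open>m\<close> and \<open>u\<close>;
        \<open>G\<close> dominates the sums over all subintervals for this reason.\<close>
      define S where "S = {v\<in>{..<V}. m + int u * int v \<in> {1..int M}}"
      obtain n1 n2 where S: "n1 \<le> n2" "n2 \<le> V" "S = {n1..<n2}"
      proof (rule convex_nat_set_interval[of S V])
        show "S \<subseteq> {..<V}" by (auto simp: S_def)
        fix x y z assume xyz: "x \<in> S" "z \<in> S" "x \<le> y" "y \<le> z"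
        have "int u * int x \<le> int u * int y" "int u * int y \<le> int u * int z"
          using xyz by (auto intro!: mult_left_mono)
        then show "y \<in> S" using xyz by (auto simp: S_def)
      qed
      have lx: "[b * int u * int n * int (l u n x) = x] (mod int p)" using l[OF u n] by blast
      have "(\<Sum>v<V. F (m + int u * int v)) = (\<Sum>v\<in>S. \<chi> (a * int k + b * (m + int u * int v) * int n))"
        unfolding S_def F_def by (rule sum.inter_filter[symmetric]) simp
      also have "\<dots> = (\<Sum>v\<in>S. \<chi> (b * int u * int n) * \<chi> (int (l u n x) + int v))"
      proof (intro sum.cong refl)
        fix v
        have "[b * int u * int n * (int (l u n x) + int v) = x + b * int u * int n * int v] (mod int p)"
          using cong_add[OF lx cong_refl, of "b * int u * int n * int v"] by (simp add: distrib_left)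
        then have "\<chi> (b * int u * int n * (int (l u n x) + int v)) = \<chi> (x + b * int u * int n * int v)"
          by (rule dirichlet_character_cong[OF \<chi>])
        moreover have "x + b * int u * int n * int v = a * int k + b * (m + int u * int v) * int n"
          by (simp add: x_def algebra_simps)
        ultimately show "\<chi> (a * int k + b * (m + int u * int v) * int n) = \<chi> (b * int u * int n) * \<chi> (int (l u n x) + int v)"
          by (simp add: dirichlet_character_mult[OF \<chi>])
      qed
      also have "\<dots> = \<chi> (b * int u * int n) * (\<Sum>v\<in>{n1..<n2}. \<chi> (int (l u n x) + int v))"
        by (simp add: sum_distrib_left S(3))
      finally have "norm (\<Sum>v<V. F (m + int u * int v)) = norm (\<chi> (b * int u * int n)) * norm (\<Sum>v\<in>{n1..<n2}. \<chi> (int (l u n x) + int v))"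
        by (simp add: norm_mult)
      also have "\<dots> \<le> 1 * G (l u n x)"
        by (rule mult_mono[OF norm_dirichlet_character_le[OF p \<chi>] G[OF S(1,2)]]) auto
      finally show "norm (\<Sum>v<V. F (m + int u * int v)) \<le> G (\<mu> (k, m, n, u))" by (simp add: \<mu>_def x_def)
    qed
    finally show ?thesis .
  qed
  show thesis
  proof (rule that[of \<mu>])
    fix q assume q: "q \<in> quads a K M N U"
    obtain k m n u where e: "q = (k, m, n, u)" by (cases q) auto
    have un: "u \<in> {1..U}" "n \<in> nset a N" using q unfolding e quads_def by auto
    show "\<mu> q < p" using l[OF un] by (simp add: e \<mu>_def)
    show "[b * int (yval q) * int (\<mu> q) = xval a b q] (mod int p)"
      using l[OF un, of "a * int k + b * m * int n"] by (simp add: e \<mu>_def yval_def xval_def mult.assoc)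
  next
    let ?S = "\<Sum>k\<in>{1..K}. \<Sum>m\<in>{1..M}. \<Sum>n\<in>nset a N. \<beta> k n * \<chi> (a * int k + b * int m * int n)"
    have eqS: "of_nat (U * V) * ?S = (\<Sum>k\<in>{1..K}. \<Sum>n\<in>nset a N. \<beta> k n * (of_nat (U * V) * (\<Sum>m\<in>{1..M}. \<chi> (a * int k + b * int m * int n))))"
    proof -
      have "?S = (\<Sum>k\<in>{1..K}. \<Sum>n\<in>nset a N. \<Sum>m\<in>{1..M}. \<beta> k n * \<chi> (a * int k + b * int m * int n))"
        by (rule sum.cong[OF refl], rule sum.swap)
      also have "\<dots> = (\<Sum>k\<in>{1..K}. \<Sum>n\<in>nset a N. \<beta> k n * (\<Sum>m\<in>{1..M}. \<chi> (a * int k + b * int m * int n)))"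
        by (simp only: sum_distrib_left)
      finally have S: "?S = \<dots>" .
      have "c * (\<Sum>k\<in>{1..K}. \<Sum>n\<in>nset a N. \<beta> k n * Y k n) = (\<Sum>k\<in>{1..K}. \<Sum>n\<in>nset a N. \<beta> k n * (c * Y k n))" for c Y
        unfolding sum_distrib_left by (intro sum.cong refl mult.left_commute)
      then show ?thesis unfolding S .
    qed
    have "real (U * V) * norm ?S = norm (\<Sum>k\<in>{1..K}. \<Sum>n\<in>nset a N. \<beta> k n * (of_nat (U * V) * (\<Sum>m\<in>{1..M}. \<chi> (a * int k + b * int m * int n))))"
      unfolding eqS[symmetric] by (simp only: norm_mult norm_of_nat)
    also have "\<dots> \<le> (\<Sum>k\<in>{1..K}. \<Sum>n\<in>nset a N. norm (\<beta> k n * (of_nat (U * V) * (\<Sum>m\<in>{1..M}. \<chi> (a * int k + b * int m * int n)))))"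
      by (rule order_trans[OF norm_sum], rule sum_mono, rule norm_sum)
    also have "\<dots> \<le> (\<Sum>k\<in>{1..K}. \<Sum>n\<in>nset a N. W * (\<Sum>u\<in>{1..U}. \<Sum>m\<in>{- int M..int M}. G (\<mu> (k, m, n, u))))"
      unfolding norm_mult[of "\<beta> _ _"] by (intro sum_mono mult_mono \<beta> inner W) auto
    also have "\<dots> = W * (\<Sum>q\<in>quads a K M N U. G (\<mu> q))"
    proof -
      have "(\<Sum>q\<in>quads a K M N U. G (\<mu> q)) = (\<Sum>k\<in>{1..K}. \<Sum>m\<in>{- int M..int M}. \<Sum>n\<in>nset a N. \<Sum>u\<in>{1..U}. G (\<mu> (k, m, n, u)))"
        unfolding quads_def by (simp add: sum.cartesian_product case_prod_unfold)
      also have "\<dots> = (\<Sum>k\<in>{1..K}. \<Sum>n\<in>nset a N. \<Sum>u\<in>{1..U}. \<Sum>m\<in>{- int M..int M}. G (\<mu> (k, m, n, u)))"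
        by (rule sum.cong[OF refl], subst sum.swap, rule sum.cong[OF refl], rule sum.swap)
      finally show ?thesis by (simp add: sum_distrib_left)
    qed
    finally show "real (U * V) * norm ?S \<le> W * (\<Sum>q\<in>quads a K M N U. G (\<mu> q))" .
  qed
qed

text \<open>\<open>V = 2 ^ L\<close> is within a factor 2 of
  \<open>P = p powr (1 / (2 * r))\<close>, the length at which both terms of the moment bound have
  order \<open>p * sqrt p\<close>; \<open>U\<close> is as large as \<open>4 * U * V \<le> M\<close>
  permits. In \<open>c\<close>, \<open>96 = 12 * 8\<close> joins the constant of the pair count to
  that of \<open>M \<le> 8 * U * V\<close>, the power of 3 comes from \<open>cardQ\<close>, the
  power of 2 from \<open>P \<le> 2 * V\<close>, and the last factor from the moments. In the
  exponent of \<open>\<Lambda>\<close>, the pair count gives 6 and the moments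
  \<open>2 * r + 1\<close>.\<close>

lemma trilinear_sum_bound:
  fixes \<beta> :: "nat \<Rightarrow> nat \<Rightarrow> complex" and K M N L r p :: nat and a b :: int and \<Lambda> P W :: real
  assumes p: "prime p" "p \<ge> 3" and \<chi>: "dirichlet_character p \<chi>" "\<chi> \<noteq> principal_character p"
    and r: "r \<ge> 1" and ab: "a \<noteq> 0" "b \<noteq> 0" "coprime b (int p)"
    and KMN: "K \<ge> 1" "N \<ge> 1" "M < p" "N < p" "4 * 2 ^ L \<le> M"
    and P: "P ^ (2 * r) = real p" "2 ^ L \<le> P" "P \<le> 2 * 2 ^ L"
    and \<Lambda>: "\<Lambda> \<ge> 1" "\<And>y::nat. 1 \<le> y \<Longrightarrow> y \<le> p\<^sup>2 \<Longrightarrow> real (card {d. d dvd y}) \<le> \<Lambda>"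
      "real (card {c::nat. int c dvd b}) \<le> \<Lambda>" "hsum (p\<^sup>2) \<le> \<Lambda>" "2 * (real L + 1) \<le> \<Lambda>"
    and \<beta>: "\<And>k n. k \<in> {1..K} \<Longrightarrow> n \<in> nset a N \<Longrightarrow> norm (\<beta> k n) \<le> W" and W: "W \<ge> 0"
  defines "c \<equiv> 96 * 3 ^ (2 * (r - 1)) * 2 ^ (2 * r) * (2 * real r + real r ^ (2 * r))"
  shows "norm (\<Sum>k\<in>{1..K}. \<Sum>m\<in>{1..M}. \<Sum>n\<in>nset a N. \<beta> k n * \<chi> (a * int k + b * int m * int n)) ^ (2 * r)
    \<le> W ^ (2 * r) * (c * \<Lambda> ^ (2 * r + 7) * ((real K * real M * real N) ^ (2 * (r - 1)) * (real K * (real K + real N))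
        * (1 + (real_of_int \<bar>a\<bar> * real K + real_of_int \<bar>b\<bar> * real M * real N) * real M * real N / (real p * P)) * (P * sqrt (real p))))"
proof -
  define V where "V = (2::nat) ^ L"
  define U where "U = M div (4 * V)"
  define LL where "LL = real_of_int \<bar>a\<bar> * real K + real_of_int \<bar>b\<bar> * real M * real N"
  define Y where "Y = 1 + LL * real M * real N / (real p * P)"
  define S where "S = (\<Sum>k\<in>{1..K}. \<Sum>m\<in>{1..M}. \<Sum>n\<in>nset a N. \<beta> k n * \<chi> (a * int k + b * int m * int n))"
  define Q where "Q = quads a K M N U"
  define c1 where "c1 = 2 * real r + real r ^ (2 * r)"
  have V: "V \<ge> 1" "real V \<le> P" "P \<le> 2 * real V" "4 * V \<le> M" using P KMN by (auto simp: V_def)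
  have P0: "P > 0" using V by linarith
  have p0: "real p > 0" using p(2) by simp
  have U1: "U \<ge> 1" using V by (simp add: U_def div_greater_zero_iff Suc_le_eq)
  have "4 * (U * V) = M div (4 * V) * (4 * V)" by (simp add: U_def)
  then have UV: "4 * (U * V) \<le> M" using div_times_less_eq_dividend[of M "4 * V"] by (simp only:)
  have UV8: "M \<le> 8 * (U * V)"
  proof -
    have "M < 4 * V * (U + 1)" unfolding U_def using V
      by (metis add.commute div_less_iff_less_mult less_add_one mult.commute mult_pos_pos zero_less_numeral less_le_trans zero_less_one)
    also have "\<dots> \<le> 4 * V * (2 * U)" using U1 by (intro mult_le_mono) auto
    finally show ?thesis by (simp add: ac_simps)
  qed
  have UM: "U \<le> M"
  proof -
    have "U * 1 \<le> U * V" using V(1) by (rule mult_le_mono2)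
    then show ?thesis using UV by linarith
  qed
  have M1: "M \<ge> 1" using V by linarith
  have UNp: "U * N \<le> p\<^sup>2" unfolding power2_eq_square using UM KMN by (intro mult_le_mono) auto
  have LLp: "2 ^ L \<le> p" using KMN(3,5) by linarith
  have LL0: "LL \<ge> 0" by (simp add: LL_def)
  have Y1: "Y \<ge> 1" unfolding Y_def using LL0 P0 by simp
  obtain G :: "nat \<Rightarrow> real" where G: "\<And>x. G x \<ge> 0"
    "\<And>x n1 n2. n1 \<le> n2 \<Longrightarrow> n2 \<le> 2 ^ L \<Longrightarrow> norm (\<Sum>v\<in>{n1..<n2}. \<chi> (int x + int v)) \<le> G x"
    "(\<Sum>x<p. G x ^ (2 * r)) \<le> (2 * (real L + 1)) ^ (2 * r) * (real L + 1) *
        (2 * real r * 2 ^ (2 * r * L) * sqrt (real p) + real r ^ (2 * r) * 2 ^ (r * L) * real p)"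
    using maximal_moment_bound[OF p \<chi> LLp r] by metis
  obtain \<mu> where \<mu>: "\<And>q. q \<in> Q \<Longrightarrow> \<mu> q < p"
    "\<And>q. q \<in> Q \<Longrightarrow> [b * int (yval q) * int (\<mu> q) = xval a b q] (mod int p)"
    "real (U * V) * norm S \<le> W * (\<Sum>q\<in>Q. G (\<mu> q))"
  proof (rule shifted_sum_bound[OF p(1) \<chi>(1) ab(3) UV U1 V(1) KMN(3,4), where G = G and \<beta> = \<beta> and W = W and K = K and a = a])
    show "norm (\<Sum>v\<in>{n1..<n2}. \<chi> (int x + int v)) \<le> G x" if "n1 \<le> n2" "n2 \<le> V" for x n1 n2
      using G(2)[OF that(1)] that(2) by (simp add: V_def)
  qed (use \<beta> W in \<open>auto simp: Q_def S_def\<close>)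
  have hs: "hsum n \<le> \<Lambda>" if "n \<le> p\<^sup>2" for n using hsum_mono[OF that] \<Lambda>(4) by linarith
  have NU: "N \<le> p\<^sup>2" "U \<le> p\<^sup>2"
    using UNp mult_le_mono1[OF U1, of N] mult_le_mono2[OF KMN(2), of U] by linarith+
  have D: "real (card {d. d dvd y}) \<le> \<Lambda>" if "1 \<le> y" "y \<le> U * N" for y using \<Lambda>(2)[of y] that UNp by linarith
  have \<Lambda>0: "\<Lambda> \<ge> 0" using \<Lambda>(1) by simp
  have cardQ: "real (card Q) \<le> 3 * real K * real M * real N * real U"
    unfolding Q_def by (rule card_quads_le[OF ab(1,2) KMN(1) M1 KMN(2) U1 UM D \<Lambda>(3)])
  have J: "real (card {(q1, q2) \<in> Q \<times> Q. \<mu> q1 = \<mu> q2})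
      \<le> 12 * \<Lambda> ^ 6 * Y * (real U * (real K + real N) * (real K * real M))"
  proof -
    have sub: "{(q1, q2) \<in> Q \<times> Q. \<mu> q1 = \<mu> q2} \<subseteq> {(q1, q2) \<in> Q \<times> Q. int p dvd xval a b q1 * int (yval q2) - xval a b q2 * int (yval q1)}"
    proof
      fix z assume z: "z \<in> {(q1, q2) \<in> Q \<times> Q. \<mu> q1 = \<mu> q2}"
      obtain q1 q2 where zq: "z = (q1, q2)" by (cases z)
      have q: "q1 \<in> Q" "q2 \<in> Q" "\<mu> q1 = \<mu> q2" using z by (auto simp: zq)
      have "[b * int (yval q1) * int (\<mu> q1) * int (yval q2) = xval a b q1 * int (yval q2)] (mod int p)"
        by (rule cong_mult[OF \<mu>(2)[OF q(1)] cong_refl])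
      moreover have "[b * int (yval q2) * int (\<mu> q2) * int (yval q1) = xval a b q2 * int (yval q1)] (mod int p)"
        by (rule cong_mult[OF \<mu>(2)[OF q(2)] cong_refl])
      moreover have "b * int (yval q1) * int (\<mu> q1) * int (yval q2) = b * int (yval q2) * int (\<mu> q2) * int (yval q1)"
        using q(3) by simp
      ultimately have "[xval a b q1 * int (yval q2) = xval a b q2 * int (yval q1)] (mod int p)"
        by (metis cong_sym cong_trans)
      then have "int p dvd xval a b q1 * int (yval q2) - xval a b q2 * int (yval q1)" by (simp add: cong_iff_dvd_diff)
      then show "z \<in> {(q1, q2) \<in> Q \<times> Q. int p dvd xval a b q1 * int (yval q2) - xval a b q2 * int (yval q1)}"
        using q by (simp add: zq)
    qed
    have "real (card {(q1, q2) \<in> Q \<times> Q. \<mu> q1 = \<mu> q2}) \<le>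
        real (card {(q1, q2) \<in> Q \<times> Q. int p dvd xval a b q1 * int (yval q2) - xval a b q2 * int (yval q1)})"
      unfolding of_nat_le_iff
      by (rule card_mono[OF _ sub], rule finite_subset[of _ "Q \<times> Q"]) (auto simp: Q_def finite_quads)
    also have "\<dots> \<le> 2 * (4 * LL * real U * real N / real p + 1) * (\<Lambda> * real U * (real K * hsum (U * N) + real N))
        * (3 * real K * real M * \<Lambda> * hsum N * (\<Lambda> * hsum U))"
      unfolding Q_def LL_def
      by (rule card_congruence_pairs[OF ab(1,2) KMN(1) M1 KMN(2) U1 UM D \<Lambda>(3)]) (use p in auto)
    also have "\<dots> \<le> 2 * (2 * Y) * (\<Lambda> * real U * (\<Lambda> * (real K + real N))) * (3 * real K * real M * \<Lambda> * \<Lambda> * (\<Lambda> * \<Lambda>))"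
    proof (intro mult_mono mult_nonneg_nonneg add_nonneg_nonneg order_refl)
      \<comment> \<open>From \<open>4 * U * P \<le> 8 * U * V \<le> 2 * M\<close>: the number of
        multiples of \<open>p\<close> is expressed through \<open>M / P\<close> instead of
        \<open>U\<close>, the shape in which it occurs in \<open>Delta1\<close>.\<close>
      have "4 * LL * real U * real N / real p \<le> 2 * (LL * real M * real N / (real p * P))"
      proof -
        have "4 * real U * P \<le> 4 * real U * (2 * real V)" using V by (intro mult_left_mono) auto
        also have "\<dots> = 2 * real (4 * (U * V))" by simp
        also have "\<dots> \<le> 2 * real M" using UV by (simp only: mult_le_cancel_left_pos of_nat_le_iff zero_less_numeral)
        finally have "LL * real N * (4 * real U * P) \<le> LL * real N * (2 * real M)"
          using LL0 by (intro mult_left_mono) auto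
        then show ?thesis using P0 p0 by (simp add: field_simps)
      qed
      then show "4 * LL * real U * real N / real p + 1 \<le> 2 * Y" using LL0 P0 unfolding Y_def by simp
      have "real K * hsum (U * N) \<le> real K * \<Lambda>" using hs[OF UNp] by (intro mult_left_mono) auto
      moreover have "1 * real N \<le> \<Lambda> * real N" using \<Lambda>(1) by (intro mult_right_mono) auto
      ultimately show "real K * hsum (U * N) + real N \<le> \<Lambda> * (real K + real N)" by (simp add: algebra_simps)
    qed (use hs NU \<Lambda>0 LL0 p0 P0 hsum_nonneg Y1 in \<open>auto intro: order_trans[OF _ Y1]\<close>)
    also have "\<dots> = 12 * \<Lambda> ^ 6 * Y * (real U * (real K + real N) * (real K * real M))"
      by (simp add: power_numeral_reduce algebra_simps)
    finally show ?thesis .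
  qed
  have GG: "(\<Sum>x<p. G x ^ (2 * r)) \<le> \<Lambda> ^ (2 * r + 1) * (c1 * (real p * sqrt (real p)))"
  proof -
    have v1: "(2::real) ^ (2 * r * L) \<le> real p"
    proof -
      have "(2::real) ^ (2 * r * L) = real V ^ (2 * r)" by (simp add: V_def mult.commute flip: power_mult)
      also have "\<dots> \<le> P ^ (2 * r)" using V by (intro power_mono) auto
      finally show ?thesis using P(1) by simp
    qed
    have v2: "(2::real) ^ (r * L) \<le> sqrt (real p)"
    proof (rule real_le_rsqrt)
      have "2 * r * L = r * L * 2" by simp
      then show "((2::real) ^ (r * L))\<^sup>2 \<le> real p" using v1 by (metis power_mult)
    qed
    have "(\<Sum>x<p. G x ^ (2 * r)) \<le> (2 * (real L + 1)) ^ (2 * r) * (real L + 1) *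
        (2 * real r * 2 ^ (2 * r * L) * sqrt (real p) + real r ^ (2 * r) * 2 ^ (r * L) * real p)" by (rule G(3))
    also have "\<dots> \<le> \<Lambda> ^ (2 * r) * \<Lambda> * (2 * real r * real p * sqrt (real p) + real r ^ (2 * r) * sqrt (real p) * real p)"
      using \<Lambda>(5) \<Lambda>0 v1 v2 by (intro mult_mono add_mono power_mono mult_nonneg_nonneg add_nonneg_nonneg) auto
    also have "\<dots> = \<Lambda> ^ (2 * r + 1) * (c1 * (real p * sqrt (real p)))" by (simp add: c1_def algebra_simps)
    finally show ?thesis .
  qed
  have main: "real (U * V) ^ (2 * r) * norm S ^ (2 * r) \<le> W ^ (2 * r) *
     ((3 * real K * real M * real N * real U) ^ (2 * (r - 1)) * (12 * \<Lambda> ^ 6 * Y * (real U * (real K + real N) * (real K * real M)))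
       * (\<Lambda> ^ (2 * r + 1) * (c1 * (real p * sqrt (real p)))))"
  proof -
    have "(real (U * V) * norm S) ^ (2 * r) \<le> (W * (\<Sum>q\<in>Q. G (\<mu> q))) ^ (2 * r)"
      using \<mu>(3) by (intro power_mono) auto
    also have "\<dots> = W ^ (2 * r) * (\<Sum>q\<in>Q. G (\<mu> q)) ^ (2 * r)" by (rule power_mult_distrib)
    also have "(\<Sum>q\<in>Q. G (\<mu> q)) ^ (2 * r) \<le> real (card Q) ^ (2 * (r - 1)) * real (card {(q1, q2) \<in> Q \<times> Q. \<mu> q1 = \<mu> q2}) * (\<Sum>x<p. G x ^ (2 * r))"
      by (rule holder_multiplicity) (use \<mu>(1) G(1) r in \<open>auto simp: Q_def finite_quads\<close>)
    also have "\<dots> \<le> (3 * real K * real M * real N * real U) ^ (2 * (r - 1)) * (12 * \<Lambda> ^ 6 * Y * (real U * (real K + real N) * (real K * real M)))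
       * (\<Lambda> ^ (2 * r + 1) * (c1 * (real p * sqrt (real p))))"
      using cardQ J GG G(1) \<Lambda>0 Y1
      by (intro mult_mono power_mono mult_nonneg_nonneg sum_nonneg zero_le_power) auto
    finally show ?thesis using W by (simp add: power_mult_distrib mult_left_mono)
  qed
  define Z where "Z = (real K * real M * real N) ^ (2 * (r - 1)) * (real K * (real K + real N)) * Y"
  have Z0: "Z \<ge> 0" unfolding Z_def using Y1 by simp
  have c10: "c1 \<ge> 0" by (simp add: c1_def)
  have rr: "2 * r = 2 * (r - 1) + 2" using r by simp
  have Ur: "real U ^ (2 * r) = real U ^ (2 * (r - 1)) * (real U * real U)"
    by (subst rr) (simp add: power_add power2_eq_square)
  \<comment> \<open>On the left \<open>U\<close> occurs to the power \<open>2 * r\<close>, on the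
    right to the power \<open>2 * r - 1\<close>; the powers are split so that the common part can be
    cancelled and one \<open>U\<close> survives on the left.\<close>
  have "real V ^ (2 * r) * (real U * real U) * real U ^ (2 * (r - 1)) * norm S ^ (2 * r)
      \<le> W ^ (2 * r) * (12 * 3 ^ (2 * (r - 1)) * c1 * \<Lambda> ^ (2 * r + 7) * Z * (real M * (real p * sqrt (real p)))) * real U * real U ^ (2 * (r - 1))"
  proof -
    have "real V ^ (2 * r) * (real U * real U) * real U ^ (2 * (r - 1)) * norm S ^ (2 * r) = real (U * V) ^ (2 * r) * norm S ^ (2 * r)"
      unfolding of_nat_mult power_mult_distrib Ur by (simp only: ac_simps)
    also note main
    also have "W ^ (2 * r) *
     ((3 * real K * real M * real N * real U) ^ (2 * (r - 1)) * (12 * \<Lambda> ^ 6 * Y * (real U * (real K + real N) * (real K * real M)))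
       * (\<Lambda> ^ (2 * r + 1) * (c1 * (real p * sqrt (real p)))))
     = W ^ (2 * r) * (12 * 3 ^ (2 * (r - 1)) * c1 * \<Lambda> ^ (2 * r + 7) * Z * (real M * (real p * sqrt (real p)))) * real U * real U ^ (2 * (r - 1))"
    proof -
      have "2 * r + 7 = 6 + (2 * r + 1)" by simp
      then have "\<Lambda> ^ (2 * r + 7) = \<Lambda> ^ 6 * \<Lambda> ^ (2 * r + 1)" by (metis power_add)
      then show ?thesis unfolding Z_def power_mult_distrib by (simp only: ac_simps)
    qed
    finally show ?thesis .
  qed
  then have "real V ^ (2 * r) * real U * norm S ^ (2 * r)
      \<le> W ^ (2 * r) * (12 * 3 ^ (2 * (r - 1)) * c1 * \<Lambda> ^ (2 * r + 7) * Z * (real M * (real p * sqrt (real p))))"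
  proof -
    assume le: "real V ^ (2 * r) * (real U * real U) * real U ^ (2 * (r - 1)) * norm S ^ (2 * r)
      \<le> W ^ (2 * r) * (12 * 3 ^ (2 * (r - 1)) * c1 * \<Lambda> ^ (2 * r + 7) * Z * (real M * (real p * sqrt (real p)))) * real U * real U ^ (2 * (r - 1))"
    have pos: "real U * real U ^ (2 * (r - 1)) > 0" using U1 by simp
    show ?thesis
    proof (rule mult_right_le_imp_le[OF _ pos])
      show "real V ^ (2 * r) * real U * norm S ^ (2 * r) * (real U * real U ^ (2 * (r - 1)))
        \<le> W ^ (2 * r) * (12 * 3 ^ (2 * (r - 1)) * c1 * \<Lambda> ^ (2 * r + 7) * Z * (real M * (real p * sqrt (real p)))) * (real U * real U ^ (2 * (r - 1)))"
        using le by (simp only: ac_simps)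
    qed
  qed
  \<comment> \<open>One \<open>M\<close> is traded for \<open>8 * U * P\<close> and \<open>p\<close>
    for \<open>(2 * V) ^ (2 * r)\<close>, so that \<open>V ^ (2 * r) * U\<close> appears on the
    right and can be cancelled.\<close>
  also have "\<dots> \<le> W ^ (2 * r) * (12 * 3 ^ (2 * (r - 1)) * c1 * \<Lambda> ^ (2 * r + 7) * Z *
      ((8 * real U * P) * (2 ^ (2 * r) * real V ^ (2 * r) * sqrt (real p))))"
  proof (intro mult_left_mono mult_mono)
    have "real M \<le> real (8 * (U * V))" using UV8 by (simp only: of_nat_le_iff)
    also have "\<dots> = 8 * real U * real V" by simp
    also have "\<dots> \<le> 8 * real U * P" using V by (intro mult_left_mono) auto
    finally show "real M \<le> 8 * real U * P" .
    have "real p \<le> (2 * real V) ^ (2 * r)" unfolding P(1)[symmetric] using V P0 by (intro power_mono) auto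
    then show "real p \<le> 2 ^ (2 * r) * real V ^ (2 * r)" by (simp only: power_mult_distrib)
  qed (use P0 c10 \<Lambda>0 Z0 W in auto)
  also have "\<dots> = real V ^ (2 * r) * real U * (W ^ (2 * r) * (c * \<Lambda> ^ (2 * r + 7) * (Z * (P * sqrt (real p)))))"
    by (simp add: c_def c1_def[symmetric])
  finally have "real V ^ (2 * r) * real U * norm S ^ (2 * r)
     \<le> real V ^ (2 * r) * real U * (W ^ (2 * r) * (c * \<Lambda> ^ (2 * r + 7) * (Z * (P * sqrt (real p)))))" .
  moreover have "real V ^ (2 * r) * real U > 0" using V(1) U1 by simp
  ultimately have "norm S ^ (2 * r) \<le> W ^ (2 * r) * (c * \<Lambda> ^ (2 * r + 7) * (Z * (P * sqrt (real p))))"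
    by (rule mult_left_le_imp_le)
  then show ?thesis unfolding S_def Z_def Y_def LL_def .
qed

section \<open>The trilinear sum\<close>

lemma pos_upto_eq: "x \<ge> 0 \<Longrightarrow> pos_upto x = {1..nat \<lfloor>x\<rfloor>}"
  by (auto simp: pos_upto_def le_nat_floor nat_le_iff le_floor_iff) (metis le_floor_iff le_nat_iff of_int_of_nat_eq zero_le_floor)

lemma card_pos_upto_le: "x \<ge> 0 \<Longrightarrow> real (card (pos_upto x)) \<le> x"
  by (simp add: pos_upto_eq)

lemma weight_norm_upper:
  assumes "K \<ge> 0" "N \<ge> 0" "k \<in> pos_upto K" "n \<in> pos_upto N"
  shows "norm (\<beta> k n) \<le> weight_norm K N \<beta>"
proof -
  have eq: "{norm (\<beta> k n) | k n. k \<in> pos_upto K \<and> n \<in> pos_upto N}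
     = (\<lambda>(k, n). norm (\<beta> k n)) ` (pos_upto K \<times> pos_upto N)" by auto
  have "finite (pos_upto K \<times> pos_upto N)" using assms by (simp add: pos_upto_eq)
  then show ?thesis unfolding weight_norm_def eq using assms(3,4) by (intro Max_ge) auto
qed

lemma powr_inverse_power: "x \<ge> 0 \<Longrightarrow> n \<ge> 1 \<Longrightarrow> (x powr (1 / real n)) ^ n = x"
  by (cases "x = 0") (auto simp: powr_powr simp flip: powr_realpow)

text \<open>Relates \<open>Delta1\<close> to the output of \<open>trilinear_sum_bound\<close>. The
  last factor of \<open>Delta1\<close> has exponent \<open>1 / (4 * r)\<close>, but its base is the
  square of \<open>sqrt p * P / (M ^ 2 * N ^ 2)\<close>, so all three factors are
  \<open>2 * r\<close>-th roots.\<close>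

lemma Delta1_power:
  fixes K M N :: real and r p :: nat
  assumes "r \<ge> 1" "K > 0" "M > 0" "N > 0" "p \<ge> 1"
  defines "P \<equiv> real p powr (1 / (2 * real r))"
  shows "(K * M * N * Delta1 p r a b K M N) ^ (2 * r)
     = (K * M * N) ^ (2 * (r - 1)) * (K * (K + N)) * (1 + L1 a b K M N * M * N / (real p * P)) * (P * sqrt (real p))"
proof -
  define Y where "Y = 1 + L1 a b K M N * M * N / (real p * P)"
  have p: "real p > 0" using assms(5) by simp
  have P0: "P > 0" using p by (simp add: P_def)
  have L0: "L1 a b K M N \<ge> 0" using assms by (simp add: L1_def)
  have Y: "1 + L1 a b K M N * M * N * real p powr (- 1 - 1 / (2 * real r)) = Y"
  proof -
    have "real p powr (- 1 - 1 / (2 * real r)) = 1 / (real p * P)"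
    proof -
      have "- 1 - 1 / (2 * real r) = - (1 + 1 / (2 * real r))" by simp
      then have "real p powr (- 1 - 1 / (2 * real r)) = inverse (real p powr 1 * P)"
        unfolding P_def by (simp only: powr_minus powr_add)
      then show ?thesis using p by (simp add: inverse_eq_divide)
    qed
    then show ?thesis by (simp add: Y_def)
  qed
  have Y0: "Y \<ge> 0" unfolding Y_def using L0 P0 assms by simp
  have e: "(x powr (1 / (2 * real r))) ^ (2 * r) = x" if "x \<ge> 0" for x
    using powr_inverse_power[OF that, of "2 * r"] assms(1) by simp
  have PP: "P * P = real p powr (1 / real r)" unfolding P_def by (simp flip: powr_add)
  have "real p powr (1 + 1 / real r) / (M ^ 4 * N ^ 4) = (sqrt (real p) * P / (M\<^sup>2 * N\<^sup>2))\<^sup>2"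
  proof -
    have "(sqrt (real p) * P)\<^sup>2 = real p powr (1 + 1 / real r)"
      using p by (simp add: powr_add PP[symmetric] power_mult_distrib power2_eq_square[of P])
    moreover have "(M\<^sup>2 * N\<^sup>2)\<^sup>2 = M ^ 4 * N ^ 4" by (simp add: power_mult_distrib flip: power_mult)
    ultimately show ?thesis by (simp only: power_divide)
  qed
  then have "(real p powr (1 + 1 / real r) / (M ^ 4 * N ^ 4)) powr (1 / (4 * real r))
     = ((sqrt (real p) * P / (M\<^sup>2 * N\<^sup>2)) powr 2) powr (1 / (4 * real r))"
    using P0 by (simp add: powr_numeral)
  also have "\<dots> = (sqrt (real p) * P / (M\<^sup>2 * N\<^sup>2)) powr (1 / (2 * real r))"
    by (simp add: powr_powr)
  finally have R: "(real p powr (1 + 1 / real r) / (M ^ 4 * N ^ 4)) powr (1 / (4 * real r))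
     = (sqrt (real p) * P / (M\<^sup>2 * N\<^sup>2)) powr (1 / (2 * real r))" .
  have "Delta1 p r a b K M N ^ (2 * r) = (1 + N / K) * Y * (sqrt (real p) * P / (M\<^sup>2 * N\<^sup>2))"
  proof -
    have "((1 + N / K) powr (1 / (2 * real r))) ^ (2 * r) = 1 + N / K" by (rule e) (use assms in simp)
    moreover have "(Y powr (1 / (2 * real r))) ^ (2 * r) = Y" by (rule e[OF Y0])
    moreover have "((sqrt (real p) * P / (M\<^sup>2 * N\<^sup>2)) powr (1 / (2 * real r))) ^ (2 * r) = sqrt (real p) * P / (M\<^sup>2 * N\<^sup>2)"
      by (rule e) (use P0 in simp)
    ultimately show ?thesis unfolding Delta1_def Y R power_mult_distrib by (simp only:)
  qed
  moreover have "2 * r = 2 * (r - 1) + 2" using assms(1) by simp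
  then have "(K * M * N) ^ (2 * r) = (K * M * N) ^ (2 * (r - 1)) * (K * M * N)\<^sup>2" by (metis power_add)
  ultimately have "(K * M * N * Delta1 p r a b K M N) ^ (2 * r)
    = (K * M * N) ^ (2 * (r - 1)) * ((K * M * N)\<^sup>2 * ((1 + N / K) * Y * (sqrt (real p) * P / (M\<^sup>2 * N\<^sup>2))))"
    by (simp add: power_mult_distrib[of "K * M * N"])
  also have "(K * M * N)\<^sup>2 * ((1 + N / K) * Y * (sqrt (real p) * P / (M\<^sup>2 * N\<^sup>2))) = (K * (K + N)) * Y * (P * sqrt (real p))"
  proof -
    have cancel: "K * K * z * (w * y * (t / z)) = K * (K * w) * y * t" if "z \<noteq> 0" for z w y t :: real
      using that by simp
    have "(K * M * N)\<^sup>2 = K * K * (M\<^sup>2 * N\<^sup>2)" by (simp add: power_mult_distrib power2_eq_square[of K])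
    moreover have "K * (1 + N / K) = K + N" using assms(2) by (simp add: distrib_left)
    moreover have "M\<^sup>2 * N\<^sup>2 \<noteq> 0" using assms(3,4) by simp
    ultimately show ?thesis using cancel[of "M\<^sup>2 * N\<^sup>2" "1 + N / K" Y "sqrt (real p) * P"]
      by (simp only: mult.commute[of P] simp_thms)
  qed
  finally show ?thesis unfolding Y_def by (simp only: mult.assoc)
qed

text \<open>The \<open>n\<close> are grouped by \<open>h = gcd(n, a)\<close>; the cofactor of
  \<open>h\<close> in \<open>n\<close> is then prime to \<open>a div int h\<close>. This yields the
  ranges \<open>nset\<close> on which the counting of the congruence relies.\<close>

lemma split_by_gcd:
  fixes f :: "nat \<Rightarrow> 'b::comm_monoid_add" and a :: int
  assumes "a \<noteq> 0"
  shows "(\<Sum>n\<in>{1..N}. f n) = (\<Sum>h\<in>{h\<in>{1..N}. int h dvd a}. \<Sum>n\<in>nset (a div int h) (N div h). f (h * n))"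
proof -
  define H where "H = {h\<in>{1..N}. int h dvd a}"
  define g where "g n = nat (gcd (int n) a)" for n
  have g: "int (g n) = gcd (int n) a" for n by (simp add: g_def)
  have gn: "g n dvd n" for n by (metis g gcd_dvd1 of_nat_dvd_iff)
  have "(\<Sum>n\<in>{1..N}. f n) = (\<Sum>h\<in>H. \<Sum>n\<in>{n\<in>{1..N}. g n = h}. f n)"
  proof (rule sum.group[symmetric])
    show "g ` {1..N} \<subseteq> H"
    proof
      fix h assume "h \<in> g ` {1..N}"
      then obtain n where n: "n \<in> {1..N}" "h = g n" by auto
      have "g n \<le> n" using gn[of n] n by (intro dvd_imp_le) auto
      moreover have "g n > 0" using gn[of n] n by (auto intro: gr0I)
      moreover have "int (g n) dvd a" by (simp add: g)
      ultimately show "h \<in> H" using n by (simp add: H_def)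
    qed
  qed (auto simp: H_def)
  also have "\<dots> = (\<Sum>h\<in>H. \<Sum>n\<in>nset (a div int h) (N div h). f (h * n))"
  proof (rule sum.cong[OF refl])
    fix h assume "h \<in> H"
    then have h: "h \<ge> 1" "int h dvd a" by (auto simp: H_def)
    obtain a' where a': "a = int h * a'" using h(2) by (elim dvdE)
    have adiv: "a div int h = a'" using h(1) a' by simp
    have gh: "g (h * n) = h * nat (gcd (int n) a')" for n
      unfolding g_def a' by (simp add: nat_mult_distrib flip: gcd_mult_distrib_int)
    have iff: "g (h * n) = h \<longleftrightarrow> coprime (int n) a'" for n
      using h(1) unfolding gh coprime_iff_gcd_eq_1 by (auto simp: nat_eq_iff)
    show "(\<Sum>n\<in>{n\<in>{1..N}. g n = h}. f n) = (\<Sum>n\<in>nset (a div int h) (N div h). f (h * n))"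
    proof (rule sum.reindex_bij_witness[where i = "\<lambda>n. h * n" and j = "\<lambda>n. n div h"])
      fix n assume n: "n \<in> {n\<in>{1..N}. g n = h}"
      then have "h dvd n" using gn[of n] by simp
      then have e: "h * (n div h) = n" by simp
      then show "h * (n div h) = n" .
      show "f (h * (n div h)) = f n" by (simp only: e)
      have "n div h \<noteq> 0"
      proof
        assume "n div h = 0"
        then show False using e n by simp
      qed
      moreover have "n div h \<le> N div h" using n by (intro div_le_mono) simp
      moreover have "coprime (int (n div h)) a'" using iff[of "n div h"] n e by simp
      ultimately show "n div h \<in> nset (a div int h) (N div h)" by (simp add: nset_def adiv)
    next
      fix n assume n: "n \<in> nset (a div int h) (N div h)"
      then have n': "1 \<le> n" "n \<le> N div h" "coprime (int n) a'" by (auto simp: nset_def adiv)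
      have "h * n \<le> h * (N div h)" using n'(2) by (rule mult_le_mono2)
      also have "\<dots> \<le> N" by simp
      finally have "h * n \<le> N" .
      then show "h * n \<in> {n\<in>{1..N}. g n = h}" using n' h iff[of n] by simp
      show "h * n div h = n" using h by simp
    qed
  qed
  finally show ?thesis by (simp only: H_def)
qed

theorem theorem2p1:
  fixes r :: nat and \<epsilon> :: real
  assumes "r \<ge> 1" and "\<epsilon> > 0"
  shows "\<exists>p0::nat. \<forall>p::nat. prime p \<and> p \<ge> p0 \<longrightarrow>
    (\<forall>(\<chi>::int \<Rightarrow> complex) (a::int) (b::int) (K::real) (M::real) (N::real)
       (\<beta>::nat \<Rightarrow> nat \<Rightarrow> complex).
       dirichlet_character p \<chi> \<and> \<chi> \<noteq> principal_character p \<and>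
       gcd (a * b) (int p) = 1 \<and>
       K > 1 \<and> M > 1 \<and> N > 1 \<and> real p > Max {K, M, N} \<and>
       M > 4 * real p powr (1 / (2 * real r)) \<longrightarrow>
       norm (char_sum \<chi> a b K M N \<beta>)
         \<le> weight_norm K N \<beta> * K * M * N * Delta1 p r a b K M N * real p powr \<epsilon>)"
proof -
  \<comment> \<open>With \<open>\<Lambda> = p powr \<delta>\<close>, each of the sums
    \<open>S h\<close> below costs \<open>\<Lambda> ^ 6\<close> and the number of the
    \<open>h\<close> one more factor.\<close>
  define \<delta> where "\<delta> = \<epsilon> / 7"
  have \<delta>: "\<delta> > 0" using assms(2) by (simp add: \<delta>_def)
  \<comment> \<open>The divisor bound will be applied up to \<open>p ^ 3\<close>, where exponent
    \<open>\<delta> / 6\<close> gives \<open>p powr (\<delta> / 2)\<close>. The other half of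
    \<open>\<Lambda>\<close> is kept for the constants.\<close>
  obtain C where C: "C \<ge> 1" "\<And>n::nat. n \<ge> 1 \<Longrightarrow> real (card {d. d dvd n}) \<le> C * real n powr (\<delta> / 6)"
    using divisor_bound[of "\<delta> / 6"] \<delta> by auto
  define c where "c = 96 * 3 ^ (2 * (r - 1)) * 2 ^ (2 * r) * (2 * real r + real r ^ (2 * r))"
  have c0: "c \<ge> 0" by (simp add: c_def)
  \<comment> \<open>The sum dominates each constant that \<open>p powr (\<delta> / 2)\<close> has to
    absorb: that of the divisor bound, that of \<open>trilinear_sum_bound\<close>, and the one
    needed for logarithms of \<open>p\<close>.\<close>
  define C0 where "C0 = C + c + 8 / \<delta> + 2"
  have C0: "C0 > 0" using C(1) c0 \<delta> by (simp add: C0_def add_pos_pos add_nonneg_pos)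
  define p0 where "p0 = nat \<lceil>C0 powr (2 / \<delta>)\<rceil> + 3"
  show ?thesis
  proof (intro exI[of _ p0] allI impI, elim conjE)
    fix p :: nat and \<chi> :: "int \<Rightarrow> complex" and a b :: int and K M N :: real and \<beta> :: "nat \<Rightarrow> nat \<Rightarrow> complex"
    assume p: "prime p" and pp0: "p0 \<le> p" and \<chi>: "dirichlet_character p \<chi>" "\<chi> \<noteq> principal_character p"
      and gcd: "gcd (a * b) (int p) = 1" and K: "1 < K" and M: "1 < M" and N: "1 < N"
      and Max: "Max {K, M, N} < real p" and M4: "4 * real p powr (1 / (2 * real r)) < M"
    have p3: "p \<ge> 3" using pp0 by (simp add: p0_def)
    have lt: "K < real p" "M < real p" "N < real p" using Max by auto
    define \<Lambda> where "\<Lambda> = real p powr \<delta>"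
    define P where "P = real p powr (1 / (2 * real r))"
    define W where "W = weight_norm K N \<beta>"
    have p1: "real p \<ge> 1" using p3 by simp
    have half: "C0 \<le> real p powr (\<delta> / 2)"
    proof -
      have "C0 powr (2 / \<delta>) \<le> real p" using pp0 unfolding p0_def by linarith
      then have "(C0 powr (2 / \<delta>)) powr (\<delta> / 2) \<le> real p powr (\<delta> / 2)" using \<delta> by (intro powr_mono2) auto
      then show ?thesis using C0 \<delta> by (simp add: powr_powr)
    qed
    have half\<Lambda>: "real p powr (\<delta> / 2) * real p powr (\<delta> / 2) = \<Lambda>" unfolding \<Lambda>_def by (simp flip: powr_add)
    have half1: "real p powr (\<delta> / 2) \<ge> 1" using p1 \<delta> by (intro ge_one_powr_ge_zero) auto
    have le\<Lambda>: "x * real p powr (\<delta> / 2) \<le> \<Lambda>" if "x \<le> C0" for x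
      unfolding half\<Lambda>[symmetric] using that half by (intro mult_right_mono) auto
    have \<Lambda>1: "\<Lambda> \<ge> 1" unfolding \<Lambda>_def using p1 \<delta> by (intro ge_one_powr_ge_zero) auto
    have c\<Lambda>: "c \<le> \<Lambda>"
    proof -
      have "c * 1 \<le> c * real p powr (\<delta> / 2)" using c0 half1 by (rule mult_left_mono[rotated])
      also have "\<dots> \<le> \<Lambda>" by (rule le\<Lambda>) (use C(1) \<delta> in \<open>simp add: C0_def\<close>)
      finally show ?thesis by simp
    qed
    have div\<Lambda>: "real (card {d. d dvd y}) \<le> \<Lambda>" if y: "1 \<le> y" "real y \<le> real p ^ 3" for y :: nat
    proof -
      have "real y powr (\<delta> / 6) \<le> (real p ^ 3) powr (\<delta> / 6)" using y \<delta> by (intro powr_mono2) auto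
      also have "real p ^ 3 = real p powr 3" using p1 by (simp add: powr_numeral)
      also have "(real p powr 3) powr (\<delta> / 6) = real p powr (\<delta> / 2)" by (subst powr_powr) simp
      finally have "C * real y powr (\<delta> / 6) \<le> C * real p powr (\<delta> / 2)" using C(1) by (intro mult_left_mono) auto
      also have "\<dots> \<le> \<Lambda>" by (rule le\<Lambda>) (use c0 \<delta> in \<open>simp add: C0_def\<close>)
      finally show ?thesis using C(2)[OF y(1)] by linarith
    qed
    have ln\<Lambda>: "4 * ln (real p) + 2 \<le> \<Lambda>"
    proof -
      have "ln (real p) \<le> real p powr (\<delta> / 2) / (\<delta> / 2)" using p1 \<delta> by (intro ln_powr_bound) auto
      then have "4 * ln (real p) \<le> 8 / \<delta> * real p powr (\<delta> / 2)" using \<delta> by (simp add: field_simps)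
      then have "4 * ln (real p) + 2 \<le> (8 / \<delta> + 2) * real p powr (\<delta> / 2)" using half1 by (simp add: distrib_right)
      also have "\<dots> \<le> \<Lambda>" by (rule le\<Lambda>) (use c0 C(1) in \<open>simp add: C0_def\<close>)
      finally show ?thesis .
    qed
    have W: "norm (\<beta> k n) \<le> W" if "k \<in> pos_upto K" "n \<in> pos_upto N" for k n
      unfolding W_def using K N that by (intro weight_norm_upper) auto
    have W0: "W \<ge> 0"
    proof -
      have "1 \<in> pos_upto K" "1 \<in> pos_upto N" using K N by (auto simp: pos_upto_def)
      from W[OF this] show ?thesis using norm_ge_zero order_trans by blast
    qed
    have \<Delta>0: "Delta1 p r a b K M N \<ge> 0" by (simp add: Delta1_def)
    define \<Phi> where "\<Phi> = (K * M * N) ^ (2 * (r - 1)) * (K * (K + N)) * (1 + L1 a b K M N * M * N / (real p * P)) * (P * sqrt (real p))"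
    have \<Phi>: "(K * M * N * Delta1 p r a b K M N) ^ (2 * r) = \<Phi>"
      unfolding \<Phi>_def P_def by (rule Delta1_power) (use assms K M N p3 in auto)
    have P1: "P \<ge> 1" unfolding P_def using p1 by (intro ge_one_powr_ge_zero) auto
    have P2r: "P ^ (2 * r) = real p"
      unfolding P_def using powr_inverse_power[of "real p" "2 * r"] assms(1) by simp
    have L10: "L1 a b K M N \<ge> 0" using K M N by (simp add: L1_def)
    show "norm (char_sum \<chi> a b K M N \<beta>) \<le> weight_norm K N \<beta> * K * M * N * Delta1 p r a b K M N * real p powr \<epsilon>"
    proof (cases "L1 a b K M N \<ge> real p ^ 3") \<comment> \<open>outside this trivial range the divisor bound applies to \<open>a\<close> and \<open>b\<close>\<close>
      case True
      have "norm (char_sum \<chi> a b K M N \<beta>) \<le> (\<Sum>k\<in>pos_upto K. \<Sum>m\<in>pos_upto M. \<Sum>n\<in>pos_upto N. W * 1)"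
        unfolding char_sum_def
      proof (intro sum_norm_le)
        fix k m n assume "k \<in> pos_upto K" "n \<in> pos_upto N"
        then show "norm (\<beta> k n * \<chi> (a * int k + b * int m * int n)) \<le> W * 1"
          unfolding norm_mult using W W0 norm_dirichlet_character_le[OF p \<chi>(1)] by (intro mult_mono) auto
      qed
      also have "\<dots> = W * (real (card (pos_upto K)) * real (card (pos_upto M)) * real (card (pos_upto N)))" by simp
      also have "\<dots> \<le> W * (K * M * N)"
        using K M N W0 card_pos_upto_le by (intro mult_left_mono mult_mono) auto
      also have "\<dots> \<le> W * (K * M * N) * (Delta1 p r a b K M N * real p powr \<epsilon>)"
      proof -
        \<comment> \<open>Compared in \<open>2 * r\<close>-th powers. Here
          \<open>M * N * sqrt p \<le> p ^ 3 \<le> L1\<close>, hence \<open>(M * N) ^ 2\<close> is at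
          most the middle factor of \<open>\<Phi>\<close> times \<open>P * sqrt p\<close>, and
          \<open>K * K \<le> K * (K + N)\<close> does the rest.\<close>
        have "1 \<le> Delta1 p r a b K M N"
        proof (rule ccontr)
          assume "\<not> 1 \<le> Delta1 p r a b K M N"
          then have "K * M * N * Delta1 p r a b K M N < K * M * N" using K M N by simp
          then have "\<Phi> < (K * M * N) ^ (2 * r)" unfolding \<Phi>[symmetric]
            using \<Delta>0 K M N assms(1) by (intro power_strict_mono) auto
          also have "\<dots> = (K * M * N) ^ (2 * (r - 1)) * (K * M * N)\<^sup>2"
          proof -
            have "2 * r = 2 * (r - 1) + 2" using assms(1) by simp
            then show ?thesis by (metis power_add)
          qed
          also have "(K * M * N)\<^sup>2 \<le> (K * (K + N)) * (1 + L1 a b K M N * M * N / (real p * P)) * (P * sqrt (real p))"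
          proof -
            have "(M * N) * (sqrt (real p) * real p) \<le> (real p * real p) * (real p * real p)"
            proof (intro mult_mono)
              show "sqrt (real p) \<le> real p" using p1 by (intro real_le_lsqrt) (auto simp: power2_eq_square)
            qed (use lt M N in auto)
            also have "\<dots> \<le> real p * L1 a b K M N" using True p1 by (simp add: power3_eq_cube mult.assoc)
            finally have "M * N * sqrt (real p) \<le> L1 a b K M N" using p1 by (simp add: mult.assoc[symmetric] mult.commute[of "real p"])
            then have "M * N * sqrt (real p) * sqrt (real p) \<le> L1 a b K M N * sqrt (real p)" by (rule mult_right_mono) simp
            then have "M * N * real p \<le> L1 a b K M N * sqrt (real p)" by (simp add: mult.assoc)
            then have "(M * N) * (M * N * real p) \<le> (M * N) * (L1 a b K M N * sqrt (real p))" using M N by (intro mult_left_mono) auto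
            then have "(M * N)\<^sup>2 \<le> L1 a b K M N * M * N / (real p * P) * (P * sqrt (real p))"
              using p1 P1 by (simp add: field_simps power2_eq_square)
            also have "\<dots> \<le> (1 + L1 a b K M N * M * N / (real p * P)) * (P * sqrt (real p))"
              using P1 by (intro mult_right_mono) auto
            finally have 1: "(M * N)\<^sup>2 \<le> (1 + L1 a b K M N * M * N / (real p * P)) * (P * sqrt (real p))" .
            have "K * K \<le> K * (K + N)" using K N by (intro mult_left_mono) auto
            then have "(K * K) * (M * N)\<^sup>2 \<le> (K * (K + N)) * ((1 + L1 a b K M N * M * N / (real p * P)) * (P * sqrt (real p)))"
              using 1 K N by (intro mult_mono) auto
            then show ?thesis by (simp add: power2_eq_square ac_simps)
          qed
          then have "(K * M * N) ^ (2 * (r - 1)) * (K * M * N)\<^sup>2 \<le> \<Phi>"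
            unfolding \<Phi>_def mult.assoc[of "(K * M * N) ^ (2 * (r - 1))"]
            using K M N by (intro mult_left_mono) (auto simp: mult.assoc)
          finally show False by simp
        qed
        moreover have "1 \<le> real p powr \<epsilon>" using p1 assms(2) by (intro ge_one_powr_ge_zero) auto
        ultimately have "1 * 1 \<le> Delta1 p r a b K M N * real p powr \<epsilon>" by (intro mult_mono) auto
        then have "W * (K * M * N) * 1 \<le> W * (K * M * N) * (Delta1 p r a b K M N * real p powr \<epsilon>)"
          using W0 K M N by (intro mult_left_mono) auto
        then show ?thesis by simp
      qed
      finally show ?thesis by (simp add: W_def mult.assoc)
    next
      case False
      define K0 where "K0 = nat \<lfloor>K\<rfloor>"
      define M0 where "M0 = nat \<lfloor>M\<rfloor>"
      define N0 where "N0 = nat \<lfloor>N\<rfloor>"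
      have pos: "pos_upto K = {1..K0}" "pos_upto M = {1..M0}" "pos_upto N = {1..N0}"
        using K M N by (auto simp: pos_upto_eq K0_def M0_def N0_def)
      have le: "real K0 \<le> K" "real M0 \<le> M" "real N0 \<le> N" using K M N by (auto simp: K0_def M0_def N0_def)
      have ge1: "K0 \<ge> 1" "M0 \<ge> 1" "N0 \<ge> 1" using K M N by (auto simp: K0_def M0_def N0_def le_nat_floor)
      have ltp: "M0 < p" "N0 < p" using le lt by linarith+
      have "coprime (a * b) (int p)" using gcd by (simp add: coprime_iff_gcd_eq_1)
      then have cb: "coprime b (int p)" by simp
      have nz: "a \<noteq> 0" "b \<noteq> 0" using gcd p3 by auto
      have ab3: "real_of_int \<bar>a\<bar> \<le> real p ^ 3" "real_of_int \<bar>b\<bar> \<le> real p ^ 3"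
      proof -
        have "real_of_int \<bar>a\<bar> * 1 \<le> real_of_int \<bar>a\<bar> * K" using K by (intro mult_left_mono) auto
        moreover have "real_of_int \<bar>b\<bar> * (1 * 1) \<le> real_of_int \<bar>b\<bar> * (M * N)" using M N by (intro mult_left_mono mult_mono) auto
        moreover have "0 \<le> real_of_int \<bar>a\<bar> * K" "0 \<le> real_of_int \<bar>b\<bar> * (M * N)" using K M N by auto
        ultimately show "real_of_int \<bar>a\<bar> \<le> real p ^ 3" "real_of_int \<bar>b\<bar> \<le> real p ^ 3"
          using False unfolding L1_def mult.assoc by linarith+
      qed
      have intdiv: "real (card {d::nat. int d dvd z}) \<le> \<Lambda>" if "z \<noteq> 0" "real_of_int \<bar>z\<bar> \<le> real p ^ 3" for z
      proof -
        have "{d::nat. int d dvd z} = {d. d dvd nat \<bar>z\<bar>}" by (auto simp: nat_abs_dvd_iff)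
        then show ?thesis using div\<Lambda>[of "nat \<bar>z\<bar>"] that by simp
      qed
      \<comment> \<open>\<open>2 ^ L\<close> is the largest power of two not exceeding
        \<open>P\<close>. The hypothesis \<open>M > 4 * P\<close> gives
        \<open>4 * 2 ^ L \<le> M\<close>, and the left side being an integer, the same holds for the
        integer part of \<open>M\<close>; this ensures \<open>U \<ge> 1\<close> later.\<close>
      obtain L where L: "2 ^ L \<le> P" "P \<le> 2 * 2 ^ L" "4 * 2 ^ L \<le> M0"
      proof -
        have "1 \<le> nat \<lfloor>P\<rfloor>" using P1 by (simp add: le_nat_floor)
        then obtain L where L: "2 ^ L \<le> nat \<lfloor>P\<rfloor>" "nat \<lfloor>P\<rfloor> < 2 ^ (L + 1)"
          using ex_power_ivl1[of 2 "nat \<lfloor>P\<rfloor>"] by auto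
        have "real (2 ^ L) \<le> real (nat \<lfloor>P\<rfloor>)" using L(1) by (simp only: of_nat_le_iff)
        also have "\<dots> \<le> P" using P1 by simp
        finally have 1: "2 ^ L \<le> P" by simp
        have "nat \<lfloor>P\<rfloor> + 1 \<le> 2 ^ (L + 1)" using L(2) by simp
        then have "real (nat \<lfloor>P\<rfloor> + 1) \<le> real (2 ^ (L + 1))" by (simp only: of_nat_le_iff)
        then have "P \<le> 2 * 2 ^ L" using P1 by simp linarith
        moreover have "real (4 * 2 ^ L) \<le> M" using 1 M4 by (simp add: P_def)
        then have "4 * 2 ^ L \<le> M0" unfolding M0_def by (rule le_nat_floor)
        ultimately show ?thesis using that 1 by blast
      qed
      have L\<Lambda>: "2 * (real L + 1) \<le> \<Lambda>"
      proof -
        have "P \<le> real p" unfolding P_def using p1 assms(1) powr_mono[of "1 / (2 * real r)" 1 "real p"] by simp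
        then have "2 ^ L \<le> real p" using L(1) by linarith
        then have "ln (2 ^ L) \<le> ln (real p)" using p1 by (intro ln_mono) auto
        then have "real L * ln 2 \<le> ln (real p)" by (simp add: ln_realpow)
        moreover have "real L * (1 / 2) \<le> real L * ln 2" using exp_half_le2 ln_ge_iff[of 2 "1 / 2"] by (intro mult_left_mono) auto
        ultimately have "real L \<le> 2 * ln (real p)" by linarith
        then have "2 * (real L + 1) \<le> 4 * ln (real p) + 2" by simp
        then show ?thesis using ln\<Lambda> by (rule order_trans)
      qed
      have hs\<Lambda>: "hsum (p\<^sup>2) \<le> \<Lambda>"
      proof -
        have "hsum (p\<^sup>2) \<le> 1 + ln (real (p\<^sup>2))" using p3 by (intro hsum_le_ln) simp
        also have "ln (real (p\<^sup>2)) = 2 * ln (real p)" using p3 by (simp add: ln_realpow)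
        finally show ?thesis using ln\<Lambda> p1 ln_ge_zero[OF p1] by linarith
      qed
      define H where "H = {h\<in>{1..N0}. int h dvd a}"
      define S where "S h = (\<Sum>k\<in>{1..K0}. \<Sum>m\<in>{1..M0}. \<Sum>n\<in>nset (a div int h) (N0 div h).
          \<beta> k (h * n) * \<chi> ((a div int h) * int k + b * int m * int n))" for h
      \<comment> \<open>For \<open>gcd(n, a) = h\<close> the whole argument of \<open>\<chi>\<close>
        is divisible by \<open>h\<close>, so \<open>\<chi> (int h)\<close> factors out and leaves a
        sum with \<open>a div int h\<close> and a shorter range of \<open>n\<close>.\<close>
      have split: "char_sum \<chi> a b K M N \<beta> = (\<Sum>h\<in>H. \<chi> (int h) * S h)"
      proof -
        have "char_sum \<chi> a b K M N \<beta> = (\<Sum>k\<in>{1..K0}. \<Sum>m\<in>{1..M0}. \<Sum>h\<in>H. \<Sum>n\<in>nset (a div int h) (N0 div h).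
          \<beta> k (h * n) * \<chi> (a * int k + b * int m * int (h * n)))"
          unfolding char_sum_def pos H_def by (intro sum.cong refl split_by_gcd nz(1))
        also have "\<dots> = (\<Sum>k\<in>{1..K0}. \<Sum>m\<in>{1..M0}. \<Sum>h\<in>H. \<chi> (int h) * (\<Sum>n\<in>nset (a div int h) (N0 div h).
          \<beta> k (h * n) * \<chi> ((a div int h) * int k + b * int m * int n)))"
          unfolding sum_distrib_left
        proof (intro sum.cong refl)
          fix k m h n assume "h \<in> H"
          then have "a = int h * (a div int h)" by (simp add: H_def)
          then have "a * int k + b * int m * int (h * n) = int h * ((a div int h) * int k + b * int m * int n)"
            by (metis (no_types, opaque_lifting) distrib_left mult.assoc mult.left_commute of_nat_mult)
          then show "\<beta> k (h * n) * \<chi> (a * int k + b * int m * int (h * n)) = \<chi> (int h) * (\<beta> k (h * n) * \<chi> ((a div int h) * int k + b * int m * int n))"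
            by (simp only: dirichlet_character_mult[OF \<chi>(1)] mult.left_commute)
        qed
        also have "\<dots> = (\<Sum>h\<in>H. \<chi> (int h) * S h)"
          unfolding S_def sum_distrib_left[of "\<chi> (int _)" _ "{1..K0}"] sum_distrib_left[of "\<chi> (int _)" _ "{1..M0}"]
          by (subst sum.swap, rule sum.swap[THEN trans], intro sum.cong refl)
        finally show ?thesis .
      qed
      have Sh: "norm (S h) \<le> W * (K * M * N * Delta1 p r a b K M N) * \<Lambda> ^ 6" if h: "h \<in> H" for h
      proof -
        have h': "1 \<le> h" "h \<le> N0" "int h dvd a" using h by (auto simp: H_def)
        define a' where "a' = a div int h"
        have aa: "a = int h * a'" using h'(3) by (simp add: a'_def)
        have a'0: "a' \<noteq> 0" using nz aa by auto
        have N'1: "1 \<le> N0 div h" using h' by (simp add: div_greater_zero_iff Suc_le_eq)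
        have N'le: "N0 div h \<le> N0" by simp
        define LL where "LL = real_of_int \<bar>a'\<bar> * real K0 + real_of_int \<bar>b\<bar> * real M0 * real (N0 div h)"
        define \<Phi>h where "\<Phi>h = (real K0 * real M0 * real (N0 div h)) ^ (2 * (r - 1)) * (real K0 * (real K0 + real (N0 div h)))
          * (1 + LL * real M0 * real (N0 div h) / (real p * P)) * (P * sqrt (real p))"
        have "norm (S h) ^ (2 * r) \<le> W ^ (2 * r) * (c * \<Lambda> ^ (2 * r + 7) * \<Phi>h)"
          unfolding S_def c_def \<Phi>h_def LL_def a'_def[symmetric]
        proof (rule trilinear_sum_bound[OF p p3 \<chi> assms(1) a'0 nz(2) cb ge1(1) N'1 ltp(1) _ L(3) P2r L(1,2) \<Lambda>1 _ _ hs\<Lambda> L\<Lambda>])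
          show "N0 div h < p" using N'le ltp by linarith
          show "real (card {d. d dvd y}) \<le> \<Lambda>" if "1 \<le> y" "y \<le> p\<^sup>2" for y
          proof (rule div\<Lambda>[OF that(1)])
            have "real y \<le> real (p\<^sup>2)" using that(2) by (simp only: of_nat_le_iff)
            also have "\<dots> \<le> real p ^ 3" using p1 by (simp add: power_increasing)
            finally show "real y \<le> real p ^ 3" .
          qed
          show "real (card {c::nat. int c dvd b}) \<le> \<Lambda>" by (rule intdiv[OF nz(2) ab3(2)])
          show "norm (\<beta> k (h * n)) \<le> W" if "k \<in> {1..K0}" "n \<in> nset a' (N0 div h)" for k n
          proof (rule W)
            show "k \<in> pos_upto K" using that(1) by (simp add: pos)
            have "1 \<le> n" "n \<le> N0 div h" using that(2) by (auto simp: nset_def)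
            then have "h * n \<le> h * (N0 div h)" by (intro mult_le_mono2)
            also have "\<dots> \<le> N0" by simp
            finally show "h * n \<in> pos_upto N" unfolding pos using h' \<open>1 \<le> n\<close> by simp
          qed
          show "0 \<le> W" by (rule W0)
        qed
        also have "\<dots> \<le> W ^ (2 * r) * (\<Lambda> * \<Lambda> ^ (2 * r + 7) * \<Phi>)"
        proof (intro mult_left_mono mult_mono c\<Lambda>)
          have a'a: "\<bar>a'\<bar> \<le> \<bar>a\<bar>"
          proof -
            have "1 * \<bar>a'\<bar> \<le> int h * \<bar>a'\<bar>" using h'(1) by (intro mult_right_mono) auto
            then show ?thesis by (simp add: aa abs_mult)
          qed
          have N'N: "real (N0 div h) \<le> N" using N'le le(3) by (meson of_nat_le_iff order_trans)
          have LL: "LL \<le> L1 a b K M N" unfolding LL_def L1_def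
            using a'a le N'N K M N by (intro add_mono mult_mono) auto
          \<comment> \<open>\<open>\<Phi>\<close> increases with \<open>K\<close>, \<open>M\<close>,
            \<open>N\<close> and \<open>L1\<close>. Integer parts and division by \<open>h\<close>
            only shrink these, so every \<open>h\<close> gets the same bound.\<close>
          show "\<Phi>h \<le> \<Phi>" unfolding \<Phi>h_def \<Phi>_def
            using le N'N LL L10 K M N P1 p1
            by (intro mult_mono add_mono power_mono divide_right_mono order_refl)
              (auto intro!: mult_nonneg_nonneg add_nonneg_nonneg divide_nonneg_nonneg zero_le_power simp: LL_def)
          show "0 \<le> \<Phi>h" unfolding \<Phi>h_def LL_def using P1 by (auto intro!: mult_nonneg_nonneg add_nonneg_nonneg)
        qed (use \<Lambda>1 W0 c0 in auto)
        also have "\<dots> \<le> W ^ (2 * r) * (\<Lambda> ^ (6 * (2 * r)) * \<Phi>)"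
        proof (intro mult_left_mono mult_right_mono)
          \<comment> \<open>The extra factor \<open>\<Lambda>\<close> has absorbed \<open>c\<close>.
            From \<open>r \<ge> 1\<close> follows \<open>2 * r + 8 \<le> 6 * (2 * r)\<close>, so
            \<open>\<Lambda> ^ 6\<close> is what remains after taking the \<open>2 * r\<close>-th
            root, uniformly in \<open>r\<close>.\<close>
          have "\<Lambda> * \<Lambda> ^ (2 * r + 7) = \<Lambda> ^ (2 * r + 8)" by (simp add: power_add[symmetric] numeral_eq_Suc)
          also have "\<dots> \<le> \<Lambda> ^ (6 * (2 * r))" using \<Lambda>1 assms(1) by (intro power_increasing) auto
          finally show "\<Lambda> * \<Lambda> ^ (2 * r + 7) \<le> \<Lambda> ^ (6 * (2 * r))" .
          show "0 \<le> \<Phi>" unfolding \<Phi>[symmetric] by simp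
        qed (use W0 in auto)
        also have "\<dots> = (W * (K * M * N * Delta1 p r a b K M N) * \<Lambda> ^ 6) ^ (2 * r)"
          unfolding \<Phi>[symmetric] power_mult power_mult_distrib by simp
        finally have pow: "norm (S h) ^ (2 * r) \<le> (W * (K * M * N * Delta1 p r a b K M N) * \<Lambda> ^ 6) ^ (2 * r)" .
        show ?thesis
        proof (rule ccontr)
          assume "\<not> ?thesis"
          then have "(W * (K * M * N * Delta1 p r a b K M N) * \<Lambda> ^ 6) ^ (2 * r) < norm (S h) ^ (2 * r)"
            using assms(1) W0 K M N \<Delta>0 \<Lambda>1 by (intro power_strict_mono) auto
          then show False using pow by simp
        qed
      qed
      have "norm (char_sum \<chi> a b K M N \<beta>) \<le> (\<Sum>h\<in>H. W * (K * M * N * Delta1 p r a b K M N) * \<Lambda> ^ 6)"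
        unfolding split
      proof (rule sum_norm_le)
        fix h assume h: "h \<in> H"
        have "norm (\<chi> (int h)) * norm (S h) \<le> 1 * (W * (K * M * N * Delta1 p r a b K M N) * \<Lambda> ^ 6)"
          using norm_dirichlet_character_le[OF p \<chi>(1)] Sh[OF h] by (intro mult_mono) auto
        then show "norm (\<chi> (int h) * S h) \<le> W * (K * M * N * Delta1 p r a b K M N) * \<Lambda> ^ 6" by (simp add: norm_mult)
      qed
      also have "\<dots> = real (card H) * (W * (K * M * N * Delta1 p r a b K M N) * \<Lambda> ^ 6)" by simp
      also have "\<dots> \<le> \<Lambda> * (W * (K * M * N * Delta1 p r a b K M N) * \<Lambda> ^ 6)"
      proof (rule mult_right_mono)
        have "finite {d::nat. int d dvd a}"
          by (rule finite_subset[of _ "{..nat \<bar>a\<bar>}"]) (use nz in \<open>auto dest!: dvd_imp_le_int\<close>)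
        then have "card H \<le> card {d::nat. int d dvd a}" by (intro card_mono) (auto simp: H_def)
        then show "real (card H) \<le> \<Lambda>" using intdiv[OF nz(1) ab3(1)] by linarith
      qed (use W0 K M N \<Delta>0 \<Lambda>1 in auto)
      also have "\<dots> = W * K * M * N * Delta1 p r a b K M N * \<Lambda> ^ 7"
        by (simp add: power_numeral_reduce ac_simps)
      also have "\<Lambda> ^ 7 = real p powr \<epsilon>"
      proof -
        have "\<Lambda> ^ 7 = \<Lambda> powr 7" using \<Lambda>1 by (simp add: powr_numeral)
        then show ?thesis by (simp add: \<Lambda>_def powr_powr \<delta>_def)
      qed
      finally show ?thesis by (simp add: W_def)
    qed
  qed
qed

end
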